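(* Let $\mathcal{A}$ be the Bresse operator on the Hilbert space $\mathcal{H}=\left(H^1_0(0,L)\times L^2(0,L)\right)^3$ defined in the context. The $C_0$-semigroup of contractions $\left(e^{t\mathcal{A}}\right)_{t\geq 0}$ generated by $\mathcal{A}$ is strongly stable in $\mathcal{H}$; i.e., for all $U_0\in\mathcal{H}$, the solution $U(t)=e^{t\mathcal{A}}U_0$ of $U_t=\mathcal{A}U$, $U(0)=U_0$, satisfies $$\lim_{t\to+\infty}\|e^{t\mathcal{A}}U_0\|_{\mathcal{H}}=0.$$
   Context: Let $\rho_1,\rho_2,k_1,k_2,k_3,l,L$ be positive real numbers, let $0<\alpha<\beta<L$ and $d_0>0$, and let $d(x)=d_0$ for $x\in(\alpha,\beta)$ and $d(x)=0$ for $x\in(0,\alpha)\cup(\beta,L)$. All functions are complex-valued; the subscript $x$ denotes the (distributional) derivative in $x$. The Hilbert space $\mathcal{H}=\left(H^1_0(0,L)\times L^2(0,L)\right)^3$, with elements $U=(v^1,v^2,v^3,v^4,v^5,v^6)^\top$ ($v^1,v^3,v^5\in H^1_0(0,L)$, $v^2,v^4,v^6\in L^2(0,L)$), carries the inner product associated with the norm (equivalent to the usual one) $$\|U\|_{\mathcal{H}}^2=\int_0^L\left(k_1|v^1_x+v^3+lv^5|^2+\rho_1|v^2|^2+k_2|v^3_x|^2+\rho_2|v^4|^2+k_3|v^5_x-lv^1|^2+\rho_1|v^6|^2\right)dx.$$ The unbounded linear operator $\mathcal{A}:D(\mathcal{A})\subset\mathcal{H}\to\mathcal{H}$ has domain $$D(\mathcal{A})=\left\{U\in\mathcal{H}\;:\;v^1,v^3\in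 H^2(0,L)\cap H^1_0(0,L),\ v^2,v^4,v^6\in H^1_0(0,L),\ \left[k_3v^5_x+d(x)(v^6_x-lv^2)\right]_x\in L^2(0,L)\right\}$$ and acts by $$\mathcal{A}U=\begin{pmatrix}v^2\\ \frac{k_1}{\rho_1}(v^1_x+v^3+lv^5)_x+\frac{lk_3}{\rho_1}(v^5_x-lv^1)+\frac{l d(x)}{\rho_1}(v^6_x-lv^2)\\ v^4\\ \frac{k_2}{\rho_2}v^3_{xx}-\frac{k_1}{\rho_2}(v^1_x+v^3+lv^5)\\ v^6\\ \frac{1}{\rho_1}\left[k_3(v^5_x-lv^1)+d(x)(v^6_x-lv^2)\right]_x-\frac{lk_1}{\rho_1}(v^1_x+v^3+lv^5)\end{pmatrix}.$$ The operator $\mathcal{A}$ is m-dissipative and hence generates a $C_0$-semigroup of contractions $e^{t\mathcal{A}}$ on $\mathcal{H}$. *)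

theory Defs
  imports "HOL-Analysis.Analysis"
begin

section \<open>Complex vector spaces\<close>

class scaleC = scaleR +
  fixes scaleC :: "complex \<Rightarrow> 'a \<Rightarrow> 'a"  (infixr \<open>*\<^sub>C\<close> 75)
  assumes scaleR_scaleC: "scaleR r = scaleC (complex_of_real r)"

class complex_vector = scaleC + ab_group_add +
  assumes scaleC_add_right: "a *\<^sub>C (x + y) = a *\<^sub>C x + a *\<^sub>C y"
    and scaleC_add_left: "(a + b) *\<^sub>C x = a *\<^sub>C x + b *\<^sub>C x"
    and scaleC_scaleC: "a *\<^sub>C b *\<^sub>C x = (a * b) *\<^sub>C x"
    and scaleC_one: "1 *\<^sub>C x = x"

subclass (in complex_vector) real_vector
  by standard
    (simp_all add: scaleR_scaleC scaleC_add_right scaleC_add_left scaleC_scaleC scaleC_one)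

instantiation prod :: (complex_vector, complex_vector) complex_vector
begin

definition scaleC_prod :: "complex \<Rightarrow> 'a \<times> 'b \<Rightarrow> 'a \<times> 'b"
  where "scaleC_prod c p = (c *\<^sub>C fst p, c *\<^sub>C snd p)"

instance
  by standard
    (auto simp: scaleC_prod_def scaleR_prod_def scaleR_scaleC scaleC_add_right
      scaleC_add_left scaleC_scaleC scaleC_one fun_eq_iff)

end


section \<open>The space $L^2$\<close>

definition sq_integrable :: "(real \<Rightarrow> complex) \<Rightarrow> bool"
  where "sq_integrable f \<longleftrightarrow>
    f \<in> borel_measurable lborel \<and> integrable lborel (\<lambda>x. (cmod (f x))\<^sup>2)"

definition L2_rel :: "(real \<Rightarrow> complex) \<Rightarrow> (real \<Rightarrow> complex) \<Rightarrow> bool"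
  where "L2_rel f g \<longleftrightarrow> sq_integrable f \<and> sq_integrable g \<and> (AE x in lborel. f x = g x)"

lemma sq_integrable_zero: "sq_integrable (\<lambda>x. 0)"
  by (simp add: sq_integrable_def)

lemma sq_integrable_scale:
  assumes "sq_integrable f" shows "sq_integrable (\<lambda>x. c * f x)"
  using assms by (auto simp: sq_integrable_def norm_mult power_mult_distrib)

lemma sq_integrable_add:
  assumes "sq_integrable f" "sq_integrable g" shows "sq_integrable (\<lambda>x. f x + g x)"
proof -
  have [measurable]: "f \<in> borel_measurable lborel" "g \<in> borel_measurable lborel"
    using assms by (auto simp: sq_integrable_def)
  have "integrable lborel (\<lambda>x. 2 * (cmod (f x))\<^sup>2 + 2 * (cmod (g x))\<^sup>2)"
    using assms by (auto simp: sq_integrable_def)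
  then have "integrable lborel (\<lambda>x. (cmod (f x + g x))\<^sup>2)"
  proof (rule Bochner_Integration.integrable_bound)
    have "(cmod (f x + g x))\<^sup>2 \<le> 2 * (cmod (f x))\<^sup>2 + 2 * (cmod (g x))\<^sup>2" for x
    proof -
      have "(cmod (f x + g x))\<^sup>2 \<le> (cmod (f x) + cmod (g x))\<^sup>2"
        by (intro power_mono norm_triangle_ineq norm_ge_zero)
      also have "\<dots> \<le> 2 * (cmod (f x))\<^sup>2 + 2 * (cmod (g x))\<^sup>2"
        using sum_squares_bound[of "cmod (f x)" "cmod (g x)"] by (simp add: power2_sum)
      finally show ?thesis .
    qed
    then show "AE x in lborel. norm ((cmod (f x + g x))\<^sup>2)
        \<le> norm (2 * (cmod (f x))\<^sup>2 + 2 * (cmod (g x))\<^sup>2)"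
      by simp
  qed measurable
  then show ?thesis
    by (simp add: sq_integrable_def)
qed

text \<open>The space $L^2(\mathbb{R};\mathbb{C})$ of classes modulo equality almost everywhere.\<close>

quotient_type L2 = "real \<Rightarrow> complex" / partial: L2_rel
proof (rule part_equivpI)
  show "\<exists>f. L2_rel f f"
    using sq_integrable_zero by (auto simp: L2_rel_def)
  show "symp L2_rel"
    by (auto simp: symp_def L2_rel_def elim: eventually_mono)
  show "transp L2_rel"
    unfolding transp_def L2_rel_def by (auto elim: eventually_elim2)
qed

instantiation L2 :: complex_vector
begin

lift_definition zero_L2 :: L2 is "\<lambda>x. 0"
  by (simp add: L2_rel_def sq_integrable_zero)

lift_definition plus_L2 :: "L2 \<Rightarrow> L2 \<Rightarrow> L2" is "\<lambda>f g x. f x + g x"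
  by (auto simp: L2_rel_def sq_integrable_add elim: eventually_elim2)

lift_definition scaleC_L2 :: "complex \<Rightarrow> L2 \<Rightarrow> L2" is "\<lambda>c f x. c * f x"
  by (auto simp: L2_rel_def sq_integrable_scale elim: eventually_mono)

definition scaleR_L2 :: "real \<Rightarrow> L2 \<Rightarrow> L2"
  where "scaleR_L2 r u = complex_of_real r *\<^sub>C u"

definition uminus_L2 :: "L2 \<Rightarrow> L2"
  where "uminus_L2 u = (-1) *\<^sub>C u"

definition minus_L2 :: "L2 \<Rightarrow> L2 \<Rightarrow> L2"
  where "minus_L2 u v = u + - v" for u v :: L2

instance
proof
  fix a b :: complex and r :: real and x y z :: L2
  show "x + y + z = x + (y + z)"
    by transfer (auto simp: L2_rel_def add.assoc intro!: sq_integrable_add)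
  show "x + y = y + x"
    by transfer (auto simp: L2_rel_def add.commute intro!: sq_integrable_add)
  show "0 + x = x"
    by transfer (auto simp: L2_rel_def)
  show "- x + x = 0"
    unfolding uminus_L2_def
    by transfer (use sq_integrable_scale[of _ "-1"] in
      \<open>auto simp: L2_rel_def intro!: sq_integrable_zero\<close>)
  show "x - y = x + - y"
    by (rule minus_L2_def)
  show "scaleR r = (scaleC (complex_of_real r) :: L2 \<Rightarrow> L2)"
    by (rule ext) (rule scaleR_L2_def)
  show "a *\<^sub>C (x + y) = a *\<^sub>C x + a *\<^sub>C y"
    by transfer (auto simp: L2_rel_def distrib_left[symmetric]
      intro!: sq_integrable_add sq_integrable_scale)
  show "(a + b) *\<^sub>C x = a *\<^sub>C x + b *\<^sub>C x"
    by transfer (auto simp: L2_rel_def distrib_right[symmetric]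
      intro!: sq_integrable_add sq_integrable_scale)
  show "a *\<^sub>C b *\<^sub>C x = (a * b) *\<^sub>C x"
    by transfer (auto simp: L2_rel_def mult.assoc[symmetric] intro!: sq_integrable_scale)
  show "1 *\<^sub>C x = x"
    by transfer (auto simp: L2_rel_def)
qed

end

text \<open>Multiplication by a bounded measurable function.\<close>

definition fn_mult :: "(real \<Rightarrow> real) \<Rightarrow> L2 \<Rightarrow> L2"  (infixr \<open>\<odot>\<close> 75)
  where "d \<odot> u = abs_L2 (\<lambda>x. complex_of_real (d x) * rep_L2 u x)"

text \<open>
  $L^2(0,L)$ is identified with the subspace of $L^2(\mathbb{R})$ of the functions that vanish
  almost everywhere outside $(0,L)$.
\<close>

definition L2_on :: "real \<Rightarrow> L2 set"
  where "L2_on L = {u. AE x in lborel. x \<notin> {0<..<L} \<longrightarrow> rep_L2 u x = 0}"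


section \<open>Sobolev spaces on $(0,L)$\<close>

definition smooth_fun :: "(real \<Rightarrow> complex) \<Rightarrow> bool"
  where "smooth_fun \<phi> \<longleftrightarrow>
    (\<exists>D. D 0 = \<phi> \<and> (\<forall>n x. (D n has_vector_derivative D (Suc n) x) (at x)))"

text \<open>$C_c^\infty(0,L)$\<close>

definition test_fun :: "real \<Rightarrow> (real \<Rightarrow> complex) \<Rightarrow> bool"
  where "test_fun L \<phi> \<longleftrightarrow>
    smooth_fun \<phi> \<and> (\<exists>a b. 0 < a \<and> b < L \<and> (\<forall>x. x \<notin> {a..b} \<longrightarrow> \<phi> x = 0))"

definition has_weak_deriv :: "real \<Rightarrow> L2 \<Rightarrow> L2 \<Rightarrow> bool"
  where "has_weak_deriv L u w \<longleftrightarrow> u \<in> L2_on L \<and> w \<in> L2_on L \<and>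
    (\<forall>\<phi>. test_fun L \<phi> \<longrightarrow>
      (LBINT x:{0<..<L}. rep_L2 u x * vector_derivative \<phi> (at x))
        = - (LBINT x:{0<..<L}. rep_L2 w x * \<phi> x))"

definition weak_deriv :: "real \<Rightarrow> L2 \<Rightarrow> L2"
  where "weak_deriv L u = (THE w. has_weak_deriv L u w)"

definition H1 :: "real \<Rightarrow> L2 set"
  where "H1 L = {u. \<exists>w. has_weak_deriv L u w}"

definition H2 :: "real \<Rightarrow> L2 set"
  where "H2 L = {u \<in> H1 L. weak_deriv L u \<in> H1 L}"

text \<open>The closure of $C_c^\infty(0,L)$ in $H^1(0,L)$.\<close>

definition H10 :: "real \<Rightarrow> L2 set"
  where "H10 L = {u \<in> H1 L. \<forall>\<epsilon>>0. \<exists>\<phi>. test_fun L \<phi> \<and>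
    (LBINT x:{0<..<L}. (cmod (rep_L2 u x - \<phi> x))\<^sup>2
      + (cmod (rep_L2 (weak_deriv L u) x - vector_derivative \<phi> (at x)))\<^sup>2) < \<epsilon>}"


section \<open>Semigroups\<close>

text \<open>
  The space is a linear subspace \<open>X\<close> of a complex vector space together with a norm \<open>N\<close> on \<open>X\<close>.
\<close>

definition C0_contraction_semigroup ::
    "'a::complex_vector set \<Rightarrow> ('a \<Rightarrow> real) \<Rightarrow> (real \<Rightarrow> 'a \<Rightarrow> 'a) \<Rightarrow> bool"
  where "C0_contraction_semigroup X N T \<longleftrightarrow>
    (\<forall>t\<ge>0. \<forall>u\<in>X. T t u \<in> X) \<and>
    (\<forall>t\<ge>0. \<forall>u\<in>X. \<forall>v\<in>X. T t (u + v) = T t u + T t v) \<and>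
    (\<forall>t\<ge>0. \<forall>c. \<forall>u\<in>X. T t (c *\<^sub>C u) = c *\<^sub>C T t u) \<and>
    (\<forall>u\<in>X. T 0 u = u) \<and>
    (\<forall>s\<ge>0. \<forall>t\<ge>0. \<forall>u\<in>X. T (s + t) u = T s (T t u)) \<and>
    (\<forall>u\<in>X. ((\<lambda>t. N (T t u - u)) \<longlongrightarrow> 0) (at_right 0)) \<and>
    (\<forall>t\<ge>0. \<forall>u\<in>X. N (T t u) \<le> N u)"

text \<open>
  The unbounded operator \<open>A\<close> with domain \<open>D\<close> is the infinitesimal generator: the right-hand side
  is the graph of \<open>u \<mapsto> lim (T h u - u) / h\<close>, defined where this limit exists in \<open>(X, N)\<close>.
\<close>

definition is_generator ::
    "'a::complex_vector set \<Rightarrow> ('a \<Rightarrow> real) \<Rightarrow> (real \<Rightarrow> 'a \<Rightarrow> 'a) \<Rightarrow> 'a set \<Rightarrow> ('a \<Rightarrow> 'a) \<Rightarrow> bool"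
  where "is_generator X N T D A \<longleftrightarrow>
    {(u, A u) | u. u \<in> D} =
    {(u, w). u \<in> X \<and> w \<in> X \<and>
      ((\<lambda>h. N ((1 / h) *\<^sub>R (T h u - u) - w)) \<longlongrightarrow> 0) (at_right 0)}"


section \<open>The Bresse system\<close>

type_synonym state = "L2 \<times> L2 \<times> L2 \<times> L2 \<times> L2 \<times> L2"

definition damping :: "real \<Rightarrow> real \<Rightarrow> real \<Rightarrow> real \<Rightarrow> real"
  where "damping \<alpha> \<beta> d0 x = (if \<alpha> < x \<and> x < \<beta> then d0 else 0)"

definition bresse_space :: "real \<Rightarrow> state set"
  where "bresse_space L = H10 L \<times> L2_on L \<times> H10 L \<times> L2_on L \<times> H10 L \<times> L2_on L"

fun bresse_norm ::
    "real \<Rightarrow> real \<Rightarrow> real \<Rightarrow> real \<Rightarrow> real \<Rightarrow> real \<Rightarrow> real \<Rightarrow> state \<Rightarrow> real"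
  where "bresse_norm \<rho>1 \<rho>2 k1 k2 k3 l L (v1, v2, v3, v4, v5, v6) =
    sqrt (LBINT x:{0<..<L}.
        k1 * (cmod (rep_L2 (weak_deriv L v1 + v3 + l *\<^sub>R v5) x))\<^sup>2
      + \<rho>1 * (cmod (rep_L2 v2 x))\<^sup>2
      + k2 * (cmod (rep_L2 (weak_deriv L v3) x))\<^sup>2
      + \<rho>2 * (cmod (rep_L2 v4 x))\<^sup>2
      + k3 * (cmod (rep_L2 (weak_deriv L v5 - l *\<^sub>R v1) x))\<^sup>2
      + \<rho>1 * (cmod (rep_L2 v6 x))\<^sup>2)"

definition bresse_dom :: "real \<Rightarrow> real \<Rightarrow> real \<Rightarrow> (real \<Rightarrow> real) \<Rightarrow> state set"
  where "bresse_dom k3 l L d = {(v1, v2, v3, v4, v5, v6) | v1 v2 v3 v4 v5 v6.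
    (v1, v2, v3, v4, v5, v6) \<in> bresse_space L \<and>
    v1 \<in> H2 L \<inter> H10 L \<and> v3 \<in> H2 L \<inter> H10 L \<and>
    v2 \<in> H10 L \<and> v4 \<in> H10 L \<and> v6 \<in> H10 L \<and>
    k3 *\<^sub>R weak_deriv L v5 + d \<odot> (weak_deriv L v6 - l *\<^sub>R v2) \<in> H1 L}"

fun bresse_op ::
    "real \<Rightarrow> real \<Rightarrow> real \<Rightarrow> real \<Rightarrow> real \<Rightarrow> real \<Rightarrow> real \<Rightarrow> (real \<Rightarrow> real) \<Rightarrow> state \<Rightarrow> state"
  where "bresse_op \<rho>1 \<rho>2 k1 k2 k3 l L d (v1, v2, v3, v4, v5, v6) =
    (v2,
     (k1 / \<rho>1) *\<^sub>R weak_deriv L (weak_deriv L v1 + v3 + l *\<^sub>R v5)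
       + (l * k3 / \<rho>1) *\<^sub>R (weak_deriv L v5 - l *\<^sub>R v1)
       + (l / \<rho>1) *\<^sub>R (d \<odot> (weak_deriv L v6 - l *\<^sub>R v2)),
     v4,
     (k2 / \<rho>2) *\<^sub>R weak_deriv L (weak_deriv L v3)
       - (k1 / \<rho>2) *\<^sub>R (weak_deriv L v1 + v3 + l *\<^sub>R v5),
     v6,
     (1 / \<rho>1) *\<^sub>R weak_deriv L
         (k3 *\<^sub>R (weak_deriv L v5 - l *\<^sub>R v1) + d \<odot> (weak_deriv L v6 - l *\<^sub>R v2))
       - (l * k1 / \<rho>1) *\<^sub>R (weak_deriv L v1 + v3 + l *\<^sub>R v5))"

end

(*
  Conjugating by the isometry that identifies the energy space with a closed subspace of six copies
  of L^2, the problem becomes one about a contraction semigroup with generator A on a real Hilbert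
  space.  On D(A) the identity <AU, U> = - int d |v6_x - l v2|^2 holds, so along every orbit
  starting in D(A) there are times t_n with vanishing dissipation.  The resolvent of A is not
  compact, since v5_x has no extra regularity where the damping acts; but k3 (v5_x - l v1) +
  d (v6_x - l v2) is bounded in H^1 along the orbit, and its second summand tends to 0 in L^2 at the
  times t_n.  With Rellich's theorem, T(t_n) U therefore has a limit point w, and |T(t) w| = |w|
  for all t.  The subspace of all such w is trivial: otherwise minimise |A y| / |y| over its
  intersection with D(A), which is possible by the same compactness.  The set of minimisers is a
  linear subspace invariant under the semigroup, and A^2 y = - m^2 y holds on it, so A has an
  eigenvalue on the imaginary axis.  For an eigenvector, v5_x - l v1 vanishes on (alpha, beta); the
  system of ordinary differential equations then forces v1 = 0 and v3, v5 constant, first on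
  (alpha, beta) and then on (0, L) by uniqueness, and the boundary conditions give 0.
*)

theory Submission
  imports Defs "HOL-Complex_Analysis.Great_Picard"
begin


text \<open>Without a compact resolvent, compactness is asked only of domain sequences that are
  bounded together with their images under A and whose pairing <A U, U> tends to 0. This one
  condition serves twice: along an orbit it holds at suitable times, since the energy is bounded
  below; on vectors whose norm the semigroup preserves the pairing is 0 outright. That is why
  minimising |A y| / |y| can replace a spectral theorem there. The complex structure is needed only
  to factor A^2 + m^2 into A - i m and A + i m, so the argument before that runs over the reals. The
  semigroup is given, not constructed: dissipativity, density of the domain and closedness of A are
  read off from contraction and the generator property. At an eigenvalue i \<omega> with \<omega>
  \<noteq> 0, the equation v5_x - l v1 = 0 on the damped interval is differentiated twice; the two
  contributions to the coefficient of v1 have the same sign, so they cannot cancel. The case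
  \<omega> = 0 is separate and follows from coercivity of the energy. Coercivity itself must hold
  for every product l L, which is the reason for the rotation argument.\<close>

section \<open>Contraction semigroups on a closed subspace of a Hilbert space\<close>

text \<open>Gauge-fine Riemann sums are linear combinations of values of \<open>f\<close>, so they
  lie in \<open>S\<close>, and they approximate \<open>I\<close>. Applied to orbits in
  \<open>S\<close> and in \<open>isom\<close>, and to curves in a graph.\<close>

lemma has_integral_closed_subspace:
  fixes f :: "real \<Rightarrow> 'a::real_normed_vector"
  assumes f: "(f has_integral I) {a..b}" and S: "subspace S" "closed S"
    and fS: "\<And>x. x \<in> {a..b} \<Longrightarrow> f x \<in> S"
  shows "I \<in> S"
proof -
  have "\<exists>y\<in>S. dist y I < e" if "e > 0" for e
  proof -
    obtain \<gamma> where "gauge \<gamma>" and \<gamma>: "\<And>D. D tagged_division_of {a..b} \<Longrightarrow> \<gamma> fine D \<Longrightarrow>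
        norm ((\<Sum>(x,k)\<in>D. measure lborel k *\<^sub>R f x) - I) < e"
      using f \<open>e > 0\<close> unfolding has_integral_real by metis
    obtain D where D: "D tagged_division_of {a..b}" "\<gamma> fine D"
      using fine_division_exists_real[OF \<open>gauge \<gamma>\<close>] by metis
    have "(\<Sum>(x,k)\<in>D. measure lborel k *\<^sub>R f x) \<in> S"
    proof (rule subspace_sum[OF S(1)])
      fix z assume "z \<in> D"
      moreover obtain x k where z: "z = (x, k)" by fastforce
      ultimately have "x \<in> {a..b}"
        using D(1) by (metis in_mono tagged_division_ofD(2,3))
      then show "(case z of (x, k) \<Rightarrow> measure lborel k *\<^sub>R f x) \<in> S"
        using z fS subspace_scale[OF S(1)] by simp
    qed
    then show ?thesis using \<gamma>[OF D] by (metis dist_norm)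
  qed
  then show ?thesis using closed_approachable[OF S(2)] by blast
qed

lemma has_integral_Pair:
  assumes "(f has_integral a) A" "(g has_integral b) A"
  shows "((\<lambda>x. (f x, g x)) has_integral (a, b)) A"
proof -
  have "bounded_linear (\<lambda>x. (x, 0))" "bounded_linear (\<lambda>y. (0, y))"
    by (auto intro!: bounded_linear_Pair bounded_linear_ident bounded_linear_zero)
  from has_integral_add[OF has_integral_linear[OF assms(1) this(1)] has_integral_linear[OF assms(2) this(2)]]
  show ?thesis by (simp add: o_def)
qed

text \<open>The carrier is a closed subspace and not the whole type, because the energy space will
  sit inside six copies of \<open>L2\<close>. Nothing is assumed about \<open>T\<close> outside
  \<open>S\<close> or at negative times.\<close>

locale contraction_semigroup =
  fixes S :: "'h::{real_inner,banach} set" and T :: "real \<Rightarrow> 'h \<Rightarrow> 'h"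
  assumes subspace_S: "subspace S" and closed_S: "closed S"
    and T_in: "\<And>t u. 0 \<le> t \<Longrightarrow> u \<in> S \<Longrightarrow> T t u \<in> S"
    and T_add: "\<And>t u v. 0 \<le> t \<Longrightarrow> u \<in> S \<Longrightarrow> v \<in> S \<Longrightarrow> T t (u + v) = T t u + T t v"
    and T_scale: "\<And>t u c. 0 \<le> t \<Longrightarrow> u \<in> S \<Longrightarrow> T t (c *\<^sub>R u) = c *\<^sub>R T t u"
    and T_0: "\<And>u. u \<in> S \<Longrightarrow> T 0 u = u"
    and T_semigroup: "\<And>s t u. 0 \<le> s \<Longrightarrow> 0 \<le> t \<Longrightarrow> u \<in> S \<Longrightarrow> T (s + t) u = T s (T t u)"
    and T_tendsto: "\<And>u. u \<in> S \<Longrightarrow> ((\<lambda>t. T t u) \<longlongrightarrow> u) (at_right 0)"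
    and T_contr: "\<And>t u. 0 \<le> t \<Longrightarrow> u \<in> S \<Longrightarrow> norm (T t u) \<le> norm u"
begin

definition gen :: "'h \<Rightarrow> 'h \<Rightarrow> bool"
  where "gen u w \<longleftrightarrow> u \<in> S \<and> w \<in> S \<and> ((\<lambda>h. (1 / h) *\<^sub>R (T h u - u)) \<longlongrightarrow> w) (at_right 0)"

lemma S_add: "u \<in> S \<Longrightarrow> v \<in> S \<Longrightarrow> u + v \<in> S"
  and S_diff: "u \<in> S \<Longrightarrow> v \<in> S \<Longrightarrow> u - v \<in> S"
  and S_scale: "u \<in> S \<Longrightarrow> c *\<^sub>R u \<in> S"
  and S_0: "0 \<in> S"
  using subspace_S by (auto simp: subspace_add subspace_diff subspace_scale subspace_0)

lemma T_diff: "0 \<le> t \<Longrightarrow> u \<in> S \<Longrightarrow> v \<in> S \<Longrightarrow> T t (u - v) = T t u - T t v"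
  using T_add[of t u "(-1) *\<^sub>R v"] T_scale[of t v "-1"] S_scale[of v "-1"] by simp

lemma T_zero: "0 \<le> t \<Longrightarrow> T t 0 = 0"
  using T_scale[of t 0 0] S_0 by simp

text \<open>The difference is \<open>T\<close> at the smaller time applied to an increment at time
  0, and \<open>T\<close> contracts. Right continuity at 0 thus yields two-sided continuity
  everywhere.\<close>

lemma norm_T_diff_le:
  assumes "0 \<le> s" "0 \<le> t" "u \<in> S"
  shows "norm (T t u - T s u) \<le> norm (T \<bar>t - s\<bar> u - u)"
proof -
  have *: "norm (T t u - T s u) \<le> norm (T (t - s) u - u)" if "0 \<le> s" "s \<le> t" for s t
  proof -
    have "T t u - T s u = T s (T (t - s) u - u)"
      using T_semigroup[of s "t - s" u] that assms(3) by (simp add: T_diff T_in)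
    then show ?thesis using that assms(3) by (simp add: T_contr T_in S_diff)
  qed
  show ?thesis
    using *[of s t] *[of t s] assms by (cases "s \<le> t") (auto simp: norm_minus_commute abs_if)
qed

lemma T_right_bound:
  assumes "u \<in> S" "e > 0"
  obtains d where "d > 0" "\<And>r. 0 \<le> r \<Longrightarrow> r < d \<Longrightarrow> norm (T r u - u) < e"
proof -
  have "eventually (\<lambda>t. dist (T t u) u < e) (at_right 0)"
    using T_tendsto[OF assms(1)] assms(2) by (rule tendstoD)
  then obtain d where d: "d > 0" "\<And>t. 0 < t \<Longrightarrow> t < d \<Longrightarrow> dist (T t u) u < e"
    by (auto simp: eventually_at_right_field)
  show ?thesis
  proof (rule that[OF d(1)])
    fix r assume "0 \<le> r" "r < d"
    then show "norm (T r u - u) < e"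
      using d(2)[of r] T_0[OF assms(1)] assms(2) by (cases "r = 0") (auto simp: dist_norm)
  qed
qed

lemma continuous_orbit: "u \<in> S \<Longrightarrow> continuous_on {0..} (\<lambda>t. T t u)"
proof (unfold continuous_on_iff, intro ballI allI impI)
  fix t e :: real assume u: "u \<in> S" and "t \<in> {0..}" "0 < e"
  obtain d where d: "d > 0" "\<And>r. 0 \<le> r \<Longrightarrow> r < d \<Longrightarrow> norm (T r u - u) < e"
    using T_right_bound[OF u \<open>0 < e\<close>] by metis
  have "dist (T s u) (T t u) < e" if "s \<in> {0..}" "dist s t < d" for s
    using norm_T_diff_le[of t s u] d(2)[of "\<bar>s - t\<bar>"] that u \<open>t \<in> {0..}\<close>
    by (auto simp: dist_norm)
  then show "\<exists>d>0. \<forall>x'\<in>{0..}. dist x' t < d \<longrightarrow> dist (T x' u) (T t u) < e"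
    using d(1) by blast
qed

lemma integrable_orbit: "u \<in> S \<Longrightarrow> 0 \<le> a \<Longrightarrow> (\<lambda>t. T t u) integrable_on {a..b}"
  by (rule integrable_continuous_interval) (auto intro: continuous_on_subset[OF continuous_orbit])

lemma integral_orbit_in: "u \<in> S \<Longrightarrow> 0 \<le> a \<Longrightarrow> integral {a..b} (\<lambda>t. T t u) \<in> S"
  using has_integral_closed_subspace[OF _ subspace_S closed_S, of "\<lambda>t. T t u"]
    integrable_orbit[of u a b] T_in[of _ u] by (auto simp: has_integral_integral)

text \<open>The graph of \<open>T s\<close> is a closed subspace, so it contains the integral of a curve in it.\<close>

lemma T_integral:
  assumes u: "u \<in> S" and "0 \<le> s" "0 \<le> h"
  shows "T s (integral {0..h} (\<lambda>r. T r u)) = integral {s..s + h} (\<lambda>r. T r u)"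
proof -
  define \<Gamma> where "\<Gamma> = {(x, T s x) | x. x \<in> S}"
  have sub: "subspace \<Gamma>"
    unfolding \<Gamma>_def subspace_def using assms(2)
    by (auto simp: zero_prod_def S_0 T_zero S_add T_add S_scale T_scale)
  have cl: "closed \<Gamma>"
    unfolding closed_sequential_limits
  proof (intro allI impI, elim conjE)
    fix x l assume x: "\<forall>n. x n \<in> \<Gamma>" and l: "x \<longlonglongrightarrow> l"
    have x1: "fst (x n) \<in> S" "snd (x n) = T s (fst (x n))" for n
      using x[rule_format, of n] unfolding \<Gamma>_def by auto
    have l1: "(\<lambda>n. fst (x n)) \<longlonglongrightarrow> fst l" and l2: "(\<lambda>n. snd (x n)) \<longlonglongrightarrow> snd l"
      using l by (auto intro: tendsto_intros)
    have lS: "fst l \<in> S"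
      using closed_sequentially[OF closed_S _ l1] x1(1) by blast
    have "(\<lambda>n. T s (fst (x n)) - T s (fst l)) \<longlonglongrightarrow> 0"
    proof (rule Lim_null_comparison)
      show "\<forall>\<^sub>F n in sequentially. norm (T s (fst (x n)) - T s (fst l)) \<le> norm (fst (x n) - fst l)"
        using T_contr[OF assms(2) S_diff[OF x1(1) lS]] T_diff[OF assms(2) x1(1) lS] by simp
      show "(\<lambda>n. norm (fst (x n) - fst l)) \<longlonglongrightarrow> 0"
        using l1 by (simp add: LIM_zero tendsto_norm_zero)
    qed
    then have "(\<lambda>n. snd (x n)) \<longlonglongrightarrow> T s (fst l)"
      by (simp add: x1 Lim_null[symmetric])
    then have "snd l = T s (fst l)" using l2 LIMSEQ_unique by blast
    then show "l \<in> \<Gamma>" unfolding \<Gamma>_def using lS by (metis (mono_tags, lifting) mem_Collect_eq prod.collapse)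
  qed
  have "((\<lambda>r. (T r u, T (s + r) u)) has_integral
      (integral {0..h} (\<lambda>r. T r u), integral {0..h} (\<lambda>r. T (s + r) u))) {0..h}"
  proof (rule has_integral_Pair)
    show "((\<lambda>r. T r u) has_integral integral {0..h} (\<lambda>r. T r u)) {0..h}"
      using integrable_orbit[OF u] by (simp add: integrable_integral)
    have "continuous_on {0..h} (\<lambda>r. T (s + r) u)"
      by (rule continuous_on_compose2[OF continuous_orbit[OF u]])
        (use assms in \<open>auto intro!: continuous_intros\<close>)
    then show "((\<lambda>r. T (s + r) u) has_integral integral {0..h} (\<lambda>r. T (s + r) u)) {0..h}"
      by (simp add: integrable_continuous_interval integrable_integral)
  qed
  moreover have "(T r u, T (s + r) u) \<in> \<Gamma>" if "r \<in> {0..h}" for r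
    using that assms unfolding \<Gamma>_def by (auto simp: T_semigroup T_in)
  ultimately have "(integral {0..h} (\<lambda>r. T r u), integral {0..h} (\<lambda>r. T (s + r) u)) \<in> \<Gamma>"
    using has_integral_closed_subspace[OF _ sub cl] by blast
  then have "T s (integral {0..h} (\<lambda>r. T r u)) = integral {0..h} (\<lambda>r. T (s + r) u)"
    unfolding \<Gamma>_def by auto
  also have "\<dots> = integral {s..s + h} (\<lambda>r. T r u)"
  proof -
    have "((\<lambda>r. T r u) has_integral integral {s..s + h} (\<lambda>r. T r u)) (cbox s (s + h))"
      using integrable_orbit[OF u assms(2)] by (simp add: integrable_integral)
    from has_integral_affinity[OF this, of 1 s]
    show ?thesis by (intro integral_unique) (simp add: algebra_simps)
  qed
  finally show ?thesis .
qed

lemma integral_orbit_deriv: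
  assumes u: "u \<in> S" and "0 \<le> t"
  shows "((\<lambda>t. integral {0..t} (\<lambda>r. T r u)) has_vector_derivative T t u) (at t within {0..})"
proof -
  have "((\<lambda>t. integral {0..t} (\<lambda>r. T r u)) has_vector_derivative T t u) (at t within {0..t+1})"
    by (rule integral_has_vector_derivative)
      (use assms in \<open>auto intro: continuous_on_subset[OF continuous_orbit]\<close>)
  \<comment> \<open>\<open>t\<close> lies strictly below \<open>t + 1\<close>, so the artificial
    right end does not affect the filter at \<open>t\<close>.\<close>
  moreover have "at t within {0..t+1} = at t within {0..}"
    by (rule at_within_nhd[of t "{..<t+1}"]) auto
  ultimately show ?thesis by simp
qed


section \<open>The infinitesimal generator: linearity, orbits in the domain, density and
  closedness\<close>

lemma gen_in: "gen u w \<Longrightarrow> u \<in> S" "gen u w \<Longrightarrow> w \<in> S"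
  by (auto simp: gen_def)

lemma gen_tendsto: "gen u w \<Longrightarrow> ((\<lambda>h. (1 / h) *\<^sub>R (T h u - u)) \<longlongrightarrow> w) (at_right 0)"
  by (simp add: gen_def)

lemma gen_unique: "gen u w \<Longrightarrow> gen u w' \<Longrightarrow> w = w'"
  unfolding gen_def by (metis tendsto_unique trivial_limit_at_right_real)

lemma gen_scale: "gen u w \<Longrightarrow> gen (c *\<^sub>R u) (c *\<^sub>R w)"
proof -
  assume *: "gen u w"
  have "((\<lambda>h. c *\<^sub>R ((1 / h) *\<^sub>R (T h u - u))) \<longlongrightarrow> c *\<^sub>R w) (at_right 0)"
    by (rule tendsto_scaleR[OF tendsto_const gen_tendsto[OF *]])
  moreover have "\<forall>\<^sub>F h in at_right 0. c *\<^sub>R ((1 / h) *\<^sub>R (T h u - u)) = (1 / h) *\<^sub>R (T h (c *\<^sub>R u) - c *\<^sub>R u)"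
    using * by (auto simp: gen_def eventually_at_right_field T_scale scaleR_diff_right intro!: exI[of _ 1])
  ultimately have "((\<lambda>h. (1 / h) *\<^sub>R (T h (c *\<^sub>R u) - c *\<^sub>R u)) \<longlongrightarrow> c *\<^sub>R w) (at_right 0)"
    by (rule Lim_transform_eventually)
  then show ?thesis using * S_scale by (simp add: gen_def)
qed

lemma gen_add: "gen u w \<Longrightarrow> gen v z \<Longrightarrow> gen (u + v) (w + z)"
proof -
  assume *: "gen u w" "gen v z"
  have "((\<lambda>h. (1 / h) *\<^sub>R (T h u - u) + (1 / h) *\<^sub>R (T h v - v)) \<longlongrightarrow> w + z) (at_right 0)"
    by (rule tendsto_add[OF gen_tendsto[OF *(1)] gen_tendsto[OF *(2)]])
  moreover have "\<forall>\<^sub>F h in at_right 0. (1 / h) *\<^sub>R (T h u - u) + (1 / h) *\<^sub>R (T h v - v)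
      = (1 / h) *\<^sub>R (T h (u + v) - (u + v))"
    using * by (auto simp: gen_def eventually_at_right_field T_add algebra_simps intro!: exI[of _ 1])
  ultimately have "((\<lambda>h. (1 / h) *\<^sub>R (T h (u + v) - (u + v))) \<longlongrightarrow> w + z) (at_right 0)"
    by (rule Lim_transform_eventually)
  then show ?thesis using * S_add by (simp add: gen_def)
qed

lemma gen_diff: "gen u w \<Longrightarrow> gen v z \<Longrightarrow> gen (u - v) (w - z)"
  using gen_add[of u w "(-1) *\<^sub>R v" "(-1) *\<^sub>R z"] gen_scale[of v z "-1"] by simp

lemma T_tendsto_0:
  assumes "(f \<longlongrightarrow> 0) F" "\<forall>\<^sub>F x in F. f x \<in> S" "0 \<le> t"
  shows "((\<lambda>x. T t (f x)) \<longlongrightarrow> 0) F"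
proof (rule Lim_null_comparison)
  show "\<forall>\<^sub>F x in F. norm (T t (f x)) \<le> norm (f x)"
    using assms(2) by eventually_elim (simp add: T_contr assms(3))
  show "((\<lambda>x. norm (f x)) \<longlongrightarrow> 0) F" using assms(1) by (rule tendsto_norm_zero)
qed

lemma T_tendsto_left:
  assumes "(f \<longlongrightarrow> a) F" "\<forall>\<^sub>F x in F. f x \<in> S" "a \<in> S" "0 \<le> t"
  shows "((\<lambda>x. T t (f x)) \<longlongrightarrow> T t a) F"
proof -
  have "((\<lambda>x. T t (f x - a)) \<longlongrightarrow> 0) F"
    by (rule T_tendsto_0)
      (use assms in \<open>auto simp: LIM_zero intro: S_diff elim: eventually_mono\<close>)
  moreover have "\<forall>\<^sub>F x in F. T t (f x - a) = T t (f x) - T t a"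
    using assms(2) by eventually_elim (use assms T_diff in auto)
  ultimately have "((\<lambda>x. T t (f x) - T t a) \<longlongrightarrow> 0) F"
    by (rule Lim_transform_eventually)
  then show ?thesis by (rule LIM_zero_cancel)
qed

lemma gen_T:
  assumes "gen u w" "0 \<le> t"
  shows "gen (T t u) (T t w)"
proof -
  have "((\<lambda>h. T t ((1 / h) *\<^sub>R (T h u - u))) \<longlongrightarrow> T t w) (at_right 0)"
    by (rule T_tendsto_left)
      (use assms in \<open>auto simp: gen_def eventually_at_right_field intro!: exI[of _ 1] S_scale S_diff T_in\<close>)
  moreover have "\<forall>\<^sub>F h in at_right 0. T t ((1 / h) *\<^sub>R (T h u - u)) = (1 / h) *\<^sub>R (T h (T t u) - T t u)"
  proof -
    have "T t ((1 / h) *\<^sub>R (T h u - u)) = (1 / h) *\<^sub>R (T h (T t u) - T t u)" if "h > 0" for h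
      using that assms T_semigroup[of t h u] T_semigroup[of h t u]
      by (simp add: gen_def T_scale T_diff S_diff T_in add.commute)
    then show ?thesis by (auto simp: eventually_at_right_field intro!: exI[of _ 1])
  qed
  ultimately have "((\<lambda>h. (1 / h) *\<^sub>R (T h (T t u) - T t u)) \<longlongrightarrow> T t w) (at_right 0)"
    by (rule Lim_transform_eventually)
  then show ?thesis using assms by (simp add: gen_def T_in)
qed

text \<open>The generator gives only a right derivative at time 0. Moving it to \<open>t\<close>
  from the right is a contraction; from the left the base point \<open>y\<close> varies with the
  increment, and the continuity of the orbit of \<open>w\<close> at 0 makes up for it.\<close>

lemma gen_has_vector_derivative:
  assumes g: "gen u w" and t: "0 \<le> t"
  shows "((\<lambda>t. T t u) has_vector_derivative T t w) (at t within {0..})"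
  unfolding has_vector_derivative_def has_derivative_within_alt
proof (intro conjI allI impI)
  show "bounded_linear (\<lambda>x. x *\<^sub>R T t w)" by (rule bounded_linear_scaleR_left)
  fix e :: real assume "e > 0"
  have uw: "u \<in> S" "w \<in> S" using g by (auto simp: gen_def)
  obtain d1 where d1: "d1 > 0" "\<And>r. 0 \<le> r \<Longrightarrow> r < d1 \<Longrightarrow> norm (T r w - w) < e / 2"
    using T_right_bound[OF uw(2), of "e / 2"] \<open>e > 0\<close> by auto
  have "\<forall>\<^sub>F h in at_right 0. dist ((1 / h) *\<^sub>R (T h u - u)) w < e / 2"
    by (rule tendstoD[OF gen_tendsto[OF g]]) (use \<open>e > 0\<close> in simp)
  then obtain d2 where d2: "d2 > 0"
      "\<And>h. 0 < h \<Longrightarrow> h < d2 \<Longrightarrow> norm ((1 / h) *\<^sub>R (T h u - u) - w) < e / 2"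
    by (auto simp: eventually_at_right_field dist_norm)
  have q: "norm (T h u - u - h *\<^sub>R w) \<le> e / 2 * h" if "0 < h" "h < d2" for h
  proof -
    have "T h u - u - h *\<^sub>R w = h *\<^sub>R ((1 / h) *\<^sub>R (T h u - u) - w)"
      using that by (simp add: scaleR_diff_right)
    then have "norm (T h u - u - h *\<^sub>R w) = h * norm ((1 / h) *\<^sub>R (T h u - u) - w)"
      using that by simp
    then show ?thesis using d2(2)[of h] that by (simp add: mult.commute)
  qed
  have "norm (T y u - T t u - (y - t) *\<^sub>R T t w) \<le> e * norm (y - t)"
    if y: "y \<in> {0..}" "norm (y - t) < min d1 d2" for y
  proof (cases "y = t")
    case False
    show ?thesis
    proof (cases "t < y")
      case True
      have "T y u - T t u - (y - t) *\<^sub>R T t w = T t (T (y - t) u - u - (y - t) *\<^sub>R w)"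
        using T_semigroup[of t "y - t" u] True t uw
        by (simp add: T_diff T_scale T_in S_diff S_scale)
      then have "norm (T y u - T t u - (y - t) *\<^sub>R T t w) \<le> norm (T (y - t) u - u - (y - t) *\<^sub>R w)"
        using T_contr[of t "T (y - t) u - u - (y - t) *\<^sub>R w"] True t uw
        by (simp add: T_in S_diff S_scale)
      also have "\<dots> \<le> e / 2 * (y - t)" using q[of "y - t"] y True by simp
      also have "\<dots> \<le> e * norm (y - t)" using True \<open>e > 0\<close> by (simp add: field_simps)
      finally show ?thesis .
    next
      case f2: False
      define h where "h = t - y"
      have h: "0 < h" "h < d1" "h < d2" "t = y + h" "0 \<le> y"
        using False f2 y by (auto simp: h_def)
      \<comment> \<open>Both terms carry \<open>T y\<close> in front, so their size depends only on
        what \<open>u\<close> and \<open>w\<close> do up to time \<open>h\<close>, uniformly in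
        \<open>y\<close>.\<close>
      have "T y u - T t u - (y - t) *\<^sub>R T t w = h *\<^sub>R T y (T h w - w) - T y (T h u - u - h *\<^sub>R w)"
      proof -
        have "T y (T h u - u - h *\<^sub>R w) = T y (T h u) - T y u - h *\<^sub>R T y w"
            "T y (T h w - w) = T y (T h w) - T y w"
          using h(1,5) uw by (simp_all add: T_diff T_scale T_in S_diff S_scale)
        then show ?thesis
          using T_semigroup[of y h u] T_semigroup[of y h w] h(1,5) uw unfolding h(4)
          by (simp add: scaleR_diff_right)
      qed
      also have "norm \<dots> \<le> norm (h *\<^sub>R T y (T h w - w)) + norm (T y (T h u - u - h *\<^sub>R w))"
        by (rule norm_triangle_ineq4)
      also have "\<dots> \<le> h * norm (T h w - w) + norm (T h u - u - h *\<^sub>R w)"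
        using T_contr[of y "T h w - w"] T_contr[of y "T h u - u - h *\<^sub>R w"] h uw
        by (auto simp: T_in S_diff S_scale intro!: add_mono mult_left_mono)
      also have "\<dots> \<le> h * (e / 2) + e / 2 * h"
        using q[of h] d1(2)[of h] h by (intro add_mono mult_left_mono) auto
      also have "\<dots> = e * norm (y - t)" using h by (simp add: field_simps)
      finally show ?thesis .
    qed
  qed auto
  then show "\<exists>d>0. \<forall>y\<in>{0..}. norm (y - t) < d \<longrightarrow>
      norm (T y u - T t u - (y - t) *\<^sub>R T t w) \<le> e * norm (y - t)"
    using d1(1) d2(1) by (intro exI[of _ "min d1 d2"]) auto
qed

lemma gen_integral:
  assumes "gen u w" "0 \<le> t"
  shows "T t u - u = integral {0..t} (\<lambda>s. T s w)"
proof -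
  have "((\<lambda>s. T s w) has_integral (T t u - T 0 u)) {0..t}"
  proof (rule fundamental_theorem_of_calculus)
    fix x assume "x \<in> {0..t}"
    then show "((\<lambda>t. T t u) has_vector_derivative T x w) (at x within {0..t})"
      using gen_has_vector_derivative[OF assms(1), of x]
      by (auto intro: has_vector_derivative_within_subset)
  qed (use assms in auto)
  then show ?thesis using T_0 gen_in(1)[OF assms(1)] by (simp add: integral_unique)
qed

lemma right_quotient_tendsto:
  fixes f :: "real \<Rightarrow> 'b::real_normed_vector"
  assumes "(f has_vector_derivative w) (at 0 within {0..})"
  shows "((\<lambda>t. (1 / t) *\<^sub>R (f t - f 0)) \<longlongrightarrow> w) (at_right 0)"
proof -
  have "((\<lambda>t. f (0 + t)) has_vector_derivative w) (at 0 within {0..})"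
    using assms by simp
  then have *: "((\<lambda>t. (1 / norm (t - 0)) *\<^sub>R (f t - (f 0 + (t - 0) *\<^sub>R w))) \<longlongrightarrow> 0) (at_right 0)"
    by (simp add: has_vector_derivative_def has_derivative_within at_within_Ici_at_right)
  have "\<forall>\<^sub>F t in at_right 0. (1 / norm (t - 0)) *\<^sub>R (f t - (f 0 + (t - 0) *\<^sub>R w))
      = (1 / t) *\<^sub>R (f t - f 0) - w"
    by (auto simp: eventually_at_right_field algebra_simps intro!: exI[of _ 1])
  from Lim_transform_eventually[OF * this] show ?thesis by (rule LIM_zero_cancel)
qed

lemma gen_I:
  assumes "u \<in> S" "w \<in> S" "((\<lambda>t. T t u) has_vector_derivative w) (at 0 within {0..})"
  shows "gen u w"
  using right_quotient_tendsto[OF assms(3)] T_0[OF assms(1)] assms(1,2) by (simp add: gen_def)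

text \<open>\<open>T s\<close> turns the integral over [0, h] into the one over [s, s + h], whose
  derivative at s = 0 is the difference of the endpoint values. With \<open>average_tendsto\<close>
  this makes the domain dense.\<close>

lemma gen_average:
  assumes u: "u \<in> S" and h: "0 \<le> h"
  shows "gen (integral {0..h} (\<lambda>r. T r u)) (T h u - u)"
proof (rule gen_I)
  define F where "F t = integral {0..t} (\<lambda>r. T r u)" for t
  have F: "(F has_vector_derivative T t u) (at t within {0..})" if "0 \<le> t" for t
    unfolding F_def[abs_def] using integral_orbit_deriv[OF u that] .
  have "((\<lambda>s. F (s + h) - F s) has_vector_derivative T h u - u) (at 0 within {0..})"
  proof (rule has_vector_derivative_diff)
    show "(F has_vector_derivative u) (at 0 within {0..})" using F[of 0] T_0[OF u] by simp
    have "((\<lambda>s. s + h) has_vector_derivative 1) (at 0 within {0..})"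
      by (auto intro!: derivative_eq_intros)
    moreover have "(F has_vector_derivative T h u) (at (0 + h) within (\<lambda>s. s + h) ` {0..})"
      by (rule has_vector_derivative_within_subset[of _ _ _ "{0..}"]) (use F[of h] h in auto)
    ultimately show "((\<lambda>s. F (s + h)) has_vector_derivative T h u) (at 0 within {0..})"
      using vector_diff_chain_within[of "\<lambda>s. s + h" 1 0 "{0..}" F "T h u"] by (simp add: o_def)
  qed
  moreover have "T s (integral {0..h} (\<lambda>r. T r u)) = F (s + h) - F s" if "s \<ge> 0" for s
  proof -
    have "F (s + h) = F s + integral {s..s + h} (\<lambda>r. T r u)"
      unfolding F_def using integrable_orbit[OF u, of 0 "s+h"] that h
      by (intro Henstock_Kurzweil_Integration.integral_combine[symmetric]) auto
    then show ?thesis using T_integral[OF u that h] by simp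
  qed
  ultimately show "((\<lambda>s. T s (integral {0..h} (\<lambda>r. T r u))) has_vector_derivative T h u - u)
      (at 0 within {0..})"
    using has_vector_derivative_transform[of 0 "{0..}" "\<lambda>s. T s (integral {0..h} (\<lambda>r. T r u))"
      "\<lambda>s. F (s + h) - F s" "T h u - u"] by simp
qed (use assms in \<open>auto intro: S_diff T_in integral_orbit_in\<close>)

lemma average_tendsto:
  assumes u: "u \<in> S"
  shows "((\<lambda>h. (1 / h) *\<^sub>R integral {0..h} (\<lambda>r. T r u)) \<longlongrightarrow> u) (at_right 0)"
  using right_quotient_tendsto[OF integral_orbit_deriv[OF u order_refl]] T_0[OF u] by simp

text \<open>The identity expressing \<open>T t y - y\<close> as the integral of \<open>T s p\<close>
  contains no derivative, so it survives the limit; differentiating it at 0 recovers the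
  generator.\<close>

lemma gen_closed:
  assumes g: "\<And>n. gen (y n) (p n)" and y: "y \<longlonglongrightarrow> a" and p: "p \<longlonglongrightarrow> b"
  shows "gen a b"
proof -
  have aS: "a \<in> S" and bS: "b \<in> S"
    using closed_sequentially[OF closed_S _ y] closed_sequentially[OF closed_S _ p] gen_in[OF g] by auto
  have eq: "T t a = a + integral {0..t} (\<lambda>s. T s b)" if "0 \<le> t" for t
  proof -
    have "(\<lambda>n. T t (y n) - y n) \<longlonglongrightarrow> T t a - a"
      using T_tendsto_left[OF y _ aS that] gen_in(1)[OF g] y by (auto intro: tendsto_diff)
    moreover have "(\<lambda>n. T t (y n) - y n) \<longlonglongrightarrow> integral {0..t} (\<lambda>s. T s b)"
    proof (rule LIM_zero_cancel, rule Lim_null_comparison)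
      have "norm (T t (y n) - y n - integral {0..t} (\<lambda>s. T s b)) \<le> norm (p n - b) * t" for n
      proof -
        have "T t (y n) - y n - integral {0..t} (\<lambda>s. T s b)
            = integral {0..t} (\<lambda>s. T s (p n) - T s b)"
          using gen_integral[OF g that] integrable_orbit gen_in(2)[OF g] bS
          by (simp add: Henstock_Kurzweil_Integration.integral_diff)
        also have "norm \<dots> \<le> norm (p n - b) * (t - 0)"
        proof (rule integral_bound)
          show "continuous_on {0..t} (\<lambda>s. T s (p n) - T s b)"
            using gen_in(2)[OF g] bS
            by (auto intro!: continuous_on_diff intro: continuous_on_subset[OF continuous_orbit])
          show "norm (T s (p n) - T s b) \<le> norm (p n - b)" if "s \<in> {0..t}" for s
            using T_contr[of s "p n - b"] that gen_in(2)[OF g] bS by (simp add: T_diff S_diff)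
        qed (use that in simp)
        finally show ?thesis by simp
      qed
      then show "\<forall>\<^sub>F n in sequentially.
          norm (T t (y n) - y n - integral {0..t} (\<lambda>s. T s b)) \<le> norm (p n - b) * t"
        by simp
      show "(\<lambda>n. norm (p n - b) * t) \<longlonglongrightarrow> 0"
        using tendsto_mult_left_zero[OF tendsto_norm_zero[OF LIM_zero[OF p]]] by blast
    qed
    ultimately have "T t a - a = integral {0..t} (\<lambda>s. T s b)" by (rule LIMSEQ_unique)
    then show ?thesis by (simp add: algebra_simps)
  qed
  show ?thesis
  proof (rule gen_I[OF aS bS])
    have "((\<lambda>t. a + integral {0..t} (\<lambda>s. T s b)) has_vector_derivative 0 + T 0 b) (at 0 within {0..})"
      by (intro has_vector_derivative_add has_vector_derivative_const integral_orbit_deriv bS order_refl)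
    then have "((\<lambda>t. a + integral {0..t} (\<lambda>s. T s b)) has_vector_derivative b) (at 0 within {0..})"
      using T_0[OF bS] by simp
    then show "((\<lambda>t. T t a) has_vector_derivative b) (at 0 within {0..})"
      by (rule has_vector_derivative_transform[rotated 2]) (simp_all add: eq)
  qed
qed


section \<open>Decay of the energy along orbits\<close>

lemma energy_deriv:
  assumes "gen u w" "0 \<le> t"
  shows "((\<lambda>t. (norm (T t u))\<^sup>2) has_real_derivative 2 * inner (T t w) (T t u)) (at t within {0..})"
proof -
  have "((\<lambda>t. inner (T t u) (T t u)) has_derivative
      (\<lambda>h. inner (T t u) (h *\<^sub>R T t w) + inner (h *\<^sub>R T t w) (T t u))) (at t within {0..})"
    using gen_has_vector_derivative[OF assms] unfolding has_vector_derivative_def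
    by (intro has_derivative_inner)
  then show ?thesis
    unfolding has_field_derivative_def power2_norm_eq_inner
    by (rule has_derivative_eq_rhs) (auto simp: inner_commute algebra_simps)
qed

lemma norm_T_antimono:
  "0 \<le> s \<Longrightarrow> s \<le> t \<Longrightarrow> u \<in> S \<Longrightarrow> norm (T t u) \<le> norm (T s u)"
  using T_contr[of "t - s" "T s u"] T_semigroup[of "t - s" s u] T_in[of s u] by simp

text \<open>If the dissipation stayed above \<open>e\<close> after time \<open>a\<close>, then by
  the mean value theorem the energy would fall at a rate of at least \<open>2 * e\<close> and become
  negative.\<close>

lemma energy_dissipation_small:
  assumes g: "gen u w" and "e > 0" "0 \<le> a"
  shows "\<exists>t\<ge>a. \<bar>inner (T t w) (T t u)\<bar> < e"
proof (rule ccontr)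
  assume "\<not> ?thesis"
  then have big: "\<bar>inner (T t w) (T t u)\<bar> \<ge> e" if "t \<ge> a" for t using that not_less by blast
  have uS: "u \<in> S" using g by (rule gen_in)
  \<comment> \<open>Dissipativity follows from contraction: Cauchy-Schwarz on the difference
    quotient.\<close>
  have neg: "inner (T t w) (T t u) \<le> 0" if t: "t \<ge> 0" for t
  proof -
    have g': "gen (T t u) (T t w)" using gen_T[OF g t] .
    have "((\<lambda>h. inner ((1 / h) *\<^sub>R (T h (T t u) - T t u)) (T t u)) \<longlongrightarrow> inner (T t w) (T t u)) (at_right 0)"
      using g' unfolding gen_def by (intro tendsto_inner tendsto_const) auto
    moreover have "\<forall>\<^sub>F h in at_right 0. inner ((1 / h) *\<^sub>R (T h (T t u) - T t u)) (T t u) \<le> 0"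
    proof -
      have "inner ((1 / h) *\<^sub>R (T h (T t u) - T t u)) (T t u) \<le> 0" if "h > 0" for h
      proof -
        have "inner (T h (T t u)) (T t u) \<le> norm (T h (T t u)) * norm (T t u)"
          by (rule norm_cauchy_schwarz)
        also have "\<dots> \<le> norm (T t u) * norm (T t u)"
          using T_contr[of h "T t u"] T_in[OF t uS] that by (intro mult_right_mono) auto
        finally show ?thesis
          using that by (simp add: inner_diff_left field_simps power2_norm_eq_inner[symmetric] power2_eq_square)
      qed
      then show ?thesis by (auto simp: eventually_at_right_field intro!: exI[of _ 1])
    qed
    ultimately show ?thesis by (rule tendsto_upperbound) simp
  qed
  \<comment> \<open>Chosen so that \<open>2 * N * e\<close> exceeds the energy at time
    \<open>a\<close>.\<close>
  define N where "N = (norm (T a u))\<^sup>2 / e + 1"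
  have "N > 0" using \<open>e > 0\<close> by (simp add: N_def add_nonneg_pos)
  have "\<exists>t\<in>{a<..<a+N}. (norm (T (a+N) u))\<^sup>2 - (norm (T a u))\<^sup>2 = (a + N - a) * (2 * inner (T t w) (T t u))"
  proof -
    have "\<exists>t\<in>{a<..<a+N}. (norm (T (a+N) u))\<^sup>2 - (norm (T a u))\<^sup>2
        = (\<lambda>h. h * (2 * inner (T t w) (T t u))) (a + N - a)"
    proof (rule mvt_simple[of a "a + N" "\<lambda>t. (norm (T t u))\<^sup>2"])
      fix t assume "a \<le> t" "t \<le> a + N"
      then have "((\<lambda>t. (norm (T t u))\<^sup>2) has_real_derivative 2 * inner (T t w) (T t u)) (at t within {a..a+N})"
        using energy_deriv[OF g, of t] \<open>0 \<le> a\<close> by (auto intro: DERIV_subset)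
      then show "((\<lambda>t. (norm (T t u))\<^sup>2) has_derivative (\<lambda>h. h * (2 * inner (T t w) (T t u)))) (at t within {a..a+N})"
        by (simp add: has_field_derivative_def mult_commute_abs)
    qed (use \<open>N > 0\<close> in auto)
    then show ?thesis by simp
  qed
  then obtain t where t: "t > a" "(norm (T (a+N) u))\<^sup>2 - (norm (T a u))\<^sup>2 = N * (2 * inner (T t w) (T t u))"
    by auto
  have "inner (T t w) (T t u) \<le> - e" using big[of t] neg[of t] t(1) \<open>0 \<le> a\<close> by linarith
  then have "N * (2 * inner (T t w) (T t u)) \<le> N * (2 * - e)"
    using \<open>N > 0\<close> by (intro mult_left_mono) auto
  then have "(norm (T (a+N) u))\<^sup>2 \<le> (norm (T a u))\<^sup>2 - 2 * N * e" using t(2) by linarith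
  also have "\<dots> < 0"
  proof -
    have "N * e = (norm (T a u))\<^sup>2 + e" using \<open>e > 0\<close> by (simp add: N_def field_simps)
    then show ?thesis using \<open>e > 0\<close> zero_le_power2[of "norm (T a u)"] by linarith
  qed
  finally show False by (simp add: not_less[symmetric])
qed

section \<open>The subspace on which the semigroup is isometric\<close>

definition isom :: "'h set"
  where "isom = {w \<in> S. \<forall>t\<ge>0. norm (T t w) = norm w}"

lemma isom_in: "w \<in> isom \<Longrightarrow> w \<in> S" by (simp add: isom_def)

lemma isom_norm: "w \<in> isom \<Longrightarrow> 0 \<le> t \<Longrightarrow> norm (T t w) = norm w" by (simp add: isom_def)

lemma parallelogram: "(norm (a + b :: 'h))\<^sup>2 + (norm (a - b))\<^sup>2 = 2 * (norm a)\<^sup>2 + 2 * (norm b)\<^sup>2"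
  by (simp add: power2_norm_eq_inner inner_add inner_diff algebra_simps)

lemma isom_scale: "w \<in> isom \<Longrightarrow> c *\<^sub>R w \<in> isom"
  by (auto simp: isom_def S_scale T_scale)

text \<open>The parallelogram law fixes the sum of the squared norms of \<open>T t (a + b)\<close>
  and \<open>T t (a - b)\<close>, while contraction bounds each of them, so neither can drop. Hence
  the nonlinear condition in \<open>isom\<close> cuts out a linear subspace.\<close>

lemma isom_add:
  assumes "a \<in> isom" "b \<in> isom" shows "a + b \<in> isom"
proof -
  have ab: "a \<in> S" "b \<in> S" using assms isom_in by auto
  have "norm (T t (a + b)) = norm (a + b)" if t: "t \<ge> 0" for t
  proof -
    have "(norm (T t (a + b)))\<^sup>2 + (norm (T t (a - b)))\<^sup>2 = (norm (a + b))\<^sup>2 + (norm (a - b))\<^sup>2"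
      using assms t ab by (simp add: T_add T_diff parallelogram isom_norm)
    moreover have "(norm (T t (a + b)))\<^sup>2 \<le> (norm (a + b))\<^sup>2" "(norm (T t (a - b)))\<^sup>2 \<le> (norm (a - b))\<^sup>2"
      using ab t by (auto intro!: power_mono T_contr S_add S_diff)
    ultimately have "(norm (T t (a + b)))\<^sup>2 = (norm (a + b))\<^sup>2" by linarith
    then show ?thesis by simp
  qed
  then show ?thesis using ab by (auto simp: isom_def S_add)
qed

lemma subspace_isom: "subspace isom"
  unfolding subspace_def using isom_add isom_scale by (auto simp: isom_def S_0 T_zero)

lemma isom_diff: "a \<in> isom \<Longrightarrow> b \<in> isom \<Longrightarrow> a - b \<in> isom"
  using subspace_isom by (rule subspace_diff)

lemma closed_isom: "closed isom"
  unfolding closed_sequential_limits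
proof (intro allI impI, elim conjE)
  fix x l assume x: "\<forall>n. x n \<in> isom" and l: "x \<longlonglongrightarrow> l"
  have lS: "l \<in> S" using closed_sequentially[OF closed_S _ l] x isom_in by auto
  have "norm (T t l) = norm l" if "t \<ge> 0" for t
  proof -
    have "(\<lambda>n. norm (T t (x n))) \<longlonglongrightarrow> norm (T t l)"
      using T_tendsto_left[OF l _ lS that] x isom_in by (auto intro!: tendsto_norm)
    then have "(\<lambda>n. norm (x n)) \<longlonglongrightarrow> norm (T t l)" using x that by (simp add: isom_norm)
    then show ?thesis using tendsto_norm[OF l] LIMSEQ_unique by blast
  qed
  then show "l \<in> isom" using lS by (simp add: isom_def)
qed

lemma isom_T: "w \<in> isom \<Longrightarrow> 0 \<le> t \<Longrightarrow> T t w \<in> isom"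
  unfolding isom_def using T_semigroup[of _ t w] by (auto simp: T_in) (metis add_nonneg_nonneg)

text \<open>The difference quotients stay in the closed subspace \<open>isom\<close>, hence so does
  their limit.\<close>

lemma gen_isom:
  assumes g: "gen u w" and u: "u \<in> isom"
  shows "w \<in> isom"
proof -
  have "((\<lambda>h. (1 / h) *\<^sub>R (T h u - u)) \<longlongrightarrow> w) (at_right 0)" using g by (simp add: gen_def)
  moreover have "\<forall>\<^sub>F h in at_right 0. (1 / h) *\<^sub>R (T h u - u) \<in> isom"
    using u by (auto simp: eventually_at_right_field isom_T isom_diff isom_scale intro!: exI[of _ 1])
  ultimately show ?thesis
    using Lim_in_closed_set[OF closed_isom, of "\<lambda>h. (1 / h) *\<^sub>R (T h u - u)" "at_right 0"] by simp
qed

lemma gen_isom_inner_0: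
  assumes g: "gen u w" and u: "u \<in> isom"
  shows "inner w u = 0"
proof -
  have "((\<lambda>t. (norm (T t u))\<^sup>2) has_real_derivative 2 * inner w u) (at 0 within {0..})"
    using energy_deriv[OF g, of 0] T_0 gen_in[OF g] by simp
  then have "((\<lambda>t. (norm (T t u))\<^sup>2) has_vector_derivative 2 * inner w u) (at 0 within {0..})"
    by (simp add: has_real_derivative_iff_has_vector_derivative)
  then have "((\<lambda>t. (norm u)\<^sup>2) has_vector_derivative 2 * inner w u) (at 0 within {0..})"
    by (rule has_vector_derivative_transform[rotated 2]) (use u isom_norm in auto)
  from right_quotient_tendsto[OF this] have "((\<lambda>t. 0::real) \<longlongrightarrow> 2 * inner w u) (at_right (0::real))"
    by simp
  then have "2 * inner w u = 0"
    by (metis tendsto_const tendsto_unique trivial_limit_at_right_real)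
  then show ?thesis by simp
qed

text \<open>Polarisation of \<open>gen_isom_inner_0\<close>.\<close>

lemma gen_isom_skew:
  assumes "gen u w" "u \<in> isom" "gen v z" "v \<in> isom"
  shows "inner w v = - inner z u"
  using gen_isom_inner_0[OF gen_add[OF assms(1,3)] isom_add[OF assms(2,4)]]
    gen_isom_inner_0[OF assms(1,2)] gen_isom_inner_0[OF assms(3,4)]
  by (simp add: inner_add inner_commute)

text \<open>
  A minimiser of \<open>\<parallel>A y\<parallel> / \<parallel>y\<parallel>\<close> over the isometric part of the domain exists by compactness.  The
  minimisers form a closed subspace which the semigroup leaves invariant because \<open>T t\<close> preserves
  both norms, so \<open>A\<close> maps it to itself; there the Euler-Lagrange equation reads \<open>A\<^sup>2 y = - m\<^sup>2 y\<close>.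
\<close>

lemma isom_trivial:
  assumes compact: "\<And>U W. \<lbrakk>\<And>n. gen (U n) (W n); bounded (range U); bounded (range W);
      (\<lambda>n. inner (W n) (U n)) \<longlonglongrightarrow> 0\<rbrakk> \<Longrightarrow> \<exists>r w. strict_mono (r::nat \<Rightarrow> nat) \<and> (U \<circ> r) \<longlonglongrightarrow> w"
    and eigen: "\<And>y p m. gen y p \<Longrightarrow> gen p (- (m\<^sup>2) *\<^sub>R y) \<Longrightarrow> y = 0"
  shows "isom = {0}"
proof (rule ccontr)
  assume "isom \<noteq> {0}"
  moreover have "0 \<in> isom" using subspace_isom by (rule subspace_0)
  ultimately obtain w where w: "w \<in> isom" "w \<noteq> 0" by auto
  define B where "B = {norm p | y p. gen y p \<and> y \<in> isom \<and> norm y = 1}"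
  have unit: "norm p / norm y \<in> B" if "gen y p" "y \<in> isom" "y \<noteq> 0" for y p
  proof -
    have "gen ((1 / norm y) *\<^sub>R y) ((1 / norm y) *\<^sub>R p)" "(1 / norm y) *\<^sub>R y \<in> isom"
      using that by (auto intro: gen_scale isom_scale)
    then show ?thesis unfolding B_def
      using that(3) by (intro CollectI exI[of _ "(1 / norm y) *\<^sub>R y"] exI[of _ "(1 / norm y) *\<^sub>R p"]) auto
  qed
  \<comment> \<open>The average of \<open>w\<close> over a short interval lies in the domain, stays
    in \<open>isom\<close>, and is nonzero because the averages tend to \<open>w\<close>.\<close>
  have "B \<noteq> {}"
  proof -
    have "\<forall>\<^sub>F h in at_right 0. (1 / h) *\<^sub>R integral {0..h} (\<lambda>r. T r w) \<noteq> 0"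
      using average_tendsto[OF isom_in[OF w(1)]] w(2) by (rule tendsto_imp_eventually_ne)
    then obtain h where h: "h > 0" "(1 / h) *\<^sub>R integral {0..h} (\<lambda>r. T r w) \<noteq> 0"
      by (auto simp: eventually_at_right_field) (metis dense)
    have "integral {0..h} (\<lambda>r. T r w) \<in> isom"
      using has_integral_closed_subspace[OF _ subspace_isom closed_isom, of "\<lambda>r. T r w"]
        integrable_orbit[OF isom_in[OF w(1)], of 0 h] isom_T[OF w(1)]
      by (auto simp: has_integral_integral)
    then show ?thesis
      using unit[OF gen_average[OF isom_in[OF w(1)], of h]] h by auto
  qed
  have B0: "b \<ge> 0" if "b \<in> B" for b using that by (auto simp: B_def)
  then have bdd: "bdd_below B" by (rule bdd_belowI)
  define m where "m = Inf B"
  have m0: "m \<ge> 0" unfolding m_def using \<open>B \<noteq> {}\<close> B0 by (rule cInf_greatest)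
  have m_le: "m * norm y \<le> norm p" if "gen y p" "y \<in> isom" for y p
  proof (cases "y = 0")
    case False
    then have "m \<le> norm p / norm y" unfolding m_def using unit[OF that] bdd by (intro cInf_lower) auto
    then show ?thesis using False by (simp add: field_simps)
  qed simp
  have m_le2: "m\<^sup>2 * (norm y)\<^sup>2 \<le> (norm p)\<^sup>2" if "gen y p" "y \<in> isom" for y p
    using power_mono[OF m_le[OF that], of 2] m0 by (simp add: power_mult_distrib)
  \<comment> \<open>The minimising condition is written with squares: it is then homogeneous,
    includes 0 and can be expanded on sums.\<close>
  define F where "F = {y \<in> isom. \<exists>p. gen y p \<and> (norm p)\<^sup>2 = m\<^sup>2 * (norm y)\<^sup>2}"
  have "\<exists>y p. gen y p \<and> y \<in> isom \<and> norm y = 1 \<and> norm p < m + 1 / Suc n" for n :: nat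
  proof -
    have "\<exists>b\<in>B. b < m + 1 / Suc n"
      using cInf_lessD[OF \<open>B \<noteq> {}\<close>, of "m + 1 / Suc n"] unfolding m_def by auto
    then show ?thesis unfolding B_def by auto
  qed
  then obtain y p where yp: "\<And>n. gen (y n) (p n)" "\<And>n. y n \<in> isom" "\<And>n. norm (y n) = 1"
      "\<And>n. norm (p n) < m + 1 / Suc n" by metis
  have pn: "(\<lambda>n. norm (p n)) \<longlonglongrightarrow> m"
  proof (rule tendsto_sandwich)
    show "\<forall>\<^sub>F n in sequentially. m \<le> norm (p n)" using m_le[OF yp(1,2)] yp(3) by simp
    show "\<forall>\<^sub>F n in sequentially. norm (p n) \<le> m + 1 / Suc n" using yp(4) by (simp add: less_imp_le)
    show "(\<lambda>n. m + 1 / Suc n) \<longlonglongrightarrow> m"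
      using tendsto_add[OF tendsto_const lim_inverse_n'[THEN LIMSEQ_Suc], of m] by simp
  qed simp
  have "\<exists>r v. strict_mono (r::nat \<Rightarrow> nat) \<and> (y \<circ> r) \<longlonglongrightarrow> v"
  proof (rule compact[OF yp(1)])
    show "bounded (range y)" using yp(3) by (auto simp: bounded_iff)
    show "bounded (range p)"
      using convergent_imp_bounded[OF pn] by (auto simp: bounded_iff)
    show "(\<lambda>n. inner (p n) (y n)) \<longlonglongrightarrow> 0" using gen_isom_inner_0[OF yp(1,2)] by simp
  qed
  then obtain r v where r: "strict_mono (r::nat \<Rightarrow> nat)" and v: "(\<lambda>n. y (r n)) \<longlonglongrightarrow> v"
    by (auto simp: o_def)
  have pr: "(\<lambda>n. norm (p (r n))) \<longlonglongrightarrow> m"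
    using LIMSEQ_subseq_LIMSEQ[OF pn r] by (simp add: o_def)
  \<comment> \<open>Compactness makes \<open>y\<close> converge along \<open>r\<close>, but not
    \<open>p\<close>. The parallelogram law, with the lower bound \<open>m\<close> applied to the
    sum, controls \<open>p i - p j\<close> by a quantity tending to 4 m^2 - 4 m^2 = 0.\<close>
  have dp: "(norm (p i - p j))\<^sup>2 \<le> 2 * (norm (p i))\<^sup>2 + 2 * (norm (p j))\<^sup>2 - m\<^sup>2 * (norm (y i + y j))\<^sup>2" for i j
    using m_le2[OF gen_add[OF yp(1) yp(1)] isom_add[OF yp(2) yp(2)], of i j] parallelogram[of "p i" "p j"]
    by linarith
  have "Cauchy (\<lambda>n. p (r n))"
  proof (rule metric_CauchyI)
    fix e :: real assume "e > 0"
    have "((\<lambda>(i, j). 2 * (norm (p (r i)))\<^sup>2 + 2 * (norm (p (r j)))\<^sup>2 - m\<^sup>2 * (norm (y (r i) + y (r j)))\<^sup>2)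
        \<longlongrightarrow> 2 * m\<^sup>2 + 2 * m\<^sup>2 - m\<^sup>2 * (norm (v + v))\<^sup>2) (sequentially \<times>\<^sub>F sequentially)"
      unfolding split_def
      by (intro tendsto_intros filterlim_compose[OF pr] filterlim_compose[OF v] filterlim_fst filterlim_snd)
    moreover have "norm v = 1" using LIMSEQ_unique[OF tendsto_norm[OF v]] yp(3) by simp
    then have "2 * m\<^sup>2 + 2 * m\<^sup>2 - m\<^sup>2 * (norm (v + v))\<^sup>2 = 0"
      by (simp add: scaleR_2[symmetric] power_mult_distrib del: scaleR_2)
    ultimately have "\<forall>\<^sub>F x in sequentially \<times>\<^sub>F sequentially.
        (case x of (i, j) \<Rightarrow> 2 * (norm (p (r i)))\<^sup>2 + 2 * (norm (p (r j)))\<^sup>2 - m\<^sup>2 * (norm (y (r i) + y (r j)))\<^sup>2) < e\<^sup>2"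
      using \<open>e > 0\<close> by (intro order_tendstoD(2)) auto
    then obtain N where N: "\<And>i j. i \<ge> N \<Longrightarrow> j \<ge> N \<Longrightarrow>
        2 * (norm (p (r i)))\<^sup>2 + 2 * (norm (p (r j)))\<^sup>2 - m\<^sup>2 * (norm (y (r i) + y (r j)))\<^sup>2 < e\<^sup>2"
      unfolding eventually_prod_sequentially by auto
    have "dist (p (r i)) (p (r j)) < e" if "i \<ge> N" "j \<ge> N" for i j
      using order.strict_trans1[OF dp N[OF that]] \<open>e > 0\<close>
      by (simp add: dist_norm power_less_imp_less_base)
    then show "\<exists>M. \<forall>m\<ge>M. \<forall>n\<ge>M. dist (p (r m)) (p (r n)) < e" by blast
  qed
  then obtain q where q: "(\<lambda>n. p (r n)) \<longlonglongrightarrow> q" using Cauchy_convergent convergent_def by blast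
  have vq: "gen v q" using gen_closed[of "\<lambda>n. y (r n)" "\<lambda>n. p (r n)"] yp(1) v q by auto
  have v1: "norm v = 1" using LIMSEQ_unique[OF tendsto_norm[OF v]] yp(3) by simp
  have "norm q = m" using LIMSEQ_unique[OF tendsto_norm[OF q] pr] .
  moreover have "v \<in> isom" using closed_sequentially[OF closed_isom _ v] yp(2) by auto
  ultimately have vF: "v \<in> F" using vq v1 by (auto simp: F_def)
  \<comment> \<open>First variation: |A y|^2 - m^2 |y|^2 is nonnegative on the isometric domain and
    vanishes on \<open>F\<close>, so its derivative in the direction \<open>x\<close> is 0.\<close>
  have EL: "inner p z = m\<^sup>2 * inner y x"
    if y: "y \<in> F" "gen y p" and x: "gen x z" "x \<in> isom" for y p x z
  proof -
    have py: "(norm p)\<^sup>2 = m\<^sup>2 * (norm y)\<^sup>2" "y \<in> isom"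
      using y gen_unique by (auto simp: F_def)
    define a where "a = inner p z - m\<^sup>2 * inner y x"
    define b where "b = (norm z)\<^sup>2 - m\<^sup>2 * (norm x)\<^sup>2"
    have "0 \<le> 2 * t * a + t\<^sup>2 * b" for t
    proof -
      have "m\<^sup>2 * (norm (y + t *\<^sub>R x))\<^sup>2 \<le> (norm (p + t *\<^sub>R z))\<^sup>2"
        by (rule m_le2) (use y x py in \<open>auto intro: gen_add gen_scale isom_add isom_scale\<close>)
      moreover have "(norm (a + t *\<^sub>R c))\<^sup>2 = (norm a)\<^sup>2 + 2 * t * inner a c + t\<^sup>2 * (norm c)\<^sup>2" for a c :: 'h
        unfolding power2_norm_eq_inner
        by (simp add: inner_add inner_commute[of c a] power2_eq_square algebra_simps)
      ultimately show ?thesis using py(1) by (simp add: a_def b_def algebra_simps)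
    qed
    then have q: "0 \<le> 2 * t * a + t\<^sup>2 * b" for t .
    have "b \<ge> 0" using m_le2[OF x] by (simp add: b_def)
    have "a = 0"
    proof (rule ccontr)
      assume "a \<noteq> 0"
      \<comment> \<open>At t = - s the quadratic equals - s^2 (b + 2); dividing by
        \<open>b + 1\<close> avoids a case split on b = 0.\<close>
      define s where "s = a / (b + 1)"
      have s: "a = s * (b + 1)" "s \<noteq> 0" using \<open>b \<ge> 0\<close> \<open>a \<noteq> 0\<close> by (auto simp: s_def)
      have "0 \<le> 2 * (- s) * a + (- s)\<^sup>2 * b" by (rule q)
      also have "\<dots> = - (s\<^sup>2 * (b + 2))" by (simp add: s(1) power2_eq_square algebra_simps)
      also have "\<dots> < 0" using \<open>b \<ge> 0\<close> s(2) by simp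
      finally show False by simp
    qed
    then show ?thesis by (simp add: a_def)
  qed
  have F_isom: "y \<in> isom" if "y \<in> F" for y using that by (simp add: F_def)
  have F_gen: "\<exists>p. gen y p \<and> (norm p)\<^sup>2 = m\<^sup>2 * (norm y)\<^sup>2" if "y \<in> F" for y using that by (simp add: F_def)
  have F_scale: "c *\<^sub>R y \<in> F" if y: "y \<in> F" for c y
  proof -
    obtain p where "gen y p" "(norm p)\<^sup>2 = m\<^sup>2 * (norm y)\<^sup>2" using F_gen[OF y] by blast
    then show ?thesis using F_isom[OF y] unfolding F_def
      by (auto intro!: isom_scale exI[of _ "c *\<^sub>R p"] gen_scale simp: power_mult_distrib)
  qed
  have F_add: "a + b \<in> F" if ab: "a \<in> F" "b \<in> F" for a b
  proof -
    obtain p q where pq: "gen a p" "(norm p)\<^sup>2 = m\<^sup>2 * (norm a)\<^sup>2" "gen b q" "(norm q)\<^sup>2 = m\<^sup>2 * (norm b)\<^sup>2"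
      using F_gen ab by metis
    \<comment> \<open>The mixed term of the expansion is exactly what \<open>EL\<close> supplies;
      this is why minimisers form a subspace.\<close>
    have "(norm (p + q))\<^sup>2 = m\<^sup>2 * (norm (a + b))\<^sup>2"
      using pq(2,4) EL[OF ab(1) pq(1) pq(3) F_isom[OF ab(2)]]
      by (simp add: power2_norm_eq_inner inner_add inner_commute algebra_simps)
    then show ?thesis unfolding F_def using F_isom ab gen_add[OF pq(1,3)] isom_add by blast
  qed
  have F_diff: "a - b \<in> F" if "a \<in> F" "b \<in> F" for a b
    using F_add[OF that(1) F_scale[OF that(2), of "-1"]] by simp
  have F_T: "T t y \<in> F" if y: "y \<in> F" and t: "0 \<le> t" for t y
  proof -
    obtain p where p: "gen y p" "(norm p)\<^sup>2 = m\<^sup>2 * (norm y)\<^sup>2" using F_gen[OF y] by blast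
    have "norm (T t p) = norm p" "norm (T t y) = norm y"
      using isom_norm gen_isom[OF p(1)] F_isom[OF y] t by auto
    then show ?thesis unfolding F_def using gen_T[OF p(1) t] isom_T[OF F_isom[OF y] t] p(2) by auto
  qed
  have F_lim: "l \<in> F" if x: "\<And>n. x n \<in> F" and l: "x \<longlonglongrightarrow> l" for x l
  proof -
    obtain p where p: "\<And>n. gen (x n) (p n)" "\<And>n. (norm (p n))\<^sup>2 = m\<^sup>2 * (norm (x n))\<^sup>2"
      using F_gen[OF x] by metis
    \<comment> \<open>Since \<open>F\<close> is a subspace, the norm equality holds for differences
      too, so the images converge together with the vectors.\<close>
    have d: "norm (p i - p j) = m * norm (x i - x j)" for i j
    proof -
      have "(norm (p i - p j))\<^sup>2 = (m * norm (x i - x j))\<^sup>2"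
        using F_gen[OF F_diff[OF x x]] gen_unique[OF gen_diff[OF p(1) p(1)]]
        by (metis power_mult_distrib)
      then show ?thesis using m0 by (simp add: power2_eq_iff_nonneg)
    qed
    have "Cauchy p"
    proof (rule metric_CauchyI)
      fix e :: real assume "e > 0"
      then have "e / (m + 1) > 0" using m0 by simp
      then obtain M where M: "\<And>i j. i \<ge> M \<Longrightarrow> j \<ge> M \<Longrightarrow> dist (x i) (x j) < e / (m + 1)"
        using metric_CauchyD[OF LIMSEQ_imp_Cauchy[OF l]] by metis
      have "dist (p i) (p j) < e" if "i \<ge> M" "j \<ge> M" for i j
      proof -
        have "dist (p i) (p j) \<le> (m + 1) * dist (x i) (x j)"
          using d[of i j] by (simp add: dist_norm algebra_simps)
        also have "\<dots> < e" using M[OF that] m0 by (simp add: field_simps)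
        finally show ?thesis .
      qed
      then show "\<exists>M. \<forall>m\<ge>M. \<forall>n\<ge>M. dist (p m) (p n) < e" by blast
    qed
    then obtain q where q: "p \<longlonglongrightarrow> q" using Cauchy_convergent convergent_def by blast
    have "gen l q" using gen_closed[OF p(1) l q] .
    moreover have "(norm q)\<^sup>2 = m\<^sup>2 * (norm l)\<^sup>2"
    proof (rule LIMSEQ_unique)
      show "(\<lambda>n. (norm (p n))\<^sup>2) \<longlonglongrightarrow> (norm q)\<^sup>2" using q by (intro tendsto_intros)
      show "(\<lambda>n. (norm (p n))\<^sup>2) \<longlonglongrightarrow> m\<^sup>2 * (norm l)\<^sup>2"
        unfolding p(2) using l by (intro tendsto_intros)
    qed
    ultimately show ?thesis unfolding F_def
      using closed_sequentially[OF closed_isom _ l] F_isom[OF x] by auto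
  qed
  have F_closed: "closed F" unfolding closed_sequential_limits using F_lim by blast
  have F_inv: "p \<in> F" if y: "y \<in> F" and p: "gen y p" for y p
  proof -
    have "((\<lambda>h. (1 / h) *\<^sub>R (T h y - y)) \<longlongrightarrow> p) (at_right 0)" using p by (simp add: gen_def)
    moreover have "\<forall>\<^sub>F h in at_right 0. (1 / h) *\<^sub>R (T h y - y) \<in> F"
      using y by (auto simp: eventually_at_right_field F_T F_diff F_scale intro!: exI[of _ 1])
    ultimately show ?thesis
      using Lim_in_closed_set[OF F_closed, of "\<lambda>h. (1 / h) *\<^sub>R (T h y - y)" "at_right 0"] by simp
  qed
  obtain q' where q': "gen q q'" using F_gen[OF F_inv[OF vF vq]] by blast
  define x where "x = q' + m\<^sup>2 *\<^sub>R v"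
  have qF: "q \<in> F" "q' \<in> F" using F_inv vF vq q' by blast+
  have xF: "x \<in> F" unfolding x_def using qF vF by (intro F_add F_scale)
  obtain z where z: "gen x z" using F_gen[OF xF] by blast
  \<comment> \<open>The candidate A^2 v + m^2 v lies in \<open>F\<close>, hence in the domain, and
    can be paired with itself. Skewness moves A from \<open>q\<close> to \<open>x\<close>,
    \<open>EL\<close> turns the second term into \<open>inner q z\<close>, and the two
    cancel.\<close>
  have "inner x x = inner q' x + m\<^sup>2 * inner v x"
    by (metis inner_add_left inner_scaleR_left x_def)
  also have "\<dots> = - inner z q + inner q z"
    using gen_isom_skew[OF q' F_isom[OF qF(1)] z F_isom[OF xF]] EL[OF vF vq z F_isom[OF xF]] by simp
  finally have "x = 0" by (simp add: inner_commute)
  then have "q' = - (m\<^sup>2) *\<^sub>R v" by (simp add: x_def eq_neg_iff_add_eq_0)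
  then have "v = 0" using eigen[OF vq, of m] q' by simp
  then show False using v1 by simp
qed

text \<open>LaSalle's principle: the energy decreases to a limit, a limit point of the orbit carries
  this value at all times and so belongs to \<open>isom\<close>. Vectors outside the domain are
  reached by density.\<close>

theorem strongly_stable:
  assumes compact: "\<And>U W. \<lbrakk>\<And>n. gen (U n) (W n); bounded (range U); bounded (range W);
      (\<lambda>n. inner (W n) (U n)) \<longlonglongrightarrow> 0\<rbrakk> \<Longrightarrow> \<exists>r w. strict_mono (r::nat \<Rightarrow> nat) \<and> (U \<circ> r) \<longlonglongrightarrow> w"
    and eigen: "\<And>y p m. gen y p \<Longrightarrow> gen p (- (m\<^sup>2) *\<^sub>R y) \<Longrightarrow> y = 0"
    and u: "u \<in> S"
  shows "((\<lambda>t. T t u) \<longlongrightarrow> 0) at_top"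
proof -
  have dom: "\<exists>t\<ge>0. norm (T t x) < e" if g: "gen x p" and "e > 0" for x p e
  proof -
    have xp: "x \<in> S" "p \<in> S" using g gen_in by auto
    have "\<exists>t\<ge>real n. \<bar>inner (T t p) (T t x)\<bar> < 1 / Suc n" for n
      by (rule energy_dissipation_small[OF g]) auto
    then obtain t where t: "\<And>n. t n \<ge> real n" "\<And>n. \<bar>inner (T (t n) p) (T (t n) x)\<bar> < 1 / Suc n"
      by metis
    have t0: "t n \<ge> 0" for n using t(1)[of n] of_nat_0_le_iff[of n] by linarith
    have "\<exists>r w. strict_mono (r::nat \<Rightarrow> nat) \<and> ((\<lambda>n. T (t n) x) \<circ> r) \<longlonglongrightarrow> w"
    proof (rule compact)
      show "gen (T (t n) x) (T (t n) p)" for n using gen_T[OF g t0] .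
      show "bounded (range (\<lambda>n. T (t n) x))" "bounded (range (\<lambda>n. T (t n) p))"
        using T_contr[OF t0] xp by (auto simp: bounded_iff)
      show "(\<lambda>n. inner (T (t n) p) (T (t n) x)) \<longlonglongrightarrow> 0"
        by (rule Lim_null_comparison[OF _ lim_inverse_n'[THEN LIMSEQ_Suc]])
          (use t(2) in \<open>simp add: less_imp_le\<close>)
    qed
    then obtain r w where r: "strict_mono (r::nat \<Rightarrow> nat)" and w: "(\<lambda>n. T (t (r n)) x) \<longlonglongrightarrow> w"
      by (auto simp: o_def)
    have wS: "w \<in> S" using closed_sequentially[OF closed_S _ w] T_in[OF t0 xp(1)] by blast
    \<comment> \<open>The energy is nonincreasing, so its limit along \<open>t (r n)\<close> bounds
      it from below at every time.\<close>
    have le: "norm w \<le> norm (T s x)" if "s \<ge> 0" for s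
    proof (rule LIMSEQ_le_const2[OF tendsto_norm[OF w]])
      obtain N :: nat where "s \<le> real N" using real_arch_simple by blast
      have "norm (T (t (r n)) x) \<le> norm (T s x)" if "n \<ge> N" for n
        using norm_T_antimono[OF \<open>s \<ge> 0\<close> _ xp(1), of "t (r n)"] t(1)[of "r n"] that \<open>s \<le> real N\<close>
          seq_suble[OF r, of n] by (meson of_nat_mono order_trans)
      then show "\<exists>N. \<forall>n\<ge>N. norm (T (t (r n)) x) \<le> norm (T s x)" by blast
    qed
    have "norm (T s w) = norm w" if s: "s \<ge> 0" for s
    proof (rule antisym)
      show "norm (T s w) \<le> norm w" by (rule T_contr[OF s wS])
      \<comment> \<open>\<open>T s\<close> applied to the sequence again gives points of the orbit,
        whose norms stay above \<open>norm w\<close>.\<close>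
      have "(\<lambda>n. T s (T (t (r n)) x)) \<longlonglongrightarrow> T s w"
        using T_tendsto_left[OF w _ wS s] T_in[OF t0 xp(1)] by simp
      moreover have "norm w \<le> norm (T s (T (t (r n)) x))" for n
        using le[of "s + t (r n)"] T_semigroup[OF s t0 xp(1)] s t0[of "r n"] by simp
      ultimately show "norm w \<le> norm (T s w)"
        by (intro LIMSEQ_le_const[OF tendsto_norm]) auto
    qed
    then have "w \<in> isom" using wS by (simp add: isom_def)
    moreover have "isom = {0}"
    proof (rule isom_trivial, goal_cases)
      case 1 then show ?case by (rule compact)
    next
      case 2 then show ?case by (rule eigen)
    qed
    ultimately have "w = 0" by simp
    then have "\<forall>\<^sub>F n in sequentially. norm (T (t (r n)) x) < e"
      using tendsto_norm[OF w] \<open>e > 0\<close> by (auto dest: order_tendstoD)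
    then show ?thesis using t0 by (auto simp: eventually_sequentially)
  qed
  show ?thesis
  proof (rule tendstoI)
    fix e :: real assume "e > 0"
    \<comment> \<open>An average of \<open>u\<close> lies in the domain and is close to
      \<open>u\<close>; contraction keeps the error small for all times.\<close>
    have "\<forall>\<^sub>F h in at_right 0. dist ((1 / h) *\<^sub>R integral {0..h} (\<lambda>r. T r u)) u < e / 2"
      using average_tendsto[OF u] \<open>e > 0\<close> by (intro tendstoD) auto
    then obtain h where h: "h > 0" "dist ((1 / h) *\<^sub>R integral {0..h} (\<lambda>r. T r u)) u < e / 2"
      by (auto simp: eventually_at_right_field) (metis dense)
    define x where "x = (1 / h) *\<^sub>R integral {0..h} (\<lambda>r. T r u)"
    have g: "gen x ((1 / h) *\<^sub>R (T h u - u))"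
      unfolding x_def using gen_average[OF u] h by (intro gen_scale) auto
    obtain s where s: "s \<ge> 0" "norm (T s x) < e / 2" using dom[OF g, of "e / 2"] \<open>e > 0\<close> by auto
    have "dist (T t u) 0 < e" if "t \<ge> s" for t
    proof -
      have "norm (T t u) \<le> norm (T t x) + norm (T t (u - x))"
        using T_diff[of t u x] that s u gen_in(1)[OF g] norm_triangle_ineq[of "T t x" "T t u - T t x"] by simp
      also have "\<dots> \<le> norm (T s x) + norm (u - x)"
        using norm_T_antimono[OF s(1) that] T_contr[of t "u - x"] that s u gen_in(1)[OF g]
        by (intro add_mono) (auto simp: S_diff)
      also have "\<dots> < e" using s h(2) by (simp add: x_def[symmetric] dist_norm norm_minus_commute)
      finally show ?thesis by simp
    qed
    then show "\<forall>\<^sub>F t in at_top. dist (T t u) 0 < e" by (auto simp: eventually_at_top_linorder)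
  qed
qed

end


section \<open>The Hilbert space $L^2$\<close>

lemma sq_integrable_rep_L2: "sq_integrable (rep_L2 u)"
  using Quotient_rep_reflp[OF Quotient_L2, of u] by (simp add: L2_rel_def)

lemma rep_L2_measurable [measurable]: "rep_L2 u \<in> borel_measurable borel"
  using sq_integrable_rep_L2[of u] by (simp add: sq_integrable_def)

lemma abs_rep_L2: "abs_L2 (rep_L2 u) = u"
  by (rule Quotient_abs_rep[OF Quotient_L2])

lemma rep_abs_L2:
  assumes "sq_integrable f" shows "AE x in lborel. rep_L2 (abs_L2 f) x = f x"
  using Quotient_rep_abs[OF Quotient_L2, of f] assms by (simp add: L2_rel_def)

lemma L2_eq_iff: "u = v \<longleftrightarrow> (AE x in lborel. rep_L2 u x = rep_L2 v x)"
  using Quotient_rel_rep[OF Quotient_L2, of u v] by (simp add: L2_rel_def sq_integrable_rep_L2)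

lemma abs_L2_add: "sq_integrable f \<Longrightarrow> sq_integrable g \<Longrightarrow> abs_L2 f + abs_L2 g = abs_L2 (\<lambda>x. f x + g x)"
  by (simp add: plus_L2.abs_eq L2_rel_def)

lemma abs_L2_scaleC: "sq_integrable f \<Longrightarrow> c *\<^sub>C abs_L2 f = abs_L2 (\<lambda>x. c * f x)"
  by (simp add: scaleC_L2.abs_eq L2_rel_def)

lemma rep_L2_add: "AE x in lborel. rep_L2 (u + v) x = rep_L2 u x + rep_L2 v x"
  using rep_abs_L2[OF sq_integrable_add[OF sq_integrable_rep_L2 sq_integrable_rep_L2, of u v]]
    abs_L2_add[OF sq_integrable_rep_L2 sq_integrable_rep_L2, of u v] by (simp add: abs_rep_L2)

lemma rep_L2_scaleC: "AE x in lborel. rep_L2 (c *\<^sub>C u) x = c * rep_L2 u x"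
  using rep_abs_L2[OF sq_integrable_scale[OF sq_integrable_rep_L2, of c u]]
    abs_L2_scaleC[OF sq_integrable_rep_L2, of c u] by (simp add: abs_rep_L2)

lemma rep_L2_scaleR: "AE x in lborel. rep_L2 (r *\<^sub>R u) x = of_real r * rep_L2 u x"
  unfolding scaleR_scaleC by (rule rep_L2_scaleC)

lemma rep_L2_zero: "AE x in lborel. rep_L2 0 x = 0"
  using rep_abs_L2[OF sq_integrable_zero] by (simp add: zero_L2_def)

lemma rep_L2_minus: "AE x in lborel. rep_L2 (- u) x = - rep_L2 u x"
  unfolding uminus_L2_def using rep_L2_scaleC[of "-1" u] by simp

lemma rep_L2_diff: "AE x in lborel. rep_L2 (u - v) x = rep_L2 u x - rep_L2 v x"
  using rep_L2_add[of u "- v"] rep_L2_minus[of v] by eventually_elim simp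

lemma integrable_mult_sq:
  assumes "sq_integrable f" "sq_integrable g"
  shows "integrable lborel (\<lambda>x. f x * g x)"
proof -
  have [measurable]: "f \<in> borel_measurable borel" "g \<in> borel_measurable borel"
    using assms by (auto simp: sq_integrable_def)
  have "integrable lborel (\<lambda>x. (cmod (f x))\<^sup>2 + (cmod (g x))\<^sup>2)"
    using assms by (auto simp: sq_integrable_def)
  then show ?thesis
  proof (rule Bochner_Integration.integrable_bound)
    have "norm (f x * g x) \<le> norm ((cmod (f x))\<^sup>2 + (cmod (g x))\<^sup>2)" for x
    proof -
      have "cmod (f x) * cmod (g x) * 2 \<le> (cmod (f x))\<^sup>2 + (cmod (g x))\<^sup>2"
        using sum_squares_bound[of "cmod (f x)" "cmod (g x)"] by simp
      moreover have "0 \<le> cmod (f x) * cmod (g x)" by simp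
      ultimately have "cmod (f x) * cmod (g x) \<le> (cmod (f x))\<^sup>2 + (cmod (g x))\<^sup>2" by linarith
      then show ?thesis by (simp add: norm_mult)
    qed
    then show "AE x in lborel. norm (f x * g x) \<le> norm ((cmod (f x))\<^sup>2 + (cmod (g x))\<^sup>2)" by simp
  qed measurable
qed

lemma borel_measurable_cnj [measurable (raw)]:
  "f \<in> borel_measurable M \<Longrightarrow> (\<lambda>x. cnj (f x)) \<in> borel_measurable M"
  by (rule borel_measurable_continuous_on[where f = cnj]) (auto intro: continuous_intros)

lemma sq_integrable_cnj: "sq_integrable f \<Longrightarrow> sq_integrable (\<lambda>x. cnj (f x))"
  by (auto simp: sq_integrable_def)

lemma integrable_mult_cnj:
  "sq_integrable f \<Longrightarrow> sq_integrable g \<Longrightarrow> integrable lborel (\<lambda>x. f x * cnj (g x))"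
  by (rule integrable_mult_sq[OF _ sq_integrable_cnj])

instantiation L2 :: real_inner
begin

text \<open>The real part of the Hermitian product gives the same norm on a real Hilbert space.
  Complex information is recovered by multiplying with i where it is needed.\<close>

definition inner_L2 :: "L2 \<Rightarrow> L2 \<Rightarrow> real"
  where "inner_L2 u v = Re (LBINT x. rep_L2 u x * cnj (rep_L2 v x))"

definition norm_L2 :: "L2 \<Rightarrow> real" where "norm_L2 u = sqrt (inner u u)"

definition dist_L2 :: "L2 \<Rightarrow> L2 \<Rightarrow> real" where "dist_L2 u v = norm (u - v)"

definition sgn_L2 :: "L2 \<Rightarrow> L2" where "sgn_L2 u = u /\<^sub>R norm u"

definition uniformity_L2 :: "(L2 \<times> L2) filter"
  where "uniformity_L2 = (INF e\<in>{0<..}. principal {(x, y). dist x y < e})"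

definition open_L2 :: "L2 set \<Rightarrow> bool"
  where "open_L2 U \<longleftrightarrow> (\<forall>x\<in>U. \<forall>\<^sub>F (x', y) in uniformity. x' = x \<longrightarrow> y \<in> U)"

instance
proof
  fix x y z :: L2 and r :: real
  show "inner x y = inner y x"
  proof -
    have "(LBINT t. rep_L2 y t * cnj (rep_L2 x t)) = cnj (LBINT t. rep_L2 x t * cnj (rep_L2 y t))"
      by (subst Bochner_Integration.integral_cnj[symmetric]) (simp add: mult.commute)
    then show ?thesis by (simp add: inner_L2_def)
  qed
  note int = integrable_mult_cnj[OF sq_integrable_rep_L2 sq_integrable_rep_L2]
  show "inner (x + y) z = inner x z + inner y z"
  proof -
    have "(LBINT t. rep_L2 (x + y) t * cnj (rep_L2 z t))
        = (LBINT t. rep_L2 x t * cnj (rep_L2 z t) + rep_L2 y t * cnj (rep_L2 z t))"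
    proof (rule integral_cong_AE)
      show "AE t in lborel. rep_L2 (x + y) t * cnj (rep_L2 z t)
          = rep_L2 x t * cnj (rep_L2 z t) + rep_L2 y t * cnj (rep_L2 z t)"
        using rep_L2_add[of x y] by eventually_elim (simp add: distrib_right)
    qed measurable
    then show ?thesis by (simp add: inner_L2_def Bochner_Integration.integral_add[OF int int])
  qed
  show "inner (r *\<^sub>R x) y = r * inner x y"
  proof -
    have "(LBINT t. rep_L2 (r *\<^sub>R x) t * cnj (rep_L2 y t))
        = (LBINT t. of_real r * (rep_L2 x t * cnj (rep_L2 y t)))"
    proof (rule integral_cong_AE)
      show "AE t in lborel. rep_L2 (r *\<^sub>R x) t * cnj (rep_L2 y t)
          = of_real r * (rep_L2 x t * cnj (rep_L2 y t))"
        using rep_L2_scaleR[of r x] by eventually_elim simp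
    qed measurable
    then show ?thesis by (simp add: inner_L2_def)
  qed
  have sq: "inner x x = (LBINT t. (cmod (rep_L2 x t))\<^sup>2)"
  proof -
    have "(LBINT t. rep_L2 x t * cnj (rep_L2 x t)) = (LBINT t. complex_of_real ((cmod (rep_L2 x t))\<^sup>2))"
      by (simp add: complex_norm_square[symmetric])
    then show ?thesis by (simp only: inner_L2_def integral_complex_of_real Re_complex_of_real)
  qed
  show "0 \<le> inner x x" by (simp add: sq)
  show "inner x x = 0 \<longleftrightarrow> x = 0"
  proof -
    have "(LBINT t. (cmod (rep_L2 x t))\<^sup>2) = 0 \<longleftrightarrow> (AE t in lborel. (cmod (rep_L2 x t))\<^sup>2 = 0)"
      using sq_integrable_rep_L2[of x] by (intro integral_nonneg_eq_0_iff_AE) (auto simp: sq_integrable_def)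
    also have "\<dots> \<longleftrightarrow> (AE t in lborel. rep_L2 x t = rep_L2 0 t)"
      using rep_L2_zero by (auto elim: eventually_elim2)
    finally show ?thesis by (simp add: sq L2_eq_iff)
  qed
  show "norm x = sqrt (inner x x)" by (rule norm_L2_def)
  show "dist x y = norm (x - y)" by (rule dist_L2_def)
  show "sgn x = x /\<^sub>R norm x" by (rule sgn_L2_def)
  show "(uniformity :: (L2 \<times> L2) filter) = (INF e\<in>{0<..}. principal {(x, y). dist x y < e})"
    by (rule uniformity_L2_def)
  show "open U \<longleftrightarrow> (\<forall>x\<in>U. \<forall>\<^sub>F (x', y) in uniformity. x' = x \<longrightarrow> y \<in> U)" for U :: "L2 set"
    by (rule open_L2_def)
qed

end

lemma norm_L2_sq: "(norm (u :: L2))\<^sup>2 = (LBINT x. (cmod (rep_L2 u x))\<^sup>2)"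
proof -
  have "(LBINT t. rep_L2 u t * cnj (rep_L2 u t)) = (LBINT t. complex_of_real ((cmod (rep_L2 u t))\<^sup>2))"
    by (simp add: complex_norm_square[symmetric])
  then have "inner u u = (LBINT x. (cmod (rep_L2 u x))\<^sup>2)"
    by (simp only: inner_L2_def integral_complex_of_real Re_complex_of_real)
  then show ?thesis by (simp add: power2_norm_eq_inner)
qed

lemma inner_abs_L2:
  assumes "sq_integrable f" "sq_integrable g"
  shows "inner (abs_L2 f) (abs_L2 g) = Re (LBINT x. f x * cnj (g x))"
proof -
  have [measurable]: "f \<in> borel_measurable borel" "g \<in> borel_measurable borel"
    using assms by (auto simp: sq_integrable_def)
  have "(LBINT x. rep_L2 (abs_L2 f) x * cnj (rep_L2 (abs_L2 g) x)) = (LBINT x. f x * cnj (g x))"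
  proof (rule integral_cong_AE)
    show "AE x in lborel. rep_L2 (abs_L2 f) x * cnj (rep_L2 (abs_L2 g) x) = f x * cnj (g x)"
      using rep_abs_L2[OF assms(1)] rep_abs_L2[OF assms(2)] by eventually_elim simp
  qed measurable
  then show ?thesis by (simp add: inner_L2_def)
qed

lemma norm_abs_L2_sq:
  assumes "sq_integrable f"
  shows "(norm (abs_L2 f))\<^sup>2 = (LBINT x. (cmod (f x))\<^sup>2)"
proof -
  have [measurable]: "f \<in> borel_measurable borel"
    using assms by (auto simp: sq_integrable_def)
  show ?thesis unfolding norm_L2_sq
    by (rule integral_cong_AE) (use rep_abs_L2[OF assms] in \<open>auto elim: eventually_mono\<close>)
qed

lemma nn_integral_rep_L2: "(\<integral>\<^sup>+x. ennreal ((cmod (rep_L2 u x))\<^sup>2) \<partial>lborel) = ennreal ((norm u)\<^sup>2)"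
  unfolding norm_L2_sq
  by (rule nn_integral_eq_integral) (use sq_integrable_rep_L2[of u] in \<open>auto simp: sq_integrable_def\<close>)

lemma nn_integral_rep_L2_diff:
  "(\<integral>\<^sup>+x. ennreal ((cmod (rep_L2 u x - rep_L2 v x))\<^sup>2) \<partial>lborel) = ennreal ((norm (u - v))\<^sup>2)"
  unfolding nn_integral_rep_L2[symmetric]
  by (rule nn_integral_cong_AE) (use rep_L2_diff[of u v] in \<open>auto elim: eventually_mono\<close>)

lemma sq_integrableI:
  assumes "f \<in> borel_measurable borel" "(\<integral>\<^sup>+x. ennreal ((cmod (f x))\<^sup>2) \<partial>lborel) < \<infinity>"
  shows "sq_integrable f"
  unfolding sq_integrable_def using assms by (auto intro!: integrableI_bounded)

text \<open>The summands 2^n (g n)^2 are bounded, which already puts \<open>g\<close> below a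
  geometric sequence of ratio \<open>1 / sqrt 2\<close>.\<close>

lemma pointwise_summable:
  fixes g :: "nat \<Rightarrow> real"
  assumes "summable (\<lambda>n. 2 ^ n * (g n)\<^sup>2)" "\<And>n. g n \<ge> 0"
  shows "summable g"
proof -
  have "bounded (range (\<lambda>n. 2 ^ n * (g n)\<^sup>2))"
    by (rule convergent_imp_bounded[OF summable_LIMSEQ_zero[OF assms(1)]])
  then obtain M where M: "\<And>n. \<bar>2 ^ n * (g n)\<^sup>2\<bar> \<le> M" by (auto simp: bounded_iff)
  have "norm (g n) \<le> sqrt M * (1 / sqrt 2) ^ n" for n
  proof -
    have "(g n)\<^sup>2 \<le> M / 2 ^ n" using M[of n] by (simp add: field_simps)
    then have "g n \<le> sqrt (M / 2 ^ n)" using assms(2)[of n] by (simp add: real_le_rsqrt)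
    then show ?thesis using assms(2)[of n]
      by (simp add: real_sqrt_divide real_sqrt_power power_divide)
  qed
  moreover have "summable (\<lambda>n. sqrt M * (1 / sqrt 2) ^ n)"
    by (intro summable_mult summable_geometric) simp
  ultimately show ?thesis by (rule summable_comparison_test'[rotated])
qed

lemma Cauchy_fast_subseq:
  fixes X :: "nat \<Rightarrow> 'a::metric_space"
  assumes "Cauchy X"
  obtains r :: "nat \<Rightarrow> nat" where "strict_mono r" "\<And>n. dist (X (r (Suc n))) (X (r n)) < (1/2) ^ n"
proof -
  have "\<exists>N. \<forall>m\<ge>N. \<forall>k\<ge>N. dist (X m) (X k) < (1/2) ^ n" for n
    by (rule metric_CauchyD[OF assms]) simp
  then obtain N where N: "\<And>n m k. m \<ge> N n \<Longrightarrow> k \<ge> N n \<Longrightarrow> dist (X m) (X k) < (1/2) ^ n" by metis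
  \<comment> \<open>The partial sum dominates \<open>N n\<close>, and the added \<open>n\<close>
    makes the sequence strictly increasing.\<close>
  define r where "r n = (\<Sum>i\<le>n. N i) + n" for n
  have s: "strict_mono r" by (rule strict_mono_Suc_iff[THEN iffD2]) (simp add: r_def)
  have "N n \<le> r n" for n unfolding r_def by (rule trans_le_add1) (auto intro: member_le_sum)
  moreover have "r n \<le> r (Suc n)" for n using s by (simp add: strict_mono_less_eq)
  ultimately have "dist (X (r (Suc n))) (X (r n)) < (1/2) ^ n" for n
    by (intro N) (auto intro: order_trans)
  with s show thesis by (rule that)
qed

text \<open>
  Riesz-Fischer: along a subsequence with \<open>\<parallel>X (r (n + 1)) - X (r n)\<parallel> \<le> 2\<^sup>-\<^sup>n\<close> the sum
  \<open>\<Sum>n. 2\<^sup>n |X (r (n + 1)) - X (r n)|\<^sup>2\<close> is integrable, hence finite almost everywhere.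
\<close>

instance L2 :: banach
proof
  fix X :: "nat \<Rightarrow> L2" assume X: "Cauchy X"
  obtain r where r: "strict_mono r" "\<And>n. dist (X (r (Suc n))) (X (r n)) < (1/2) ^ n"
    using Cauchy_fast_subseq[OF X] by metis
  define f where "f n = rep_L2 (X (r n))" for n
  have [measurable]: "f n \<in> borel_measurable borel" for n unfolding f_def by simp
  \<comment> \<open>\<open>lim\<close> is total and the result measurable; its arbitrary value where
    the sequence diverges affects only a null set.\<close>
  define F where "F x = lim (\<lambda>n. f n x)" for x
  have [measurable]: "F \<in> borel_measurable borel"
    unfolding F_def by (rule borel_measurable_lim_metric) measurable
  have "(\<integral>\<^sup>+x. (\<Sum>n. ennreal (2 ^ n * (cmod (f (Suc n) x - f n x))\<^sup>2)) \<partial>lborel)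
      = (\<Sum>n. \<integral>\<^sup>+x. ennreal (2 ^ n * (cmod (f (Suc n) x - f n x))\<^sup>2) \<partial>lborel)"
    by (rule nn_integral_suminf) measurable
  also have "\<dots> \<le> (\<Sum>n. ennreal ((1/2) ^ n))"
  proof (rule suminf_le)
    fix n
    have "(\<integral>\<^sup>+x. ennreal (2 ^ n * (cmod (f (Suc n) x - f n x))\<^sup>2) \<partial>lborel)
        = ennreal (2 ^ n) * (\<integral>\<^sup>+x. ennreal ((cmod (f (Suc n) x - f n x))\<^sup>2) \<partial>lborel)"
      by (subst nn_integral_cmult[symmetric]) (auto simp: ennreal_mult)
    also have "\<dots> = ennreal (2 ^ n * (dist (X (r (Suc n))) (X (r n)))\<^sup>2)"
      unfolding f_def nn_integral_rep_L2_diff dist_norm by (simp add: ennreal_mult)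
    also have "\<dots> \<le> ennreal ((1/2) ^ n)"
    proof (rule ennreal_leI)
      have "(dist (X (r (Suc n))) (X (r n)))\<^sup>2 \<le> ((1/2) ^ n)\<^sup>2"
        using r(2)[of n] by (intro power_mono) auto
      then have "2 ^ n * (dist (X (r (Suc n))) (X (r n)))\<^sup>2 \<le> 2 ^ n * ((1/2) ^ n)\<^sup>2"
        by (intro mult_left_mono) auto
      also have "\<dots> = (1/2) ^ n" by (simp add: power2_eq_square power_divide)
      finally show "2 ^ n * (dist (X (r (Suc n))) (X (r n)))\<^sup>2 \<le> (1/2) ^ n" .
    qed
    finally show "(\<integral>\<^sup>+x. ennreal (2 ^ n * (cmod (f (Suc n) x - f n x))\<^sup>2) \<partial>lborel) \<le> ennreal ((1/2) ^ n)" .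
  qed auto
  also have "\<dots> < \<infinity>"
    by (subst suminf_ennreal2) (auto intro: summable_geometric)
  finally have "(\<integral>\<^sup>+x. (\<Sum>n. ennreal (2 ^ n * (cmod (f (Suc n) x - f n x))\<^sup>2)) \<partial>lborel) \<noteq> \<infinity>" by simp
  then have "AE x in lborel. (\<Sum>n. ennreal (2 ^ n * (cmod (f (Suc n) x - f n x))\<^sup>2)) \<noteq> \<infinity>"
    by (intro nn_integral_PInf_AE) measurable
  then have ae: "AE x in lborel. (\<lambda>n. f n x) \<longlonglongrightarrow> F x"
  proof eventually_elim
    case (elim x)
    have "summable (\<lambda>n. 2 ^ n * (cmod (f (Suc n) x - f n x))\<^sup>2)"
      using elim by (intro summable_suminf_not_top) auto
    then have "summable (\<lambda>n. cmod (f (Suc n) x - f n x))" by (rule pointwise_summable) simp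
    then have "summable (\<lambda>n. f (Suc n) x - f n x)" by (rule summable_norm_cancel)
    then have "convergent (\<lambda>n. \<Sum>i<n. f (Suc i) x - f i x)" by (simp add: summable_iff_convergent)
    then have "convergent (\<lambda>n. (\<Sum>i<n. f (Suc i) x - f i x) + f 0 x)"
      by (intro convergent_add convergent_const)
    then have "convergent (\<lambda>n. f n x)" by (simp add: sum_lessThan_telescope[of "\<lambda>n. f n x"])
    then show ?case by (simp add: F_def convergent_LIMSEQ_iff)
  qed
  \<comment> \<open>Fatou along the subsequence transfers the Cauchy estimate to the pointwise
    limit, for differences with members of the full sequence.\<close>
  have fatou: "(\<integral>\<^sup>+x. ennreal ((cmod (F x - rep_L2 (X k) x))\<^sup>2) \<partial>lborel) \<le> ennreal (e\<^sup>2)"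
    if e: "e > 0" and N: "\<And>m. m \<ge> N \<Longrightarrow> dist (X m) (X k) < e" for e k N
  proof -
    have "(\<integral>\<^sup>+x. ennreal ((cmod (F x - rep_L2 (X k) x))\<^sup>2) \<partial>lborel)
        = (\<integral>\<^sup>+x. liminf (\<lambda>n. ennreal ((cmod (f n x - rep_L2 (X k) x))\<^sup>2)) \<partial>lborel)"
    proof (rule nn_integral_cong_AE)
      show "AE x in lborel. ennreal ((cmod (F x - rep_L2 (X k) x))\<^sup>2)
          = liminf (\<lambda>n. ennreal ((cmod (f n x - rep_L2 (X k) x))\<^sup>2))"
        using ae
      proof eventually_elim
        case (elim x)
        have "(\<lambda>n. ennreal ((cmod (f n x - rep_L2 (X k) x))\<^sup>2)) \<longlonglongrightarrow> ennreal ((cmod (F x - rep_L2 (X k) x))\<^sup>2)"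
          using elim by (intro tendsto_intros)
        then show ?case using lim_imp_Liminf[of sequentially] by fastforce
      qed
    qed
    also have "\<dots> \<le> liminf (\<lambda>n. \<integral>\<^sup>+x. ennreal ((cmod (f n x - rep_L2 (X k) x))\<^sup>2) \<partial>lborel)"
      by (rule nn_integral_liminf) measurable
    also have "\<dots> \<le> ennreal (e\<^sup>2)"
    proof (rule order_trans[OF Liminf_le_Limsup Limsup_bounded])
      show "\<forall>\<^sub>F n in sequentially. (\<integral>\<^sup>+x. ennreal ((cmod (f n x - rep_L2 (X k) x))\<^sup>2) \<partial>lborel) \<le> ennreal (e\<^sup>2)"
      proof (rule eventually_sequentiallyI)
        fix n assume "n \<ge> N"
        then have "dist (X (r n)) (X k) < e" using N seq_suble[OF r(1), of n] by (meson order_trans)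
        then have "(norm (X (r n) - X k))\<^sup>2 \<le> e\<^sup>2" by (intro power_mono) (auto simp: dist_norm)
        then show "(\<integral>\<^sup>+x. ennreal ((cmod (f n x - rep_L2 (X k) x))\<^sup>2) \<partial>lborel) \<le> ennreal (e\<^sup>2)"
          unfolding f_def nn_integral_rep_L2_diff by (rule ennreal_leI)
      qed
    qed simp
    finally show ?thesis .
  qed
  obtain N1 where N1: "\<And>m n. m \<ge> N1 \<Longrightarrow> n \<ge> N1 \<Longrightarrow> dist (X m) (X n) < 1"
    using metric_CauchyD[OF X, of 1] by auto
  \<comment> \<open>\<open>F\<close> is the sum of \<open>X N1\<close> and a difference that Fatou
    shows to be square integrable.\<close>
  have "sq_integrable (\<lambda>x. F x - rep_L2 (X N1) x)"
    by (rule sq_integrableI) (use fatou[of 1 N1 N1] N1 in \<open>auto intro: le_less_trans\<close>)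
  then have F: "sq_integrable F"
    using sq_integrable_add[OF _ sq_integrable_rep_L2[of "X N1"], of "\<lambda>x. F x - rep_L2 (X N1) x"] by simp
  have "X \<longlonglongrightarrow> abs_L2 F"
  proof (rule metric_LIMSEQ_I)
    fix e :: real assume "e > 0"
    then obtain N where N: "\<And>m n. m \<ge> N \<Longrightarrow> n \<ge> N \<Longrightarrow> dist (X m) (X n) < e / 2"
      using metric_CauchyD[OF X, of "e / 2"] by auto
    have "dist (X k) (abs_L2 F) < e" if "k \<ge> N" for k
    proof -
      have "ennreal ((norm (abs_L2 F - X k))\<^sup>2)
          = (\<integral>\<^sup>+x. ennreal ((cmod (F x - rep_L2 (X k) x))\<^sup>2) \<partial>lborel)"
        unfolding nn_integral_rep_L2_diff[symmetric]
        by (rule nn_integral_cong_AE) (use rep_abs_L2[OF F] in \<open>auto elim: eventually_mono\<close>)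
      also have "\<dots> \<le> ennreal ((e / 2)\<^sup>2)" by (rule fatou[where N = N]) (use \<open>e > 0\<close> N that in auto)
      finally have "(norm (abs_L2 F - X k))\<^sup>2 \<le> (e / 2)\<^sup>2"
        by (subst (asm) ennreal_le_iff) auto
      then have "norm (abs_L2 F - X k) \<le> e / 2" by (rule power2_le_imp_le) (use \<open>e > 0\<close> in simp)
      then show ?thesis using \<open>e > 0\<close> by (simp add: dist_norm norm_minus_commute)
    qed
    then show "\<exists>no. \<forall>n\<ge>no. dist (X n) (abs_L2 F) < e" by blast
  qed
  then show "convergent X" by (rule convergentI)
qed

lemma inner_scaleC: "inner (c *\<^sub>C u) v = inner u (cnj c *\<^sub>C (v :: L2))"
proof -
  have "(LBINT x. rep_L2 (c *\<^sub>C u) x * cnj (rep_L2 v x)) = (LBINT x. rep_L2 u x * cnj (rep_L2 (cnj c *\<^sub>C v) x))"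
  proof (rule integral_cong_AE)
    show "AE x in lborel. rep_L2 (c *\<^sub>C u) x * cnj (rep_L2 v x) = rep_L2 u x * cnj (rep_L2 (cnj c *\<^sub>C v) x)"
      using rep_L2_scaleC[of c u] rep_L2_scaleC[of "cnj c" v] by eventually_elim simp
  qed measurable
  then show ?thesis by (simp add: inner_L2_def)
qed

lemma norm_scaleC: "norm (c *\<^sub>C (u :: L2)) = cmod c * norm u"
proof -
  have "cnj c *\<^sub>C c *\<^sub>C u = (cmod c)\<^sup>2 *\<^sub>R u"
    by (simp add: scaleC_scaleC scaleR_scaleC complex_norm_square mult.commute del: of_real_power)
  then have "inner (c *\<^sub>C u) (c *\<^sub>C u) = (cmod c)\<^sup>2 * inner u u"
    unfolding inner_scaleC by simp
  then show ?thesis by (simp add: norm_eq_sqrt_inner real_sqrt_mult)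
qed

text \<open>Multiplication by i is skew for the real inner product; hence eigenvectors on the
  imaginary axis dissipate nothing.\<close>

lemma inner_ii_scaleC_self: "inner (\<i> *\<^sub>C u) (u :: L2) = 0"
proof -
  have "inner (\<i> *\<^sub>C u) u = inner u (- (\<i> *\<^sub>C u))"
    unfolding inner_scaleC by (simp add: uminus_L2_def scaleC_scaleC)
  then show ?thesis by (simp add: inner_commute)
qed


section \<open>Smooth functions and test functions\<close>

text \<open>Choosing a derivative inside the class and iterating the choice produces all
  derivatives, so no formula for the n-th one is ever needed.\<close>

lemma smooth_fun_coinduct:
  assumes "\<phi> \<in> F" "\<And>f. f \<in> F \<Longrightarrow> \<exists>g\<in>F. \<forall>x. (f has_vector_derivative g x) (at x)"
  shows "smooth_fun \<phi>"
proof -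
  obtain d where d: "\<And>f. f \<in> F \<Longrightarrow> d f \<in> F \<and> (\<forall>x. (f has_vector_derivative d f x) (at x))"
    using assms(2) by metis
  have "(d ^^ n) \<phi> \<in> F" for n by (induction n) (auto simp: assms(1) d)
  then show ?thesis unfolding smooth_fun_def
    by (intro exI[of _ "\<lambda>n. (d ^^ n) \<phi>"]) (auto simp: d)
qed

lemma smooth_fun_deriv:
  assumes "smooth_fun f"
  obtains g where "smooth_fun g" "\<And>x. (f has_vector_derivative g x) (at x)"
proof -
  obtain D where D: "D 0 = f" "\<And>n x. (D n has_vector_derivative D (Suc n) x) (at x)"
    using assms by (auto simp: smooth_fun_def)
  show ?thesis
  proof (rule that)
    show "smooth_fun (D 1)" unfolding smooth_fun_def
      by (intro exI[of _ "\<lambda>n. D (Suc n)"]) (auto simp: D)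
    show "(f has_vector_derivative D 1 x) (at x)" for x using D(2)[of 0 x] D(1) by simp
  qed
qed

lemma smooth_fun_vector_derivative:
  assumes "smooth_fun f"
  shows "smooth_fun (\<lambda>x. vector_derivative f (at x))"
    and "(f has_vector_derivative vector_derivative f (at x)) (at x)"
proof -
  obtain g where g: "smooth_fun g" "\<And>x. (f has_vector_derivative g x) (at x)"
    using smooth_fun_deriv[OF assms] by metis
  then have "(\<lambda>x. vector_derivative f (at x)) = g" by (auto intro: vector_derivative_at)
  with g show "smooth_fun (\<lambda>x. vector_derivative f (at x))"
      "(f has_vector_derivative vector_derivative f (at x)) (at x)"
    by (auto dest: fun_cong)
qed

lemma smooth_fun_primitive:
  assumes "smooth_fun g" "\<And>x. (f has_vector_derivative g x) (at x)"
  shows "smooth_fun f"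
  by (rule smooth_fun_coinduct[of _ "insert f {g. smooth_fun g}"])
    (use assms in \<open>auto elim: smooth_fun_deriv\<close>)

lemma smooth_fun_continuous: "smooth_fun f \<Longrightarrow> continuous_on A f"
  using smooth_fun_vector_derivative(2) has_vector_derivative_continuous
  by (blast intro: continuous_at_imp_continuous_on)

text \<open>The free factor \<open>c\<close> absorbs the \<open>r\<close> of the chain rule, so that
  the family is closed under differentiation.\<close>

lemma smooth_fun_mult_const_affine:
  assumes "smooth_fun f"
  shows "smooth_fun (\<lambda>x. c * f (r * x + s))"
proof (rule smooth_fun_coinduct[of _ "{\<lambda>x. c * f (r * x + s) | c f. smooth_fun f}"])
  show "\<exists>g\<in>{\<lambda>x. c * f (r * x + s) | c f. smooth_fun f}. \<forall>x. (h has_vector_derivative g x) (at x)"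
    if h0: "h \<in> {\<lambda>x. c * f (r * x + s) | c f. smooth_fun f}" for h
  proof -
    obtain c f where h: "h = (\<lambda>x. c * f (r * x + s))" "smooth_fun f" using h0 by auto
    obtain g where g: "smooth_fun g" "\<And>x. (f has_vector_derivative g x) (at x)"
      using smooth_fun_deriv[OF h(2)] by metis
    have "(h has_vector_derivative (c * of_real r) * g (r * x + s)) (at x)" for x
    proof -
      have "((\<lambda>x. r * x + s) has_vector_derivative r) (at x)"
        by (auto intro!: derivative_eq_intros)
      from vector_diff_chain_at[OF this g(2)]
      have "((\<lambda>x. f (r * x + s)) has_vector_derivative r *\<^sub>R g (r * x + s)) (at x)" by (simp add: o_def)
      then have "((\<lambda>x. c * f (r * x + s)) has_vector_derivative c * (r *\<^sub>R g (r * x + s))) (at x)"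
        by (rule has_vector_derivative_mult_right)
      then show ?thesis by (simp add: h(1) scaleR_conv_of_real mult.assoc)
    qed
    then show ?thesis
      using g(1) by (intro bexI[of _ "\<lambda>x. (c * of_real r) * g (r * x + s)"]) auto
  qed
qed (use assms in auto)

lemma smooth_fun_scale: "smooth_fun f \<Longrightarrow> smooth_fun (\<lambda>x. c * f x)"
  using smooth_fun_mult_const_affine[of f c 1 0] by simp

lemma smooth_fun_affine: "smooth_fun f \<Longrightarrow> smooth_fun (\<lambda>x. f (r * x + s))"
  using smooth_fun_mult_const_affine[of f 1 r s] by simp

lemma smooth_fun_add:
  assumes "smooth_fun f" "smooth_fun g" shows "smooth_fun (\<lambda>x. f x + g x)"
proof (rule smooth_fun_coinduct[of _ "{\<lambda>x. f x + g x | f g. smooth_fun f \<and> smooth_fun g}"])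
  show "\<exists>g\<in>{\<lambda>x. f x + g x | f g. smooth_fun f \<and> smooth_fun g}. \<forall>x. (h has_vector_derivative g x) (at x)"
    if h0: "h \<in> {\<lambda>x. f x + g x | f g. smooth_fun f \<and> smooth_fun g}" for h
  proof -
    obtain f g where h: "h = (\<lambda>x. f x + g x)" "smooth_fun f" "smooth_fun g" using h0 by auto
    obtain f' g' where "smooth_fun f'" "\<And>x. (f has_vector_derivative f' x) (at x)"
        "smooth_fun g'" "\<And>x. (g has_vector_derivative g' x) (at x)"
      using smooth_fun_deriv h(2,3) by metis
    then show ?thesis unfolding h(1)
      by (intro bexI[of _ "\<lambda>x. f' x + g' x"]) (auto intro: has_vector_derivative_add)
  qed
qed (use assms in auto)

text \<open>By the Leibniz rule sums of products are closed under differentiation; single products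
  are not.\<close>

inductive_set prod_span :: "(real \<Rightarrow> complex) set" where
  prod: "smooth_fun f \<Longrightarrow> smooth_fun g \<Longrightarrow> (\<lambda>x. f x * g x) \<in> prod_span"
| sum: "f \<in> prod_span \<Longrightarrow> g \<in> prod_span \<Longrightarrow> (\<lambda>x. f x + g x) \<in> prod_span"

lemma smooth_fun_mult:
  assumes "smooth_fun f" "smooth_fun g" shows "smooth_fun (\<lambda>x. f x * g x)"
proof (rule smooth_fun_coinduct[of _ prod_span])
  show "\<exists>g\<in>prod_span. \<forall>x. (h has_vector_derivative g x) (at x)" if "h \<in> prod_span" for h
    using that
  proof induction
    case (prod f g)
    obtain f' g' where "smooth_fun f'" "\<And>x. (f has_vector_derivative f' x) (at x)"
        "smooth_fun g'" "\<And>x. (g has_vector_derivative g' x) (at x)"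
      using smooth_fun_deriv prod by metis
    then show ?case using prod
      by (intro bexI[of _ "\<lambda>x. f x * g' x + f' x * g x"])
        (auto intro: has_vector_derivative_mult prod_span.intros)
  next
    case (sum f g)
    then obtain f' g' where "f' \<in> prod_span" "\<And>x. (f has_vector_derivative f' x) (at x)"
        "g' \<in> prod_span" "\<And>x. (g has_vector_derivative g' x) (at x)" by metis
    then show ?case
      by (intro bexI[of _ "\<lambda>x. f' x + g' x"]) (auto intro: has_vector_derivative_add prod_span.intros)
  qed
qed (use assms in \<open>auto intro: prod_span.intros\<close>)

lemma smooth_fun_cnj:
  assumes "smooth_fun f" shows "smooth_fun (\<lambda>x. cnj (f x))"
proof (rule smooth_fun_coinduct[of _ "{\<lambda>x. cnj (f x) | f. smooth_fun f}"])
  show "\<exists>g\<in>{\<lambda>x. cnj (f x) | f. smooth_fun f}. \<forall>x. (h has_vector_derivative g x) (at x)"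
    if h0: "h \<in> {\<lambda>x. cnj (f x) | f. smooth_fun f}" for h
  proof -
    obtain f where h: "h = (\<lambda>x. cnj (f x))" "smooth_fun f" using h0 by auto
    obtain f' where "smooth_fun f'" "\<And>x. (f has_vector_derivative f' x) (at x)"
      using smooth_fun_deriv h(2) by metis
    then show ?thesis unfolding h(1)
      by (intro bexI[of _ "\<lambda>x. cnj (f' x)"]) (auto intro: has_vector_derivative_cnj)
  qed
qed (use assms in auto)

section \<open>Cutoff functions built from exp (- c / x)\<close>

lemma poly_exp_tendsto_0:
  fixes p :: "real poly"
  assumes "c > 0"
  shows "((\<lambda>y. poly p y * exp (- c * y)) \<longlongrightarrow> 0) at_top"
proof -
  have *: "((\<lambda>y. y ^ k * exp (- c * y)) \<longlongrightarrow> 0) at_top" for k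
  proof -
    have "filterlim (\<lambda>y. c * y) at_top at_top"
      using assms by (intro filterlim_tendsto_pos_mult_at_top[OF tendsto_const] filterlim_ident)
    from filterlim_compose[OF tendsto_power_div_exp_0 this, of k]
    have "((\<lambda>y. (1 / c ^ k) * ((c * y) ^ k / exp (c * y))) \<longlongrightarrow> (1 / c ^ k) * 0) at_top"
      by (intro tendsto_mult tendsto_const)
    then show ?thesis using assms by (simp add: power_mult_distrib exp_minus field_simps)
  qed
  have "((\<lambda>y. \<Sum>i\<le>degree p. coeff p i * (y ^ i * exp (- c * y))) \<longlongrightarrow> (\<Sum>i\<le>degree p. coeff p i * 0)) at_top"
    by (intro tendsto_sum tendsto_mult tendsto_const *)
  then show ?thesis by (simp add: poly_altdef sum_distrib_right mult.assoc)
qed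

text \<open>The classical function that is flat at 0; an arbitrary polynomial in
  \<open>1 / x\<close> is carried along to make the family closed under differentiation.\<close>

definition flat_exp :: "real \<Rightarrow> real poly \<Rightarrow> real \<Rightarrow> real"
  where "flat_exp c p x = (if x > 0 then poly p (1 / x) * exp (- c * (1 / x)) else 0)"

text \<open>With y = 1 / x the y-derivative of \<open>p * exp (- c * y)\<close> is
  \<open>(pderiv p - c * p) * exp (- c * y)\<close>, and dy / dx = - y^2; this is the origin of the
  polynomial. At x = 0 exponential decay beats every power of y.\<close>

lemma flat_exp_deriv:
  assumes "c > 0"
  shows "(flat_exp c p has_real_derivative flat_exp c ([:0, 0, 1:] * (smult c p - pderiv p)) x) (at x)"
proof -
  consider "x > 0" | "x < 0" | "x = 0" by linarith
  then show ?thesis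
  proof cases
    case 1
    have "((\<lambda>x. poly p (1 / x) * exp (- c * (1 / x))) has_real_derivative
        flat_exp c ([:0, 0, 1:] * (smult c p - pderiv p)) x) (at x)"
      using 1 by (auto intro!: derivative_eq_intros DERIV_chain2[OF poly_DERIV]
          simp: flat_exp_def power2_eq_square field_simps)
    then show ?thesis
      by (rule has_field_derivative_transform_within_open[of _ _ _ "{0<..}"]) (use 1 in \<open>auto simp: flat_exp_def\<close>)
  next
    case 2
    have "((\<lambda>x. 0) has_real_derivative flat_exp c ([:0, 0, 1:] * (smult c p - pderiv p)) x) (at x)"
      using 2 by (simp add: flat_exp_def)
    then show ?thesis
      by (rule has_field_derivative_transform_within_open[of _ _ _ "{..<0}"]) (use 2 in \<open>auto simp: flat_exp_def\<close>)
  next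
    case 3
    have "((\<lambda>h. (flat_exp c p (0 + h) - flat_exp c p 0) / h) \<longlongrightarrow> 0) (at 0)"
    proof (rule filterlim_split_at)
      show "((\<lambda>h. (flat_exp c p (0 + h) - flat_exp c p 0) / h) \<longlongrightarrow> 0) (at_left 0)"
        by (rule tendsto_eventually) (auto simp: eventually_at_filter flat_exp_def)
      have "((\<lambda>h. poly (pCons 0 p) (1 / h) * exp (- c * (1 / h))) \<longlongrightarrow> 0) (at_right 0)"
        using filterlim_compose[OF poly_exp_tendsto_0[OF assms, of "pCons 0 p"] filterlim_inverse_at_top_right]
        by (simp add: inverse_eq_divide)
      moreover have "\<forall>\<^sub>F h in at_right 0. poly (pCons 0 p) (1 / h) * exp (- c * (1 / h))
          = (flat_exp c p (0 + h) - flat_exp c p 0) / h"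
        by (auto simp: eventually_at_filter flat_exp_def)
      ultimately show "((\<lambda>h. (flat_exp c p (0 + h) - flat_exp c p 0) / h) \<longlongrightarrow> 0) (at_right 0)"
        by (rule Lim_transform_eventually)
    qed
    then show ?thesis using 3 by (simp add: DERIV_def flat_exp_def)
  qed
qed

lemma smooth_fun_flat_exp:
  assumes "c > 0" shows "smooth_fun (\<lambda>x. complex_of_real (flat_exp c p x))"
proof (rule smooth_fun_coinduct[of _ "{\<lambda>x. complex_of_real (flat_exp c p x) | p. True}"])
  fix f assume "f \<in> {\<lambda>x. complex_of_real (flat_exp c p x) | p. True}"
  then obtain p where p: "f = (\<lambda>x. complex_of_real (flat_exp c p x))" by auto
  have "(f has_vector_derivative complex_of_real (flat_exp c ([:0, 0, 1:] * (smult c p - pderiv p)) x)) (at x)" for x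
    unfolding p using flat_exp_deriv[OF assms]
    by (intro has_vector_derivative_of_real) (simp only: has_real_derivative_iff_has_vector_derivative)
  then show "\<exists>g\<in>{\<lambda>x. complex_of_real (flat_exp c p x) | p. True}. \<forall>x. (f has_vector_derivative g x) (at x)"
    by (intro bexI[of _ "\<lambda>x. complex_of_real (flat_exp c ([:0, 0, 1:] * (smult c p - pderiv p)) x)"]) blast+
qed auto

text \<open>\<open>c\<close> sets the steepness: as it tends to 0 the bumps, always between 0 and 1,
  converge to the indicator of the open interval.\<close>

definition bump :: "real \<Rightarrow> real \<Rightarrow> real \<Rightarrow> real \<Rightarrow> real"
  where "bump a b c x = flat_exp c 1 (x - a) * flat_exp c 1 (b - x)"

lemma smooth_fun_bump: "c > 0 \<Longrightarrow> smooth_fun (\<lambda>x. complex_of_real (bump a b c x))"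
  using smooth_fun_mult[OF smooth_fun_affine[OF smooth_fun_flat_exp[of c 1], of 1 "- a"]
      smooth_fun_affine[OF smooth_fun_flat_exp[of c 1], of "-1" b]]
  by (simp add: bump_def)

lemma bump_outside: "x \<notin> {a<..<b} \<Longrightarrow> bump a b c x = 0"
  by (auto simp: bump_def flat_exp_def)

lemma bump_bounds: "c > 0 \<Longrightarrow> 0 \<le> bump a b c x" "c > 0 \<Longrightarrow> bump a b c x \<le> 1"
  by (auto simp: bump_def flat_exp_def intro!: mult_le_one)

lemma bump_pos: "x \<in> {a<..<b} \<Longrightarrow> 0 < bump a b c x"
  by (auto simp: bump_def flat_exp_def)

lemma bump_tendsto: "(\<lambda>n. bump a b (1 / Suc n) x) \<longlonglongrightarrow> indicator {a<..<b} x"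
proof (cases "x \<in> {a<..<b}")
  case True
  have "(\<lambda>n. exp (- (1 / real (Suc n)) * (1 / (x - a))) * exp (- (1 / real (Suc n)) * (1 / (b - x))))
      \<longlonglongrightarrow> exp (- 0 * (1 / (x - a))) * exp (- 0 * (1 / (b - x)))"
    by (intro tendsto_intros lim_inverse_n'[THEN LIMSEQ_Suc])
  then show ?thesis using True by (simp add: bump_def flat_exp_def)
next
  case False
  then show ?thesis using bump_outside[OF False] by simp
qed

lemma test_fun_bump: "c > 0 \<Longrightarrow> 0 < a \<Longrightarrow> b < L \<Longrightarrow> test_fun L (\<lambda>x. complex_of_real (bump a b c x))"
  unfolding test_fun_def using smooth_fun_bump bump_outside
  by (metis (no_types, lifting) greaterThanLessThan_subseteq_atLeastAtMost_iff of_real_0 order_refl subsetD)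

lemma test_fun_smooth: "test_fun L \<phi> \<Longrightarrow> smooth_fun \<phi>"
  by (simp add: test_fun_def)

lemma test_fun_outside: "test_fun L \<phi> \<Longrightarrow> x \<notin> {0<..<L} \<Longrightarrow> \<phi> x = 0"
  unfolding test_fun_def by force

lemma test_fun_scale: "test_fun L \<phi> \<Longrightarrow> test_fun L (\<lambda>x. c * \<phi> x)"
  unfolding test_fun_def using smooth_fun_scale by fastforce

lemma test_fun_cnj: "test_fun L \<phi> \<Longrightarrow> test_fun L (\<lambda>x. cnj (\<phi> x))"
  unfolding test_fun_def using smooth_fun_cnj by fastforce

lemma test_fun_add:
  assumes "test_fun L \<phi>" "test_fun L \<psi>" shows "test_fun L (\<lambda>x. \<phi> x + \<psi> x)"
proof -
  obtain a b where ab: "0 < a" "b < L" "\<And>x. x \<notin> {a..b} \<Longrightarrow> \<phi> x = 0"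
    using assms(1) unfolding test_fun_def by blast
  obtain a' b' where ab': "0 < a'" "b' < L" "\<And>x. x \<notin> {a'..b'} \<Longrightarrow> \<psi> x = 0"
    using assms(2) unfolding test_fun_def by blast
  have "\<phi> x + \<psi> x = 0" if "x \<notin> {min a a'..max b b'}" for x
  proof -
    have "x \<notin> {a..b}" "x \<notin> {a'..b'}" using that by auto
    then show ?thesis using ab(3) ab'(3) by simp
  qed
  moreover have "0 < min a a'" "max b b' < L" using ab ab' by auto
  ultimately show ?thesis unfolding test_fun_def
    using smooth_fun_add[OF test_fun_smooth[OF assms(1)] test_fun_smooth[OF assms(2)]]
    by (intro conjI exI[of _ "min a a'"] exI[of _ "max b b'"] allI impI)
qed

lemma test_fun_deriv:
  assumes "test_fun L \<phi>" shows "test_fun L (\<lambda>x. vector_derivative \<phi> (at x))"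
proof -
  obtain a b where ab: "0 < a" "b < L" "\<And>x. x \<notin> {a..b} \<Longrightarrow> \<phi> x = 0"
    using assms unfolding test_fun_def by metis
  have "vector_derivative \<phi> (at x) = 0" if "x \<notin> {a..b}" for x
  proof (rule vector_derivative_at)
    show "(\<phi> has_vector_derivative 0) (at x)"
      by (rule has_vector_derivative_transform_within_open[of "\<lambda>x. 0" _ _ "- {a..b}"])
        (use that ab(3) in auto)
  qed
  then show ?thesis unfolding test_fun_def
    using ab(1,2) smooth_fun_vector_derivative(1)[OF test_fun_smooth[OF assms]] by blast
qed

lemma test_fun_has_deriv:
  "test_fun L \<phi> \<Longrightarrow> (\<phi> has_vector_derivative vector_derivative \<phi> (at x)) (at x)"
  by (rule smooth_fun_vector_derivative(2)[OF test_fun_smooth])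

lemma sq_integrable_continuous:
  fixes f :: "real \<Rightarrow> complex"
  assumes "continuous_on {a..b} f"
  shows "sq_integrable (\<lambda>x. indicator {a..b} x *\<^sub>R f x)"
  unfolding sq_integrable_def
proof
  have f: "set_integrable lborel {a..b} f" by (rule borel_integrable_atLeastAtMost'[OF assms])
  show "(\<lambda>x. indicator {a..b} x *\<^sub>R f x) \<in> borel_measurable lborel"
    using f unfolding set_integrable_def by (rule borel_measurable_integrable)
  have "set_integrable lborel {a..b} (\<lambda>x. (cmod (f x))\<^sup>2)"
    by (rule borel_integrable_atLeastAtMost') (intro continuous_intros assms)
  then show "integrable lborel (\<lambda>x. (cmod (indicator {a..b} x *\<^sub>R f x))\<^sup>2)"
    unfolding set_integrable_def
    by (rule Bochner_Integration.integrable_cong[THEN iffD1, rotated 2])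
      (auto simp: indicator_def power_mult_distrib)
qed

lemma sq_integrable_test_fun: "test_fun L \<phi> \<Longrightarrow> sq_integrable \<phi>"
proof -
  assume t: "test_fun L \<phi>"
  have "(\<lambda>x. indicator {0..L} x *\<^sub>R \<phi> x) = \<phi>"
    using test_fun_outside[OF t] by (auto simp: indicator_def fun_eq_iff)
  then show ?thesis
    using sq_integrable_continuous[OF smooth_fun_continuous[OF test_fun_smooth[OF t]], of 0 L] by simp
qed


section \<open>Weak derivatives\<close>

lemma norm_L2_mono:
  assumes "AE x in lborel. cmod (rep_L2 u x) \<le> M * cmod (rep_L2 v x)" "0 \<le> M"
  shows "norm u \<le> M * norm v"
proof -
  have "(norm u)\<^sup>2 \<le> (LBINT x. M\<^sup>2 * (cmod (rep_L2 v x))\<^sup>2)"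
    unfolding norm_L2_sq
  proof (rule integral_mono_AE)
    show "AE x in lborel. (cmod (rep_L2 u x))\<^sup>2 \<le> M\<^sup>2 * (cmod (rep_L2 v x))\<^sup>2"
      using assms(1)
    proof eventually_elim
      case (elim x)
      then have "(cmod (rep_L2 u x))\<^sup>2 \<le> (M * cmod (rep_L2 v x))\<^sup>2" by (intro power_mono) auto
      then show ?case by (simp add: power_mult_distrib)
    qed
  qed (use sq_integrable_rep_L2 in \<open>auto simp: sq_integrable_def\<close>)
  then have "(norm u)\<^sup>2 \<le> (M * norm v)\<^sup>2" by (simp add: norm_L2_sq power_mult_distrib)
  then show ?thesis by (rule power2_le_imp_le) (use assms(2) in simp)
qed

lemma sq_integrable_mult_bounded:
  assumes [measurable]: "d \<in> borel_measurable borel" and d: "\<And>x. \<bar>d x\<bar> \<le> M" and f: "sq_integrable f"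
  shows "sq_integrable (\<lambda>x. complex_of_real (d x) * f x)"
  unfolding sq_integrable_def
proof
  have [measurable]: "f \<in> borel_measurable borel" using f by (auto simp: sq_integrable_def)
  show "(\<lambda>x. complex_of_real (d x) * f x) \<in> borel_measurable lborel" by measurable
  have "integrable lborel (\<lambda>x. M\<^sup>2 * (cmod (f x))\<^sup>2)" using f by (auto simp: sq_integrable_def)
  then show "integrable lborel (\<lambda>x. (cmod (complex_of_real (d x) * f x))\<^sup>2)"
  proof (rule Bochner_Integration.integrable_bound)
    have "(cmod (complex_of_real (d x) * f x))\<^sup>2 \<le> M\<^sup>2 * (cmod (f x))\<^sup>2" for x
    proof -
      have "cmod (complex_of_real (d x) * f x) \<le> M * cmod (f x)"
        using d[of x] by (simp add: norm_mult mult_right_mono)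
      then have "(cmod (complex_of_real (d x) * f x))\<^sup>2 \<le> (M * cmod (f x))\<^sup>2" by (intro power_mono) auto
      then show ?thesis by (simp add: power_mult_distrib)
    qed
    then show "AE x in lborel. norm ((cmod (complex_of_real (d x) * f x))\<^sup>2) \<le> norm (M\<^sup>2 * (cmod (f x))\<^sup>2)"
      by simp
  qed measurable
qed

text \<open>\<open>\<odot>\<close> goes through \<open>abs_L2\<close>, so it has the intended value
  when the product is square integrable, and boundedness guarantees that. Instances are the damping,
  the indicator of the complement of (0, L), and the cosine and sine of a rotation.\<close>

locale bounded_multiplier =
  fixes d :: "real \<Rightarrow> real" and M :: real
  assumes d_measurable [measurable]: "d \<in> borel_measurable borel"
    and d_bound: "\<And>x. \<bar>d x\<bar> \<le> M"
begin

lemma M_nonneg: "0 \<le> M" using d_bound[of 0] by linarith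

lemma rep_fn_mult: "AE x in lborel. rep_L2 (d \<odot> u) x = complex_of_real (d x) * rep_L2 u x"
  unfolding fn_mult_def
  by (rule rep_abs_L2[OF sq_integrable_mult_bounded[OF d_measurable d_bound sq_integrable_rep_L2]])

lemma norm_fn_mult_le: "norm (d \<odot> u) \<le> M * norm u"
proof (rule norm_L2_mono[OF _ M_nonneg])
  show "AE x in lborel. cmod (rep_L2 (d \<odot> u) x) \<le> M * cmod (rep_L2 u x)"
    using rep_fn_mult[of u] by eventually_elim (simp add: norm_mult mult_right_mono d_bound)
qed

lemma fn_mult_add: "d \<odot> (u + v) = d \<odot> u + d \<odot> v"
  unfolding L2_eq_iff
  using rep_fn_mult[of u] rep_fn_mult[of v] rep_fn_mult[of "u + v"] rep_L2_add[of u v]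
    rep_L2_add[of "d \<odot> u" "d \<odot> v"]
  by eventually_elim (simp add: distrib_left)

lemma fn_mult_scaleC: "d \<odot> (c *\<^sub>C u) = c *\<^sub>C (d \<odot> u)"
  unfolding L2_eq_iff
  using rep_fn_mult[of u] rep_fn_mult[of "c *\<^sub>C u"] rep_L2_scaleC[of c u] rep_L2_scaleC[of c "d \<odot> u"]
  by eventually_elim simp

lemma fn_mult_scaleR: "d \<odot> (c *\<^sub>R u) = c *\<^sub>R (d \<odot> u)"
  by (simp add: scaleR_scaleC fn_mult_scaleC)

lemma bounded_linear_fn_mult: "bounded_linear (\<lambda>u. d \<odot> u)"
proof (rule bounded_linear_intro[of _ M])
  show "norm (d \<odot> u) \<le> norm u * M" for u using norm_fn_mult_le[of u] by (simp add: mult.commute)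
qed (simp_all add: fn_mult_add fn_mult_scaleR)

end

text \<open>As the kernel of a bounded operator, \<open>L2_on\<close> is at once a closed
  subspace.\<close>

lemma L2_on_eq_ker: "L2_on L = {u. (indicator (- {0<..<L}) :: real \<Rightarrow> real) \<odot> u = 0}"
proof -
  interpret bounded_multiplier "indicator (- {0<..<L})" 1
    by standard (auto simp: indicator_def)
  have "(AE x in lborel. x \<notin> {0<..<L} \<longrightarrow> rep_L2 u x = 0) \<longleftrightarrow>
      (AE x in lborel. rep_L2 ((indicator (- {0<..<L}) :: real \<Rightarrow> real) \<odot> u) x = rep_L2 0 x)" (is "?l \<longleftrightarrow> ?r") for u
  proof
    assume ?l then show ?r
      using rep_fn_mult[of u] rep_L2_zero by eventually_elim (auto simp: indicator_def)
  next
    assume ?r then show ?l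
      using rep_fn_mult[of u] rep_L2_zero by eventually_elim (auto simp: indicator_def)
  qed
  then show ?thesis by (simp add: L2_on_def L2_eq_iff)
qed

lemma subspace_L2_on: "subspace (L2_on L)" and closed_L2_on: "closed (L2_on L)"
proof -
  interpret bounded_multiplier "indicator (- {0<..<L})" 1
    by standard (auto simp: indicator_def)
  show "subspace (L2_on L)" unfolding L2_on_eq_ker
    by (rule linear_subspace_kernel[OF bounded_linear.linear[OF bounded_linear_fn_mult]])
  show "closed (L2_on L)" unfolding L2_on_eq_ker
    by (rule closed_Collect_eq[OF linear_continuous_on[OF bounded_linear_fn_mult] continuous_on_const])
qed

lemma L2_on_add: "u \<in> L2_on L \<Longrightarrow> v \<in> L2_on L \<Longrightarrow> u + v \<in> L2_on L"
  and L2_on_diff: "u \<in> L2_on L \<Longrightarrow> v \<in> L2_on L \<Longrightarrow> u - v \<in> L2_on L"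
  and L2_on_scaleR: "u \<in> L2_on L \<Longrightarrow> r *\<^sub>R u \<in> L2_on L"
  and L2_on_zero: "0 \<in> L2_on L"
  using subspace_L2_on by (auto simp: subspace_add subspace_diff subspace_scale subspace_0)

lemma L2_on_scaleC:
  assumes "u \<in> L2_on L" shows "c *\<^sub>C u \<in> L2_on L"
proof -
  have "AE x in lborel. x \<notin> {0<..<L} \<longrightarrow> rep_L2 u x = 0" using assms by (simp add: L2_on_def)
  then have "AE x in lborel. x \<notin> {0<..<L} \<longrightarrow> rep_L2 (c *\<^sub>C u) x = 0"
    using rep_L2_scaleC[of c u] by eventually_elim auto
  then show ?thesis by (simp add: L2_on_def)
qed

lemma set_integral_L2_on:
  fixes g :: "real \<Rightarrow> 'b::{banach, second_countable_topology}"
  assumes "AE x in lborel. x \<notin> {0<..<L} \<longrightarrow> g x = 0" "g \<in> borel_measurable borel"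
  shows "(LBINT x:{0<..<L}. g x) = (LBINT x. g x)"
  unfolding set_lebesgue_integral_def
  by (rule integral_cong_AE) (use assms in \<open>auto elim!: eventually_mono simp: indicator_def\<close>)

lemma test_fun_measurable: "test_fun L \<phi> \<Longrightarrow> \<phi> \<in> borel_measurable borel"
  using sq_integrable_test_fun[of L \<phi>] by (simp add: sq_integrable_def)

lemma abs_test_L2_on: "test_fun L \<phi> \<Longrightarrow> abs_L2 \<phi> \<in> L2_on L"
  unfolding L2_on_def mem_Collect_eq using rep_abs_L2[OF sq_integrable_test_fun[of L \<phi>]]
  by (auto elim!: eventually_mono simp: test_fun_outside)

abbreviation vderiv :: "(real \<Rightarrow> complex) \<Rightarrow> real \<Rightarrow> complex"
  where "vderiv \<phi> \<equiv> \<lambda>x. vector_derivative \<phi> (at x)"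

lemma set_integral_test_fun:
  assumes "test_fun L \<phi>"
  shows "(LBINT x:{0<..<L}. rep_L2 u x * \<phi> x) = (LBINT x. rep_L2 u x * \<phi> x)"
proof (rule set_integral_L2_on)
  have [measurable]: "\<phi> \<in> borel_measurable borel" using test_fun_measurable[OF assms] .
  show "(\<lambda>x. rep_L2 u x * \<phi> x) \<in> borel_measurable borel" by measurable
qed (use test_fun_outside[OF assms] in auto)

lemma Re_integral_test:
  assumes "test_fun L \<phi>"
  shows "Re (LBINT x. rep_L2 u x * \<phi> x) = inner u (abs_L2 (\<lambda>x. cnj (\<phi> x)))"
  using inner_abs_L2[OF sq_integrable_rep_L2[of u] sq_integrable_test_fun[OF test_fun_cnj[OF assms]]]
  by (simp add: abs_rep_L2)

lemma vderiv_cnj: "test_fun L \<phi> \<Longrightarrow> vector_derivative (\<lambda>x. cnj (\<phi> x)) (at x) = cnj (vderiv \<phi> x)"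
  by (rule vector_derivative_at, rule has_vector_derivative_cnj, rule test_fun_has_deriv)

lemma vderiv_scale: "test_fun L \<phi> \<Longrightarrow> vector_derivative (\<lambda>x. c * \<phi> x) (at x) = c * vderiv \<phi> x"
  by (rule vector_derivative_at, rule has_vector_derivative_mult_right, rule test_fun_has_deriv)

lemma vderiv_add: "test_fun L \<phi> \<Longrightarrow> test_fun L \<psi> \<Longrightarrow>
    vector_derivative (\<lambda>x. \<phi> x + \<psi> x) (at x) = vderiv \<phi> x + vderiv \<psi> x"
  by (rule vector_derivative_at, rule has_vector_derivative_add; rule test_fun_has_deriv)

text \<open>Testing against \<open>\<phi>\<close> and \<open>\<i> \<phi>\<close> recovers the complex identity from the real inner product.\<close>

lemma has_weak_deriv_iff:
  "has_weak_deriv L u w \<longleftrightarrow> u \<in> L2_on L \<and> w \<in> L2_on L \<and>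
    (\<forall>\<phi>. test_fun L \<phi> \<longrightarrow> inner u (abs_L2 (vderiv \<phi>)) = - inner w (abs_L2 \<phi>))"
proof -
  have "(\<forall>\<phi>. test_fun L \<phi> \<longrightarrow> (LBINT x. rep_L2 u x * vderiv \<phi> x) = - (LBINT x. rep_L2 w x * \<phi> x)) \<longleftrightarrow>
      (\<forall>\<phi>. test_fun L \<phi> \<longrightarrow> inner u (abs_L2 (vderiv \<phi>)) = - inner w (abs_L2 \<phi>))" (is "?l \<longleftrightarrow> ?r")
  proof
    assume l: ?l
    show ?r
    proof (intro allI impI)
      fix \<phi> assume t: "test_fun L \<phi>"
      \<comment> \<open>\<open>inner\<close> conjugates its second argument, hence the conjugated
        test function.\<close>
      show "inner u (abs_L2 (vderiv \<phi>)) = - inner w (abs_L2 \<phi>)"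
        using l[rule_format, OF test_fun_cnj[OF t]] Re_integral_test[OF test_fun_cnj[OF t], of w]
          Re_integral_test[OF test_fun_cnj[OF test_fun_deriv[OF t]], of u] vderiv_cnj[OF t]
        by simp
    qed
  next
    assume r: ?r
    show ?l
    proof (intro allI impI)
      fix \<phi> assume t: "test_fun L \<phi>"
      have *: "Re (LBINT x. rep_L2 u x * vderiv \<psi> x) = - Re (LBINT x. rep_L2 w x * \<psi> x)"
        if t: "test_fun L \<psi>" for \<psi>
        using r[rule_format, OF test_fun_cnj[OF t]] Re_integral_test[OF t, of w]
          Re_integral_test[OF test_fun_deriv[OF t], of u] vderiv_cnj[OF t] by simp
      have "Re (\<i> * (LBINT x. rep_L2 u x * vderiv \<phi> x)) = - Re (\<i> * (LBINT x. rep_L2 w x * \<phi> x))"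
        using *[OF test_fun_scale[OF t, of \<i>]] vderiv_scale[OF t, of \<i>]
        by (simp add: mult.left_commute[of _ \<i>])
      with *[OF t] show "(LBINT x. rep_L2 u x * vderiv \<phi> x) = - (LBINT x. rep_L2 w x * \<phi> x)"
        by (simp add: complex_eq_iff)
    qed
  qed
  then show ?thesis
    unfolding has_weak_deriv_def using set_integral_test_fun test_fun_deriv by fastforce
qed

lemma integrable_L2_on:
  assumes "u \<in> L2_on L" shows "integrable lborel (rep_L2 u)"
proof -
  have "sq_integrable (\<lambda>x. indicator {0..L} x *\<^sub>R 1)" by (rule sq_integrable_continuous) (rule continuous_on_const)
  from integrable_mult_sq[OF sq_integrable_rep_L2[of u] this]
  have i: "integrable lborel (\<lambda>x. rep_L2 u x * (indicator {0..L} x *\<^sub>R 1))" .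
  have "AE x in lborel. rep_L2 u x = rep_L2 u x * (indicator {0..L} x *\<^sub>R 1)"
    using assms unfolding L2_on_def by (auto elim!: eventually_mono simp: indicator_def)
  then show ?thesis using i by (subst integrable_cong_AE[where g = "\<lambda>x. rep_L2 u x * (indicator {0..L} x *\<^sub>R 1)"]) auto
qed

text \<open>Dynkin's argument: open intervals are stable under intersection and generate the Borel
  sets. \<open>UNIV0\<close> handles complements, since the line is not one of these bounded
  intervals.\<close>

lemma AE_0_if_integral_intervals_0:
  fixes W :: "real \<Rightarrow> complex"
  assumes int: "integrable lborel W" and 0: "\<And>a b. (LBINT x:{a<..<b}. W x) = 0"
    and UNIV0: "(LBINT x. W x) = 0"
  shows "AE x in lborel. W x = 0"
proof (rule sigma_finite_measure.density_zero[OF lborel.sigma_finite_measure_axioms int])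
  have si: "set_integrable lborel A W" if "A \<in> sets borel" for A
    using that int unfolding set_integrable_def by (auto intro: integrable_mult_indicator)
  fix A :: "real set" assume "A \<in> sets lborel"
  then have A: "A \<in> sigma_sets UNIV (range (\<lambda>(a, b). {a<..<b}))"
    by (simp add: borel_eq_box box_real)
  have "Int_stable (range (\<lambda>(a, b). {a<..<b::real}))"
    unfolding Int_stable_def
  proof safe
    fix a b c d :: real
    show "{a<..<b} \<inter> {c<..<d} \<in> range (\<lambda>(a, b). {a<..<b})"
      by (rule image_eqI[of _ _ "(max a c, min b d)"]) auto
  qed
  moreover have "range (\<lambda>(a, b). {a<..<b::real}) \<subseteq> Pow UNIV" by simp
  moreover note A
  ultimately have "(LBINT x:A. W x) = 0 \<and> A \<in> sets borel"
  proof (induction A rule: sigma_sets_induct_disjoint)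
    case (basic A)
    then show ?case using 0 by auto
  next
    case empty
    show ?case by (simp add: set_lebesgue_integral_def)
  next
    case (compl A)
    have "(LBINT x. W x) = (LBINT x:A \<union> (UNIV - A). W x)" by (simp add: set_lebesgue_integral_def)
    also have "\<dots> = (LBINT x:A. W x) + (LBINT x:UNIV - A. W x)"
      by (rule set_integral_Un) (use compl in \<open>auto intro: si\<close>)
    finally show ?case using compl UNIV0 by auto
  next
    case (union A)
    have "(LBINT x:(\<Union>i. A i). W x) = (\<Sum>i. (LBINT x:A i. W x))"
      by (rule lebesgue_integral_countable_add)
        (use union in \<open>auto simp: disjoint_family_on_def intro!: si\<close>)
    then show ?case using union by auto
  qed
  then show "(LBINT x:A. W x) = 0" by simp
qed

text \<open>The fundamental lemma of the calculus of variations: bumps approximate indicators of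
  intervals, and integrals over intervals determine \<open>w\<close>. Testing also with i times a
  test function upgrades real orthogonality to complex.\<close>

lemma test_fun_dense:
  assumes w: "w \<in> L2_on L" and orth: "\<And>\<phi>. test_fun L \<phi> \<Longrightarrow> inner w (abs_L2 \<phi>) = 0"
  shows "w = 0"
proof -
  have int: "integrable lborel (rep_L2 w)" by (rule integrable_L2_on[OF w])
  have orth': "(LBINT x. rep_L2 w x * \<phi> x) = 0" if t: "test_fun L \<phi>" for \<phi>
  proof -
    have *: "Re (LBINT x. rep_L2 w x * \<psi> x) = 0" if "test_fun L \<psi>" for \<psi>
      using Re_integral_test[OF that, of w] orth[OF test_fun_cnj[OF that]] by simp
    have "Re (\<i> * (LBINT x. rep_L2 w x * \<phi> x)) = 0"
      using *[OF test_fun_scale[OF t, of \<i>]] by (simp add: mult.left_commute[of _ \<i>])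
    then show ?thesis using *[OF t] by (simp add: complex_eq_iff)
  qed
  \<comment> \<open>Intervals with both ends strictly inside, where the bumps are admissible test
    functions.\<close>
  have inner_int: "(LBINT x. rep_L2 w x * indicator {a<..<b} x) = 0" if ab: "0 < a" "b < L" for a b
  proof -
    have "(\<lambda>n. LBINT x. rep_L2 w x * of_real (bump a b (1 / Suc n) x))
        \<longlonglongrightarrow> (LBINT x. rep_L2 w x * indicator {a<..<b} x)"
    proof (rule integral_dominated_convergence[where w = "\<lambda>x. cmod (rep_L2 w x)"])
      show "(\<lambda>x. rep_L2 w x * of_real (bump a b (1 / Suc n) x)) \<in> borel_measurable lborel" for n
        using test_fun_measurable[OF test_fun_bump[of "1 / Suc n" a b L]] ab by measurable
      show "AE x in lborel. (\<lambda>n. rep_L2 w x * of_real (bump a b (1 / Suc n) x))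
          \<longlonglongrightarrow> rep_L2 w x * indicator {a<..<b} x"
      proof (rule AE_I2)
        fix x
        have "(\<lambda>n. complex_of_real (bump a b (1 / Suc n) x)) \<longlonglongrightarrow> of_real (indicator {a<..<b} x)"
          by (intro tendsto_of_real bump_tendsto)
        moreover have "complex_of_real (indicator {a<..<b} x) = indicator {a<..<b} x"
          by (simp add: indicator_def)
        ultimately have "(\<lambda>n. complex_of_real (bump a b (1 / Suc n) x)) \<longlonglongrightarrow> indicator {a<..<b} x" by simp
        then show "(\<lambda>n. rep_L2 w x * of_real (bump a b (1 / Suc n) x)) \<longlonglongrightarrow> rep_L2 w x * indicator {a<..<b} x"
          by (intro tendsto_mult tendsto_const)
      qed
      show "AE x in lborel. norm (rep_L2 w x * of_real (bump a b (1 / Suc n) x)) \<le> cmod (rep_L2 w x)" for n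
        using bump_bounds[of "1 / Suc n" a b] by (auto simp: norm_mult mult_left_le)
    qed (use int in auto)
    then show ?thesis
      using orth'[OF test_fun_bump[of "1 / Suc _" a b L]] ab LIMSEQ_unique[OF _ tendsto_const] by simp
  qed
  \<comment> \<open>Intervals that may touch the boundary are exhausted from inside, moving each end
    by \<open>1 / Suc n\<close>.\<close>
  have all_int: "(LBINT x. rep_L2 w x * indicator {a<..<b} x) = 0" if ab: "0 \<le> a" "b \<le> L" for a b
  proof -
    have "(\<lambda>n. LBINT x. rep_L2 w x * indicator {a + 1 / Suc n<..<b - 1 / Suc n} x)
        \<longlonglongrightarrow> (LBINT x. rep_L2 w x * indicator {a<..<b} x)"
    proof (rule integral_dominated_convergence[where w = "\<lambda>x. cmod (rep_L2 w x)"])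
      show "AE x in lborel. (\<lambda>n. rep_L2 w x * indicator {a + 1 / Suc n<..<b - 1 / Suc n} x)
          \<longlonglongrightarrow> rep_L2 w x * indicator {a<..<b} x"
      proof (rule AE_I2)
        fix x
        show "(\<lambda>n. rep_L2 w x * indicator {a + 1 / Suc n<..<b - 1 / Suc n} x) \<longlonglongrightarrow> rep_L2 w x * indicator {a<..<b} x"
        proof (cases "x \<in> {a<..<b}")
          case True
          have "\<forall>\<^sub>F n in sequentially. 1 / real (Suc n) < min (x - a) (b - x)"
            using True by (intro order_tendstoD(2)[OF lim_inverse_n'[THEN LIMSEQ_Suc]]) auto
          then have "\<forall>\<^sub>F n in sequentially. rep_L2 w x * indicator {a + 1 / Suc n<..<b - 1 / Suc n} x
              = rep_L2 w x * indicator {a<..<b} x"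
            by eventually_elim (use True in \<open>auto simp: indicator_def\<close>)
          then show ?thesis by (rule tendsto_eventually)
        next
          case False
          have "x \<notin> {a + 1 / Suc n<..<b - 1 / Suc n}" for n
          proof
            assume "x \<in> {a + 1 / Suc n<..<b - 1 / Suc n}"
            moreover have "0 < 1 / real (Suc n)" by simp
            ultimately have "x \<in> {a<..<b}" unfolding greaterThanLessThan_iff by linarith
            with False show False by simp
          qed
          then show ?thesis using False by simp
        qed
      qed
      show "AE x in lborel. norm (rep_L2 w x * indicator {a + 1 / Suc n<..<b - 1 / Suc n} x) \<le> cmod (rep_L2 w x)" for n
        by (auto simp: indicator_def)
    qed (use int in auto)
    moreover have "(LBINT x. rep_L2 w x * indicator {a + 1 / Suc n<..<b - 1 / Suc n} x) = 0" for n
      using ab by (intro inner_int) (auto simp: add_nonneg_pos less_le_trans diff_less_eq add_pos_nonneg le_less_trans)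
    ultimately show ?thesis by (simp add: LIMSEQ_const_iff)
  qed
  \<comment> \<open>\<open>w\<close> vanishes outside (0, L), so any interval may be cut down to one
    already treated.\<close>
  have clip: "(LBINT x:A. rep_L2 w x) = (LBINT x. rep_L2 w x * indicator (A \<inter> {0<..<L}) x)"
    if [measurable]: "A \<in> sets borel" for A
    unfolding set_lebesgue_integral_def
    by (rule integral_cong_AE) (use w in \<open>auto simp: L2_on_def indicator_def elim!: eventually_mono\<close>)
  have "AE x in lborel. rep_L2 w x = 0"
  proof (rule AE_0_if_integral_intervals_0[OF int])
    show "(LBINT x:{a<..<b}. rep_L2 w x) = 0" for a b
    proof -
      have "{a<..<b} \<inter> {0<..<L} = {max a 0<..<min b L}" by auto
      then show ?thesis using all_int[of "max a 0" "min b L"] by (simp add: clip)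
    qed
    show "(LBINT x. rep_L2 w x) = 0"
      using clip[of UNIV] all_int[of 0 L] by (simp add: set_lebesgue_integral_def)
  qed
  then show ?thesis unfolding L2_eq_iff using rep_L2_zero by eventually_elim simp
qed

lemma has_weak_deriv_unique:
  assumes "has_weak_deriv L u w" "has_weak_deriv L u w'" shows "w = w'"
  using test_fun_dense[of "w - w'" L] assms
  by (auto simp: has_weak_deriv_iff L2_on_diff inner_diff_left)

lemma weak_deriv_eq: "has_weak_deriv L u w \<Longrightarrow> weak_deriv L u = w"
  unfolding weak_deriv_def by (rule the_equality) (auto intro: has_weak_deriv_unique)

lemma H1_iff: "u \<in> H1 L \<longleftrightarrow> has_weak_deriv L u (weak_deriv L u)"
  unfolding H1_def using weak_deriv_eq by auto

lemma has_weak_deriv_add: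
  "has_weak_deriv L u w \<Longrightarrow> has_weak_deriv L u' w' \<Longrightarrow> has_weak_deriv L (u + u') (w + w')"
  by (auto simp: has_weak_deriv_iff L2_on_add inner_add_left)

lemma has_weak_deriv_scaleR: "has_weak_deriv L u w \<Longrightarrow> has_weak_deriv L (r *\<^sub>R u) (r *\<^sub>R w)"
  by (auto simp: has_weak_deriv_iff L2_on_scaleR)

lemma has_weak_deriv_diff:
  "has_weak_deriv L u w \<Longrightarrow> has_weak_deriv L u' w' \<Longrightarrow> has_weak_deriv L (u - u') (w - w')"
  by (auto simp: has_weak_deriv_iff L2_on_diff inner_diff_left)

lemma abs_L2_test_scale: "test_fun L \<phi> \<Longrightarrow> c *\<^sub>C abs_L2 \<phi> = abs_L2 (\<lambda>x. c * \<phi> x)"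
  by (rule abs_L2_scaleC[OF sq_integrable_test_fun])

lemma has_weak_deriv_scaleC:
  assumes "has_weak_deriv L u w" shows "has_weak_deriv L (c *\<^sub>C u) (c *\<^sub>C w)"
  unfolding has_weak_deriv_iff
proof (intro conjI allI impI)
  fix \<phi> assume t: "test_fun L \<phi>"
  have "inner u (abs_L2 (vderiv (\<lambda>x. cnj c * \<phi> x))) = - inner w (abs_L2 (\<lambda>x. cnj c * \<phi> x))"
    using assms test_fun_scale[OF t] unfolding has_weak_deriv_iff by blast
  then show "inner (c *\<^sub>C u) (abs_L2 (vderiv \<phi>)) = - inner (c *\<^sub>C w) (abs_L2 \<phi>)"
    by (simp add: inner_scaleC abs_L2_test_scale[OF t] abs_L2_test_scale[OF test_fun_deriv[OF t]] vderiv_scale[OF t])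
qed (use assms in \<open>auto simp: has_weak_deriv_iff L2_on_scaleC\<close>)

lemma has_weak_deriv_zero: "has_weak_deriv L 0 0"
  by (auto simp: has_weak_deriv_iff L2_on_zero)

lemma has_weak_deriv_tendsto:
  assumes d: "\<And>n. has_weak_deriv L (u n) (w n)" and u: "u \<longlonglongrightarrow> a" and w: "w \<longlonglongrightarrow> b"
  shows "has_weak_deriv L a b"
  unfolding has_weak_deriv_iff
proof (intro conjI allI impI)
  show "a \<in> L2_on L" "b \<in> L2_on L"
    using closed_sequentially[OF closed_L2_on _ u] closed_sequentially[OF closed_L2_on _ w] d
    by (auto simp: has_weak_deriv_iff)
  fix \<phi> assume t: "test_fun L \<phi>"
  have "(\<lambda>n. inner (u n) (abs_L2 (vderiv \<phi>))) \<longlonglongrightarrow> inner a (abs_L2 (vderiv \<phi>))"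
    using u by (intro tendsto_intros)
  moreover have "inner (u n) (abs_L2 (vderiv \<phi>)) = - inner (w n) (abs_L2 \<phi>)" for n
    using d t by (auto simp: has_weak_deriv_iff)
  moreover have "(\<lambda>n. - inner (w n) (abs_L2 \<phi>)) \<longlonglongrightarrow> - inner b (abs_L2 \<phi>)"
    using w by (intro tendsto_intros)
  ultimately show "inner a (abs_L2 (vderiv \<phi>)) = - inner b (abs_L2 \<phi>)"
    by (simp add: LIMSEQ_unique)
qed


section \<open>The space $H^1_0$\<close>

text \<open>Replaces \<open>weak_deriv\<close> by a witness and the integral by two norms, the form
  in which limits can be taken. \<open>small\<close> and \<open>small'\<close> convert between a sum
  of squares and a pair of bounds.\<close>

lemma H10_iff:
  "u \<in> H10 L \<longleftrightarrow> (\<exists>w. has_weak_deriv L u w \<and> (\<forall>e>0. \<exists>\<phi>. test_fun L \<phi> \<and>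
      norm (u - abs_L2 \<phi>) < e \<and> norm (w - abs_L2 (vderiv \<phi>)) < e))"
proof -
  have *: "(LBINT x:{0<..<L}. (cmod (rep_L2 u x - \<phi> x))\<^sup>2 + (cmod (rep_L2 w x - vderiv \<phi> x))\<^sup>2)
      = (norm (u - abs_L2 \<phi>))\<^sup>2 + (norm (w - abs_L2 (vderiv \<phi>)))\<^sup>2"
    if d: "has_weak_deriv L u w" and t: "test_fun L \<phi>" for w \<phi>
  proof -
    have [measurable]: "\<phi> \<in> borel_measurable borel" "vderiv \<phi> \<in> borel_measurable borel"
      using test_fun_measurable[OF t] test_fun_measurable[OF test_fun_deriv[OF t]] by auto
    have ae: "AE x in lborel. x \<notin> {0<..<L} \<longrightarrow> rep_L2 u x = 0" "AE x in lborel. x \<notin> {0<..<L} \<longrightarrow> rep_L2 w x = 0"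
      using d by (auto simp: has_weak_deriv_iff L2_on_def)
    have "(LBINT x:{0<..<L}. (cmod (rep_L2 u x - \<phi> x))\<^sup>2 + (cmod (rep_L2 w x - vderiv \<phi> x))\<^sup>2)
        = (LBINT x. (cmod (rep_L2 u x - \<phi> x))\<^sup>2 + (cmod (rep_L2 w x - vderiv \<phi> x))\<^sup>2)"
    proof (rule set_integral_L2_on)
      show "AE x in lborel. x \<notin> {0<..<L} \<longrightarrow>
          (cmod (rep_L2 u x - \<phi> x))\<^sup>2 + (cmod (rep_L2 w x - vderiv \<phi> x))\<^sup>2 = 0"
        using ae by eventually_elim (auto simp: test_fun_outside[OF t] test_fun_outside[OF test_fun_deriv[OF t]])
    qed measurable
    also have "\<dots> = (LBINT x. (cmod (rep_L2 (u - abs_L2 \<phi>) x))\<^sup>2 + (cmod (rep_L2 (w - abs_L2 (vderiv \<phi>)) x))\<^sup>2)"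
    proof (rule integral_cong_AE)
      show "AE x in lborel. (cmod (rep_L2 u x - \<phi> x))\<^sup>2 + (cmod (rep_L2 w x - vderiv \<phi> x))\<^sup>2
          = (cmod (rep_L2 (u - abs_L2 \<phi>) x))\<^sup>2 + (cmod (rep_L2 (w - abs_L2 (vderiv \<phi>)) x))\<^sup>2"
        using rep_L2_diff[of u "abs_L2 \<phi>"] rep_L2_diff[of w "abs_L2 (vderiv \<phi>)"]
          rep_abs_L2[OF sq_integrable_test_fun[OF t]] rep_abs_L2[OF sq_integrable_test_fun[OF test_fun_deriv[OF t]]]
        by eventually_elim simp
    qed measurable
    also have "\<dots> = (norm (u - abs_L2 \<phi>))\<^sup>2 + (norm (w - abs_L2 (vderiv \<phi>)))\<^sup>2"
      unfolding norm_L2_sq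
      by (rule Bochner_Integration.integral_add) (use sq_integrable_rep_L2 in \<open>auto simp: sq_integrable_def\<close>)
    finally show ?thesis .
  qed
  have small: "a\<^sup>2 + b\<^sup>2 < 2 * e\<^sup>2" if "0 \<le> a" "0 \<le> b" "a < e" "b < e" for a b e :: real
    using power_strict_mono[of a e 2] power_strict_mono[of b e 2] that by simp
  have small': "a < e \<and> b < e" if "0 \<le> a" "0 \<le> b" "0 < e" "a\<^sup>2 + b\<^sup>2 < e\<^sup>2" for a b e :: real
  proof -
    have "a\<^sup>2 < e\<^sup>2" "b\<^sup>2 < e\<^sup>2" using that(4) zero_le_power2[of a] zero_le_power2[of b] by linarith+
    then show ?thesis using that by (auto intro: power_less_imp_less_base)
  qed
  show ?thesis
  proof
    assume u: "u \<in> H10 L"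
    define w where "w = weak_deriv L u"
    have d: "has_weak_deriv L u w" using u by (simp add: H10_def H1_iff w_def)
    have "\<exists>\<phi>. test_fun L \<phi> \<and> norm (u - abs_L2 \<phi>) < e \<and> norm (w - abs_L2 (vderiv \<phi>)) < e" if "e > 0" for e
    proof -
      have "e\<^sup>2 > 0" using that by simp
      then obtain \<phi> where t: "test_fun L \<phi>" and
        "(LBINT x:{0<..<L}. (cmod (rep_L2 u x - \<phi> x))\<^sup>2 + (cmod (rep_L2 w x - vderiv \<phi> x))\<^sup>2) < e\<^sup>2"
        using u unfolding H10_def w_def by blast
      then show ?thesis using small'[of "norm (u - abs_L2 \<phi>)" "norm (w - abs_L2 (vderiv \<phi>))" e] *[OF d t] that
        by auto
    qed
    then show "\<exists>w. has_weak_deriv L u w \<and> (\<forall>e>0. \<exists>\<phi>. test_fun L \<phi> \<and>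
      norm (u - abs_L2 \<phi>) < e \<and> norm (w - abs_L2 (vderiv \<phi>)) < e)" using d by blast
  next
    assume "\<exists>w. has_weak_deriv L u w \<and> (\<forall>e>0. \<exists>\<phi>. test_fun L \<phi> \<and>
      norm (u - abs_L2 \<phi>) < e \<and> norm (w - abs_L2 (vderiv \<phi>)) < e)"
    then obtain w where d: "has_weak_deriv L u w" and w: "\<And>e. e > 0 \<Longrightarrow> \<exists>\<phi>. test_fun L \<phi> \<and>
      norm (u - abs_L2 \<phi>) < e \<and> norm (w - abs_L2 (vderiv \<phi>)) < e" by blast
    have "u \<in> H1 L" using d by (auto simp: H1_def)
    moreover have "\<exists>\<phi>. test_fun L \<phi> \<and>
      (LBINT x:{0<..<L}. (cmod (rep_L2 u x - \<phi> x))\<^sup>2 + (cmod (rep_L2 (weak_deriv L u) x - vderiv \<phi> x))\<^sup>2) < e"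
      if "e > 0" for e
    proof -
      obtain \<phi> where t: "test_fun L \<phi>" and
          "norm (u - abs_L2 \<phi>) < sqrt (e / 2)" "norm (w - abs_L2 (vderiv \<phi>)) < sqrt (e / 2)"
        using w[of "sqrt (e / 2)"] \<open>e > 0\<close> by auto
      then have "(norm (u - abs_L2 \<phi>))\<^sup>2 + (norm (w - abs_L2 (vderiv \<phi>)))\<^sup>2 < 2 * (sqrt (e / 2))\<^sup>2"
        by (intro small) auto
      also have "\<dots> = e" using \<open>e > 0\<close> by simp
      finally show ?thesis using *[OF d t] t weak_deriv_eq[OF d] by auto
    qed
    ultimately show "u \<in> H10 L" by (simp add: H10_def)
  qed
qed

lemma H10_approx:
  assumes "u \<in> H10 L" "has_weak_deriv L u w" "e > 0"
  obtains \<phi> where "test_fun L \<phi>" "norm (u - abs_L2 \<phi>) < e" "norm (w - abs_L2 (vderiv \<phi>)) < e"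
  using assms has_weak_deriv_unique unfolding H10_iff by metis

lemma H10_approx_seq:
  assumes "u \<in> H10 L" "has_weak_deriv L u w"
  obtains \<phi> where "\<And>n. test_fun L (\<phi> n)" "(\<lambda>n. abs_L2 (\<phi> n)) \<longlonglongrightarrow> u" "(\<lambda>n. abs_L2 (vderiv (\<phi> n))) \<longlonglongrightarrow> w"
proof -
  have "\<exists>\<phi>. test_fun L \<phi> \<and> norm (u - abs_L2 \<phi>) < 1 / Suc n \<and> norm (w - abs_L2 (vderiv \<phi>)) < 1 / Suc n" for n :: nat
    using H10_approx[OF assms, of "1 / Suc n"] by (metis zero_less_divide_1_iff of_nat_0_less_iff zero_less_Suc)
  then obtain \<phi> where \<phi>: "\<And>n. test_fun L (\<phi> n)" "\<And>n. norm (u - abs_L2 (\<phi> n)) < 1 / Suc n"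
      "\<And>n. norm (w - abs_L2 (vderiv (\<phi> n))) < 1 / Suc n" by metis
  show ?thesis
  proof (rule that[OF \<phi>(1)])
    show "(\<lambda>n. abs_L2 (\<phi> n)) \<longlonglongrightarrow> u"
      by (rule LIM_zero_cancel, rule Lim_null_comparison[OF _ lim_inverse_n'[THEN LIMSEQ_Suc]])
        (use \<phi>(2) in \<open>auto simp: norm_minus_commute less_imp_le\<close>)
    show "(\<lambda>n. abs_L2 (vderiv (\<phi> n))) \<longlonglongrightarrow> w"
      by (rule LIM_zero_cancel, rule Lim_null_comparison[OF _ lim_inverse_n'[THEN LIMSEQ_Suc]])
        (use \<phi>(3) in \<open>auto simp: norm_minus_commute less_imp_le\<close>)
  qed
qed

lemma H10_H1: "u \<in> H10 L \<Longrightarrow> u \<in> H1 L" by (simp add: H10_def)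

lemma H10_weak_deriv: "u \<in> H10 L \<Longrightarrow> has_weak_deriv L u (weak_deriv L u)"
  using H10_H1 H1_iff by blast

lemma H10_L2_on: "u \<in> H10 L \<Longrightarrow> u \<in> L2_on L"
  using H10_weak_deriv has_weak_deriv_iff by blast

text \<open>Diagonal argument: a test function close to a late member of the sequence is close to
  the limit.\<close>

lemma H10_tendsto:
  assumes u: "\<And>n. u n \<in> H10 L" and d: "\<And>n. has_weak_deriv L (u n) (w n)"
    and ua: "u \<longlonglongrightarrow> a" and wb: "w \<longlonglongrightarrow> b"
  shows "a \<in> H10 L"
proof -
  have "\<exists>\<phi>. test_fun L \<phi> \<and> norm (a - abs_L2 \<phi>) < e \<and> norm (b - abs_L2 (vderiv \<phi>)) < e" if "e > 0" for e
  proof -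
    have "\<forall>\<^sub>F n in sequentially. dist (u n) a < e / 2" "\<forall>\<^sub>F n in sequentially. dist (w n) b < e / 2"
      using \<open>e > 0\<close> by (intro tendstoD[OF ua] tendstoD[OF wb]; simp)+
    then have "\<forall>\<^sub>F n in sequentially. dist (u n) a < e / 2 \<and> dist (w n) b < e / 2"
      by (rule eventually_conj)
    then obtain n where n: "dist (u n) a < e / 2" "dist (w n) b < e / 2"
      using eventually_happens'[OF sequentially_bot] by blast
    obtain \<phi> where t: "test_fun L \<phi>" "norm (u n - abs_L2 \<phi>) < e / 2" "norm (w n - abs_L2 (vderiv \<phi>)) < e / 2"
      using H10_approx[OF u d, of "e / 2" n] \<open>e > 0\<close> by auto
    have "norm (a - abs_L2 \<phi>) < e" "norm (b - abs_L2 (vderiv \<phi>)) < e"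
      using norm_triangle_ineq[of "a - u n" "u n - abs_L2 \<phi>"] n t
        norm_triangle_ineq[of "b - w n" "w n - abs_L2 (vderiv \<phi>)"]
      by (auto simp: dist_norm norm_minus_commute)
    then show ?thesis using t(1) by blast
  qed
  then show ?thesis unfolding H10_iff using has_weak_deriv_tendsto[OF d ua wb] by blast
qed

lemma H10I_seq:
  assumes "has_weak_deriv L u w" "\<And>n. test_fun L (\<phi> n)" "(\<lambda>n. abs_L2 (\<phi> n)) \<longlonglongrightarrow> u"
    "(\<lambda>n. abs_L2 (vderiv (\<phi> n))) \<longlonglongrightarrow> w"
  shows "u \<in> H10 L"
  unfolding H10_iff
proof (intro exI[of _ w] conjI allI impI)
  fix e :: real assume "e > 0"
  then have "\<forall>\<^sub>F n in sequentially. dist (abs_L2 (\<phi> n)) u < e"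
      "\<forall>\<^sub>F n in sequentially. dist (abs_L2 (vderiv (\<phi> n))) w < e"
    by (auto intro!: tendstoD[OF assms(3)] tendstoD[OF assms(4)])
  then have "\<forall>\<^sub>F n in sequentially. dist (abs_L2 (\<phi> n)) u < e \<and> dist (abs_L2 (vderiv (\<phi> n))) w < e"
    by (rule eventually_conj)
  then obtain n where "dist (abs_L2 (\<phi> n)) u < e" "dist (abs_L2 (vderiv (\<phi> n))) w < e"
    using eventually_happens'[OF sequentially_bot] by blast
  then show "\<exists>\<phi>. test_fun L \<phi> \<and> norm (u - abs_L2 \<phi>) < e \<and> norm (w - abs_L2 (vderiv \<phi>)) < e"
    using assms(2) by (auto simp: dist_norm norm_minus_commute)
qed (rule assms(1))

lemma H10_scaleC:
  assumes "u \<in> H10 L" shows "c *\<^sub>C u \<in> H10 L"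
proof -
  obtain \<phi> where \<phi>: "\<And>n. test_fun L (\<phi> n)" "(\<lambda>n. abs_L2 (\<phi> n)) \<longlonglongrightarrow> u"
      "(\<lambda>n. abs_L2 (vderiv (\<phi> n))) \<longlonglongrightarrow> weak_deriv L u"
    using H10_approx_seq[OF assms H10_weak_deriv[OF assms]] by metis
  have lim: "(\<lambda>n. c *\<^sub>C f n) \<longlonglongrightarrow> c *\<^sub>C l" if "f \<longlonglongrightarrow> l" for f :: "nat \<Rightarrow> L2" and l
  proof -
    have "bounded_linear (\<lambda>v :: L2. c *\<^sub>C v)"
      by (rule bounded_linear_intro[of _ "cmod c"])
        (simp_all add: scaleC_add_right scaleR_scaleC scaleC_scaleC norm_scaleC mult.commute)
    from bounded_linear.tendsto[OF this that] show ?thesis .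
  qed
  show ?thesis
  proof (rule H10I_seq[OF has_weak_deriv_scaleC[OF H10_weak_deriv[OF assms]]])
    show "test_fun L (\<lambda>x. c * \<phi> n x)" for n by (rule test_fun_scale[OF \<phi>(1)])
    show "(\<lambda>n. abs_L2 (\<lambda>x. c * \<phi> n x)) \<longlonglongrightarrow> c *\<^sub>C u"
      using lim[OF \<phi>(2)] by (simp add: abs_L2_test_scale[OF \<phi>(1)])
    show "(\<lambda>n. abs_L2 (vderiv (\<lambda>x. c * \<phi> n x))) \<longlonglongrightarrow> c *\<^sub>C weak_deriv L u"
      using lim[OF \<phi>(3)] by (simp add: abs_L2_test_scale[OF test_fun_deriv[OF \<phi>(1)]] vderiv_scale[OF \<phi>(1)])
  qed
qed

lemma H10_add:
  assumes "u \<in> H10 L" "v \<in> H10 L" shows "u + v \<in> H10 L"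
proof -
  obtain \<phi> where \<phi>: "\<And>n. test_fun L (\<phi> n)" "(\<lambda>n. abs_L2 (\<phi> n)) \<longlonglongrightarrow> u"
      "(\<lambda>n. abs_L2 (vderiv (\<phi> n))) \<longlonglongrightarrow> weak_deriv L u"
    using H10_approx_seq[OF assms(1) H10_weak_deriv[OF assms(1)]] by metis
  obtain \<psi> where \<psi>: "\<And>n. test_fun L (\<psi> n)" "(\<lambda>n. abs_L2 (\<psi> n)) \<longlonglongrightarrow> v"
      "(\<lambda>n. abs_L2 (vderiv (\<psi> n))) \<longlonglongrightarrow> weak_deriv L v"
    using H10_approx_seq[OF assms(2) H10_weak_deriv[OF assms(2)]] by metis
  have e: "abs_L2 (\<lambda>x. f x + g x) = abs_L2 f + abs_L2 g" if "test_fun L f" "test_fun L g" for f g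
    using abs_L2_add[OF sq_integrable_test_fun[OF that(1)] sq_integrable_test_fun[OF that(2)]] by simp
  show ?thesis
  proof (rule H10I_seq[OF has_weak_deriv_add[OF H10_weak_deriv[OF assms(1)] H10_weak_deriv[OF assms(2)]]])
    show "test_fun L (\<lambda>x. \<phi> n x + \<psi> n x)" for n by (rule test_fun_add[OF \<phi>(1) \<psi>(1)])
    show "(\<lambda>n. abs_L2 (\<lambda>x. \<phi> n x + \<psi> n x)) \<longlonglongrightarrow> u + v"
      using tendsto_add[OF \<phi>(2) \<psi>(2)] by (simp add: e[OF \<phi>(1) \<psi>(1)])
    show "(\<lambda>n. abs_L2 (vderiv (\<lambda>x. \<phi> n x + \<psi> n x))) \<longlonglongrightarrow> weak_deriv L u + weak_deriv L v"
      using tendsto_add[OF \<phi>(3) \<psi>(3)]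
      by (simp add: e[OF test_fun_deriv[OF \<phi>(1)] test_fun_deriv[OF \<psi>(1)]] vderiv_add[OF \<phi>(1) \<psi>(1)])
  qed
qed

lemma test_fun_zero: "0 < L \<Longrightarrow> test_fun L (\<lambda>x. 0)"
  using test_fun_scale[OF test_fun_bump[of 1 "L/3" "L/2" L], of 0] by simp

lemma H10_zero: "0 < L \<Longrightarrow> 0 \<in> H10 L"
  using test_fun_zero[of L] has_weak_deriv_zero[of L] unfolding H10_iff
  by (intro exI[of _ 0] conjI allI impI exI[of _ "\<lambda>x. 0"]) (simp_all flip: zero_L2_def)

text \<open>For test functions this is the definition of the weak derivative; both sides are
  continuous in \<open>g\<close> and \<open>g'\<close>, so it extends to the closure. One factor in
  \<open>H10\<close> is enough to exclude boundary terms.\<close>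

lemma integration_by_parts_H10:
  assumes f: "has_weak_deriv L f f'" and g: "g \<in> H10 L" "has_weak_deriv L g g'"
  shows "inner f g' = - inner f' g"
proof -
  obtain \<phi> where \<phi>: "\<And>n. test_fun L (\<phi> n)" "(\<lambda>n. abs_L2 (\<phi> n)) \<longlonglongrightarrow> g"
      "(\<lambda>n. abs_L2 (vderiv (\<phi> n))) \<longlonglongrightarrow> g'"
    using H10_approx_seq[OF g] by metis
  have "(\<lambda>n. inner f (abs_L2 (vderiv (\<phi> n)))) \<longlonglongrightarrow> inner f g'"
    using \<phi>(3) by (intro tendsto_intros)
  moreover have "inner f (abs_L2 (vderiv (\<phi> n))) = - inner f' (abs_L2 (\<phi> n))" for n
    using f \<phi>(1) by (auto simp: has_weak_deriv_iff)
  moreover have "(\<lambda>n. - inner f' (abs_L2 (\<phi> n))) \<longlonglongrightarrow> - inner f' g"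
    using \<phi>(2) by (intro tendsto_intros)
  ultimately show ?thesis by (simp add: LIMSEQ_unique)
qed


section \<open>Primitives and compactness\<close>

lemma sq_integrable_indicator:
  assumes "A \<in> sets borel" "emeasure lborel A < \<infinity>"
  shows "sq_integrable (indicator A)"
  unfolding sq_integrable_def
proof
  have "integrable lborel (indicator A :: real \<Rightarrow> real)" using assms by (intro integrable_real_indicator) auto
  then show "integrable lborel (\<lambda>x. (cmod (indicator A x))\<^sup>2)"
    by (rule Bochner_Integration.integrable_cong[THEN iffD1, rotated 2]) (auto simp: indicator_def)
qed (use assms in simp)

lemma emeasure_interval_finite:
  "emeasure lborel {a..b::real} < \<infinity>" "emeasure lborel {a<..b::real} < \<infinity>"
  by (rule emeasure_bounded_finite, simp)+

lemma set_integrable_rep_L2: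
  assumes "A \<in> sets borel" "emeasure lborel A < \<infinity>"
  shows "set_integrable lborel A (rep_L2 u)"
  using integrable_mult_sq[OF sq_integrable_indicator[OF assms] sq_integrable_rep_L2[of u]]
  unfolding set_integrable_def
  by (rule Bochner_Integration.integrable_cong[THEN iffD1, rotated 2]) (auto simp: indicator_def)

text \<open>Multiplying \<open>u\<close> by the conjugate phase of the integral makes the integral
  real and nonnegative, so Cauchy-Schwarz for the real inner product applies.\<close>

lemma norm_set_integral_rep_L2_le:
  assumes A: "A \<in> sets borel" "emeasure lborel A < \<infinity>"
  shows "cmod (LBINT y:A. rep_L2 u y) \<le> sqrt (measure lborel A) * norm u"
proof -
  define I where "I = (LBINT y:A. rep_L2 u y)"
  define c where "c = cnj (sgn I)"
  have s: "sq_integrable (indicator A)" by (rule sq_integrable_indicator[OF A])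
  have cI: "c * I = of_real (cmod I)"
    unfolding c_def by (simp add: sgn_eq complex_norm_square[symmetric] power2_eq_square mult.commute[of "cnj I"])
  have "inner (c *\<^sub>C u) (abs_L2 (indicator A)) = Re (LBINT x. (c * rep_L2 u x) * cnj (indicator A x))"
    using inner_abs_L2[OF sq_integrable_scale[OF sq_integrable_rep_L2[of u], of c] s]
    by (simp add: abs_L2_scaleC[OF sq_integrable_rep_L2[of u], of c, symmetric] abs_rep_L2)
  also have "(LBINT x. (c * rep_L2 u x) * cnj (indicator A x)) = (LBINT x. c * (indicator A x *\<^sub>R rep_L2 u x))"
    by (intro Bochner_Integration.integral_cong) (auto simp: indicator_def)
  also have "\<dots> = c * I"
    unfolding I_def set_lebesgue_integral_def by (rule integral_mult_right_zero)
  also have "\<dots> = of_real (cmod I)" by (rule cI)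
  finally have "cmod I = inner (c *\<^sub>C u) (abs_L2 (indicator A))" by simp
  also have "\<dots> \<le> norm (c *\<^sub>C u) * norm (abs_L2 (indicator A))" by (rule norm_cauchy_schwarz)
  also have "norm (c *\<^sub>C u) \<le> norm u"
    by (simp add: norm_scaleC c_def norm_sgn mult_left_le_one_le)
  also have "norm (abs_L2 (indicator A)) = sqrt (measure lborel A)"
  proof -
    have "(norm (abs_L2 (indicator A)))\<^sup>2 = (LBINT x. indicator A x)"
      unfolding norm_abs_L2_sq[OF s] by (intro Bochner_Integration.integral_cong) (auto simp: indicator_def)
    also have "\<dots> = measure lborel A" using A by simp
    finally show ?thesis by (metis norm_ge_zero real_sqrt_unique)
  qed
  finally show ?thesis by (simp add: I_def mult.commute mult_right_mono)
qed

text \<open>The continuous representative that vanishes at the left end; a general H^1 function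
  differs from it by a constant.\<close>

definition prim :: "L2 \<Rightarrow> real \<Rightarrow> complex"
  where "prim u x = (LBINT y:{0..x}. rep_L2 u y)"

text \<open>Cauchy-Schwarz gives Hoelder continuity of exponent 1/2, the source of both the sup
  bounds and the equicontinuity used later.\<close>

lemma prim_diff_le:
  assumes "0 \<le> x" "x \<le> y"
  shows "cmod (prim u y - prim u x) \<le> sqrt (y - x) * norm u"
proof -
  have "{0..y} = {0..x} \<union> {x<..y}" using assms by auto
  moreover have "(LBINT z:{0..x} \<union> {x<..y}. rep_L2 u z) = (LBINT z:{0..x}. rep_L2 u z) + (LBINT z:{x<..y}. rep_L2 u z)"
    by (rule set_integral_Un) (auto intro!: set_integrable_rep_L2 emeasure_interval_finite[simplified])
  ultimately have "prim u y - prim u x = (LBINT z:{x<..y}. rep_L2 u z)" by (simp add: prim_def)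
  then show ?thesis using norm_set_integral_rep_L2_le[of "{x<..y}" u] assms by simp
qed

lemma prim_0: "prim u 0 = 0"
  unfolding prim_def set_lebesgue_integral_def
proof (rule integral_eq_zero_AE)
  show "AE x in lborel. indicat_real {0..0} x *\<^sub>R rep_L2 u x = 0"
    using AE_lborel_singleton[of 0] by eventually_elim auto
qed

lemma prim_le: "0 \<le> x \<Longrightarrow> cmod (prim u x) \<le> sqrt x * norm u"
  using prim_diff_le[of 0 x u] by (simp add: prim_0)

lemma prim_diff_le_abs:
  assumes "0 \<le> x" "0 \<le> y" shows "cmod (prim u y - prim u x) \<le> sqrt \<bar>y - x\<bar> * norm u"
  using prim_diff_le[of x y u] prim_diff_le[of y x u] assms
  by (cases "x \<le> y") (auto simp: norm_minus_commute)

lemma continuous_prim: "continuous_on {0..} (prim u)"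
  unfolding continuous_on_def
proof
  fix x :: real assume x: "x \<in> {0..}"
  show "(prim u \<longlongrightarrow> prim u x) (at x within {0..})"
  proof (rule LIM_zero_cancel, rule Lim_null_comparison)
    show "\<forall>\<^sub>F y in at x within {0..}. cmod (prim u y - prim u x) \<le> sqrt \<bar>y - x\<bar> * norm u"
      using x prim_diff_le_abs by (auto simp: eventually_at_filter)
    have "((\<lambda>y. sqrt \<bar>y - x\<bar> * norm u) \<longlongrightarrow> sqrt \<bar>x - x\<bar> * norm u) (at x within {0..})"
      by (intro tendsto_intros)
    then show "((\<lambda>y. sqrt \<bar>y - x\<bar> * norm u) \<longlongrightarrow> 0) (at x within {0..})" by simp
  qed
qed

lemma prim_diff: "prim (u - v) x = prim u x - prim v x"
proof -
  have i: "set_integrable lborel {0..x} (rep_L2 w)" for w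
    by (rule set_integrable_rep_L2[OF _ emeasure_interval_finite(1)]) simp
  have "prim (u - v) x = (LBINT y:{0..x}. rep_L2 u y - rep_L2 v y)"
    unfolding prim_def
    by (rule set_lebesgue_integral_cong_AE) (use rep_L2_diff[of u v] in auto)
  then show ?thesis by (simp add: prim_def set_integral_diff[OF i i])
qed

lemma prim_test:
  assumes t: "test_fun L \<phi>" and "0 \<le> x"
  shows "prim (abs_L2 (vderiv \<phi>)) x = \<phi> x"
proof -
  have [measurable]: "vderiv \<phi> \<in> borel_measurable borel"
    using test_fun_measurable[OF test_fun_deriv[OF t]] .
  have "prim (abs_L2 (vderiv \<phi>)) x = (LBINT y:{0..x}. vderiv \<phi> y)"
    unfolding prim_def
    by (rule set_lebesgue_integral_cong_AE) (use rep_abs_L2[OF sq_integrable_test_fun[OF test_fun_deriv[OF t]]] in auto)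
  also have "\<dots> = \<phi> x - \<phi> 0"
    unfolding set_lebesgue_integral_def
    by (rule integral_FTC_atLeastAtMost[OF assms(2)])
      (rule has_vector_derivative_at_within[OF test_fun_has_deriv[OF t]]
        smooth_fun_continuous[OF test_fun_smooth[OF test_fun_deriv[OF t]]])+
  finally show ?thesis using test_fun_outside[OF t, of 0] by simp
qed

definition emb :: "real \<Rightarrow> (real \<Rightarrow> complex) \<Rightarrow> L2"
  where "emb L f = abs_L2 (\<lambda>x. indicator {0..L} x *\<^sub>R f x)"

lemma rep_emb:
  assumes "continuous_on {0..L} f"
  shows "AE x in lborel. rep_L2 (emb L f) x = indicator {0..L} x *\<^sub>R f x"
  unfolding emb_def by (rule rep_abs_L2[OF sq_integrable_continuous[OF assms]])

lemma norm_emb_diff_le: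
  assumes f: "continuous_on {0..L} f" and g: "continuous_on {0..L} g" and "0 \<le> L"
    and M: "\<And>x. x \<in> {0..L} \<Longrightarrow> cmod (f x - g x) \<le> M"
  shows "norm (emb L f - emb L g) \<le> M * sqrt L"
proof -
  have M0: "0 \<le> M" using M[of 0] \<open>0 \<le> L\<close> by (auto intro: order_trans[OF norm_ge_zero])
  have s: "sq_integrable (indicator {0..L})"
    by (rule sq_integrable_indicator[OF _ emeasure_interval_finite(1)]) simp
  have "norm (emb L f - emb L g) \<le> M * norm (abs_L2 (indicator {0..L}))"
  proof (rule norm_L2_mono[OF _ M0])
    show "AE x in lborel. cmod (rep_L2 (emb L f - emb L g) x) \<le> M * cmod (rep_L2 (abs_L2 (indicator {0..L})) x)"
      using rep_L2_diff[of "emb L f" "emb L g"] rep_emb[OF f] rep_emb[OF g] rep_abs_L2[OF s]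
      by eventually_elim (auto simp: indicator_def M)
  qed
  also have "norm (abs_L2 (indicator {0..L})) = sqrt L"
  proof -
    have "(norm (abs_L2 (indicator {0..L})))\<^sup>2 = (LBINT x. indicator {0..L} x)"
      unfolding norm_abs_L2_sq[OF s] by (intro Bochner_Integration.integral_cong) (auto simp: indicator_def)
    also have "\<dots> = L" using \<open>0 \<le> L\<close> by simp
    finally show ?thesis by (metis norm_ge_zero real_sqrt_unique)
  qed
  finally show ?thesis .
qed

lemma emb_add:
  "continuous_on {0..L} f \<Longrightarrow> continuous_on {0..L} g \<Longrightarrow> emb L f + emb L g = emb L (\<lambda>x. f x + g x)"
  unfolding emb_def by (simp add: abs_L2_add sq_integrable_continuous scaleR_add_right)

lemma norm_emb_le:
  assumes "continuous_on {0..L} f" "0 \<le> L" "\<And>x. x \<in> {0..L} \<Longrightarrow> cmod (f x) \<le> M"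
  shows "norm (emb L f) \<le> M * sqrt L"
proof -
  have "emb L (\<lambda>x. 0) = 0" by (simp add: emb_def zero_L2_def)
  then show ?thesis using norm_emb_diff_le[OF assms(1) continuous_on_const[of _ 0] assms(2), of M] assms(3) by simp
qed

lemma emb_L2_on:
  assumes "continuous_on {0..L} f" shows "emb L f \<in> L2_on L"
proof -
  have "AE x in lborel. x \<noteq> 0 \<and> x \<noteq> L"
    using AE_lborel_singleton[of 0] AE_lborel_singleton[of L] by eventually_elim auto
  then show ?thesis unfolding L2_on_def mem_Collect_eq
    using rep_emb[OF assms] by eventually_elim (auto simp: indicator_def)
qed

lemma emb_test:
  assumes "test_fun L \<phi>" shows "emb L \<phi> = abs_L2 \<phi>"
proof -
  have "(\<lambda>x. indicator {0..L} x *\<^sub>R \<phi> x) = \<phi>"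
    using test_fun_outside[OF assms] by (auto simp: indicator_def fun_eq_iff)
  then show ?thesis by (simp add: emb_def)
qed

lemma continuous_prim_Icc: "continuous_on {0..L} (prim u)"
  by (rule continuous_on_subset[OF continuous_prim]) auto

text \<open>For test functions both claims are the fundamental theorem of calculus. Convergence of
  the derivatives in L^2 makes the primitives converge uniformly, so both pass to the limit, the
  value at \<open>L\<close> included.\<close>

lemma H10_repr:
  assumes "u \<in> H10 L" "has_weak_deriv L u w" and L: "0 < L"
  shows "u = emb L (prim w)" "prim w L = 0"
proof -
  obtain \<phi> where \<phi>: "\<And>n. test_fun L (\<phi> n)" "(\<lambda>n. abs_L2 (\<phi> n)) \<longlonglongrightarrow> u"
      "(\<lambda>n. abs_L2 (vderiv (\<phi> n))) \<longlonglongrightarrow> w"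
    using H10_approx_seq[OF assms(1,2)] by metis
  have b: "cmod (\<phi> n x - prim w x) \<le> sqrt L * norm (abs_L2 (vderiv (\<phi> n)) - w)" if "x \<in> {0..L}" for n x
  proof -
    have "\<phi> n x - prim w x = prim (abs_L2 (vderiv (\<phi> n)) - w) x"
      using prim_test[OF \<phi>(1)] that by (simp add: prim_diff)
    then have "cmod (\<phi> n x - prim w x) \<le> sqrt x * norm (abs_L2 (vderiv (\<phi> n)) - w)"
      using prim_le[of x] that by simp
    also have "\<dots> \<le> sqrt L * norm (abs_L2 (vderiv (\<phi> n)) - w)"
      using that by (intro mult_right_mono) auto
    finally show ?thesis .
  qed
  have z: "(\<lambda>n. norm (abs_L2 (vderiv (\<phi> n)) - w)) \<longlonglongrightarrow> 0"
    by (rule tendsto_norm_zero[OF LIM_zero[OF \<phi>(3)]])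
  have "(\<lambda>n. abs_L2 (\<phi> n)) \<longlonglongrightarrow> emb L (prim w)"
  proof (rule LIM_zero_cancel, rule Lim_null_comparison)
    have "norm (emb L (\<phi> n) - emb L (prim w)) \<le> (sqrt L * norm (abs_L2 (vderiv (\<phi> n)) - w)) * sqrt L" for n
      by (rule norm_emb_diff_le[OF smooth_fun_continuous[OF test_fun_smooth[OF \<phi>(1)]] continuous_prim_Icc])
        (use b L in auto)
    then show "\<forall>\<^sub>F n in sequentially. norm (abs_L2 (\<phi> n) - emb L (prim w)) \<le> (sqrt L * norm (abs_L2 (vderiv (\<phi> n)) - w)) * sqrt L"
      using emb_test[OF \<phi>(1)] by simp
    show "(\<lambda>n. (sqrt L * norm (abs_L2 (vderiv (\<phi> n)) - w)) * sqrt L) \<longlonglongrightarrow> 0"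
      using tendsto_mult_left[OF tendsto_mult_right[OF z]] by (auto intro!: tendsto_mult_left_zero tendsto_mult_right_zero z)
  qed
  then show "u = emb L (prim w)" using \<phi>(2) LIMSEQ_unique by blast
  have "cmod (prim w L) \<le> sqrt L * norm (abs_L2 (vderiv (\<phi> n)) - w)" for n
    using b[of L n] test_fun_outside[OF \<phi>(1), of L n] L by simp
  then have "cmod (prim w L) \<le> 0"
    by (intro LIMSEQ_le_const[OF tendsto_mult_right_zero[OF z]]) auto
  then show "prim w L = 0" by simp
qed

text \<open>Fubini on the triangle 0 <= y <= x <= L: integrating the derivative of the test function
  over x from y to L leaves minus its value at y.\<close>

lemma has_weak_deriv_emb_prim:
  assumes w: "w \<in> L2_on L" and L: "0 < L"
  shows "has_weak_deriv L (emb L (prim w)) w"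
  unfolding has_weak_deriv_iff
proof (intro conjI allI impI)
  fix \<phi> assume t: "test_fun L \<phi>"
  define W where "W = rep_L2 w"
  define g where "g x = cnj (vderiv \<phi> x)" for x
  have [measurable]: "W \<in> borel_measurable borel" unfolding W_def by simp
  have tg: "test_fun L g" unfolding g_def by (rule test_fun_cnj[OF test_fun_deriv[OF t]])
  have [measurable]: "g \<in> borel_measurable borel" by (rule test_fun_measurable[OF tg])
  have iW: "integrable lborel W" unfolding W_def by (rule integrable_L2_on[OF w])
  have ig: "integrable lborel g"
    using integrable_L2_on[OF abs_test_L2_on[OF tg]] integrable_cong_AE[of "rep_L2 (abs_L2 g)" lborel g]
      rep_abs_L2[OF sq_integrable_test_fun[OF tg]] by simp
  \<comment> \<open>Zero off the triangle, hence dominated by \<open>W y * g x\<close>, a product of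
    integrable functions of separate variables.\<close>
  define f where "f x y = (if 0 \<le> y \<and> y \<le> x \<and> x \<le> L then W y * g x else 0)" for x y
  have fint: "integrable (lborel \<Otimes>\<^sub>M lborel) (case_prod f)"
  proof (rule Bochner_Integration.integrable_bound)
    show "integrable (lborel \<Otimes>\<^sub>M lborel) (\<lambda>(x, y). W y * g x)"
    proof (rule lborel_pair.Fubini_integrable)
      show "(\<lambda>(x, y). W y * g x) \<in> borel_measurable (lborel \<Otimes>\<^sub>M lborel)" by measurable
      show "integrable lborel (\<lambda>x. LBINT y. norm (case (x, y) of (x, y) \<Rightarrow> W y * g x))"
        using ig by (simp add: norm_mult)
      show "AE x in lborel. integrable lborel (\<lambda>y. case (x, y) of (x, y) \<Rightarrow> W y * g x)"
        using iW by simp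
    qed
    show "case_prod f \<in> borel_measurable (lborel \<Otimes>\<^sub>M lborel)"
      unfolding f_def by measurable
    show "AE x in lborel \<Otimes>\<^sub>M lborel. norm (case_prod f x) \<le> norm (case x of (x, y) \<Rightarrow> W y * g x)"
      by (auto simp: f_def split: prod.split)
  qed
  have "(LBINT x. rep_L2 (emb L (prim w)) x * g x) = (LBINT x. LBINT y. f x y)"
  proof (rule integral_cong_AE)
    show "AE x in lborel. rep_L2 (emb L (prim w)) x * g x = (LBINT y. f x y)"
      using rep_emb[OF continuous_prim_Icc[of L w]]
    proof eventually_elim
      case (elim x)
      have "(LBINT y. f x y) = (LBINT y. (indicator {0..L} x *\<^sub>R g x) * (indicator {0..x} y *\<^sub>R W y))"
        by (intro Bochner_Integration.integral_cong) (auto simp: f_def indicator_def)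
      also have "\<dots> = (indicator {0..L} x *\<^sub>R g x) * prim w x"
        unfolding prim_def set_lebesgue_integral_def W_def by (rule integral_mult_right_zero)
      finally show ?case using elim by (simp add: mult.commute)
    qed
  qed (use lborel_pair.integrable_fst'[OF fint] in auto)
  also have "\<dots> = (LBINT y. LBINT x. f x y)"
    by (rule lborel_pair.Fubini_integral[OF fint, symmetric])
  also have "\<dots> = (LBINT y. - (W y * cnj (\<phi> y)))"
  proof (rule integral_cong_AE)
    have "AE y in lborel. y \<notin> {0<..<L} \<longrightarrow> W y = 0" using w by (simp add: L2_on_def W_def)
    then show "AE y in lborel. (LBINT x. f x y) = - (W y * cnj (\<phi> y))"
    proof eventually_elim
      case (elim y)
      show ?case
      proof (cases "y \<in> {0<..<L}")
        case True
        have "(LBINT x. f x y) = (LBINT x. W y * (indicator {y..L} x *\<^sub>R g x))"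
          using True by (intro Bochner_Integration.integral_cong) (auto simp: f_def indicator_def)
        also have "\<dots> = W y * (LBINT x. indicator {y..L} x *\<^sub>R g x)"
          by (rule integral_mult_right_zero)
        also have "(LBINT x. indicator {y..L} x *\<^sub>R g x) = cnj (\<phi> L) - cnj (\<phi> y)"
        proof (rule integral_FTC_atLeastAtMost)
          show "((\<lambda>x. cnj (\<phi> x)) has_vector_derivative g x) (at x within {y..L})" for x
            unfolding g_def
            by (rule has_vector_derivative_at_within, rule has_vector_derivative_cnj, rule test_fun_has_deriv[OF t])
          show "continuous_on {y..L} g" by (rule smooth_fun_continuous[OF test_fun_smooth[OF tg]])
        qed (use True in simp)
        also have "\<phi> L = 0" using test_fun_outside[OF t, of L] by simp
        finally show ?thesis by simp
      next
        case False
        then have "W y = 0" using elim by blast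
        then have "f x y = 0" for x by (simp add: f_def)
        then show ?thesis using \<open>W y = 0\<close> by simp
      qed
    qed
    show "(\<lambda>y. LBINT x. f x y) \<in> borel_measurable lborel"
      using lborel_pair.integrable_snd[OF fint] by auto
    have [measurable]: "\<phi> \<in> borel_measurable borel" by (rule test_fun_measurable[OF t])
    show "(\<lambda>y. - (W y * cnj (\<phi> y))) \<in> borel_measurable lborel" by measurable
  qed
  also have "\<dots> = - (LBINT y. W y * cnj (\<phi> y))" by simp
  finally have "Re (LBINT x. rep_L2 (emb L (prim w)) x * g x) = - Re (LBINT y. W y * cnj (\<phi> y))" by simp
  then show "inner (emb L (prim w)) (abs_L2 (vderiv \<phi>)) = - inner w (abs_L2 \<phi>)"
    using Re_integral_test[OF tg, of "emb L (prim w)"] Re_integral_test[OF test_fun_cnj[OF t], of w]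
    by (simp add: W_def g_def)
qed (use w emb_L2_on[OF continuous_prim_Icc] in auto)

section \<open>Functions with vanishing weak derivative, representatives in H^1, and Rellich's
  theorem\<close>

lemma integrable_test_fun:
  assumes "test_fun L \<phi>" shows "integrable lborel \<phi>"
  using integrable_L2_on[OF abs_test_L2_on[OF assms]] integrable_cong_AE[of "rep_L2 (abs_L2 \<phi>)" lborel \<phi>]
    rep_abs_L2[OF sq_integrable_test_fun[OF assms]] test_fun_measurable[OF assms] by simp

text \<open>A primitive that vanishes left of the support of \<open>g\<close> is constant right of
  it, and that constant is the total integral, which is 0.\<close>

lemma test_fun_primitive:
  assumes t: "test_fun L g" and 0: "(LBINT x. g x) = 0"
  obtains \<phi> where "test_fun L \<phi>" "vderiv \<phi> = g"
proof -
  obtain a b where ab: "0 < a" "b < L" "\<And>x. x \<notin> {a..b} \<Longrightarrow> g x = 0"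
    using t unfolding test_fun_def by blast
  have cont: "continuous_on A g" for A by (rule smooth_fun_continuous[OF test_fun_smooth[OF t]])
  have "\<exists>F. \<forall>x. - \<infinity> < ereal x \<longrightarrow> ereal x < \<infinity> \<longrightarrow> (F has_vector_derivative g x) (at x)"
    by (rule einterval_antiderivative) (use cont[of UNIV] in \<open>auto simp: continuous_on_eq_continuous_at\<close>)
  then obtain F where F: "\<And>x. (F has_vector_derivative g x) (at x)" by auto
  have FTC: "(LBINT z. indicator {x..y} z *\<^sub>R g z) = F y - F x" if "x \<le> y" for x y
    by (rule integral_FTC_atLeastAtMost[OF that]) (rule has_vector_derivative_at_within[OF F] cont)+
  define \<phi> where "\<phi> x = F x - F 0" for x
  have d: "(\<phi> has_vector_derivative g x) (at x)" for x
    unfolding \<phi>_def using has_vector_derivative_diff[OF F has_vector_derivative_const] by simp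
  have "\<phi> x = 0" if x: "x \<notin> {a..b}" for x
  proof -
    consider "x < 0" | "0 \<le> x" "x < a" | "0 \<le> x" "x > b" using x ab by fastforce
    then show ?thesis
    proof cases
      case 1
      have "(\<lambda>z. indicator {x..0} z *\<^sub>R g z) = (\<lambda>z. 0)"
        using ab(1,3) by (auto simp: indicator_def fun_eq_iff)
      then show ?thesis using FTC[of x 0] 1 by (simp add: \<phi>_def)
    next
      case 2
      have "(\<lambda>z. indicator {0..x} z *\<^sub>R g z) = (\<lambda>z. 0)"
        using ab(3) 2 by (auto simp: indicator_def fun_eq_iff)
      then show ?thesis using FTC[of 0 x] 2 by (simp add: \<phi>_def)
    next
      case 3
      have "(\<lambda>z. indicator {0..x} z *\<^sub>R g z) = g"
        using ab 3 by (auto simp: indicator_def fun_eq_iff)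
      then show ?thesis using FTC[of 0 x] 3 0 by (simp add: \<phi>_def)
    qed
  qed
  then have "test_fun L \<phi>"
    unfolding test_fun_def using smooth_fun_primitive[OF test_fun_smooth[OF t] d] ab(1,2) by blast
  moreover have "vderiv \<phi> = g" using d vector_derivative_at by blast
  ultimately show ?thesis by (rule that)
qed

lemma normalized_test_fun:
  assumes "0 < L"
  obtains \<psi> where "test_fun L (\<lambda>x. complex_of_real (\<psi> x))" "(LBINT x. complex_of_real (\<psi> x)) = 1"
proof -
  define h where "h = bump (L / 3) (L / 2) 1"
  define \<kappa> where "\<kappa> = (LBINT x. h x)"
  have t: "test_fun L (\<lambda>x. complex_of_real (h x))" unfolding h_def using assms by (intro test_fun_bump) auto
  have i: "integrable lborel h"
    using integrable_Re[OF integrable_test_fun[OF t]] by simp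
  have "\<kappa> \<noteq> 0"
  proof
    assume "\<kappa> = 0"
    then have "AE x in lborel. h x = 0"
      unfolding \<kappa>_def using i bump_bounds(1)[of 1 "L / 3" "L / 2"]
      by (subst (asm) integral_nonneg_eq_0_iff_AE) (auto simp: h_def)
    then have "AE x in lborel. x \<notin> {L / 3<..<L / 2}"
      by eventually_elim (use bump_pos[of _ "L/3" "L/2" 1] in \<open>force simp: h_def\<close>)
    then have "emeasure lborel {L / 3<..<L / 2} = 0" by (subst (asm) AE_iff_measurable[of "{L / 3<..<L / 2}"]) auto
    then show False using assms by simp
  qed
  have "test_fun L (\<lambda>x. complex_of_real (h x / \<kappa>))"
    using test_fun_scale[OF t, of "complex_of_real (1 / \<kappa>)"] by simp
  moreover have "(LBINT x. complex_of_real (h x / \<kappa>)) = 1"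
    using \<open>\<kappa> \<noteq> 0\<close> by (simp add: \<kappa>_def)
  ultimately show ?thesis by (rule that)
qed

text \<open>The du Bois-Reymond lemma: once the primitive of \<open>w\<close> is subtracted, the
  remainder annihilates every test function of mean zero, so it is the constant given by its pairing
  with a normalised bump.\<close>

lemma H1_repr:
  assumes d: "has_weak_deriv L u w" and L: "0 < L"
  obtains c where "u = emb L (\<lambda>x. c + prim w x)"
proof -
  define v where "v = u - emb L (prim w)"
  have v: "has_weak_deriv L v 0"
    unfolding v_def using has_weak_deriv_diff[OF d has_weak_deriv_emb_prim[of w L]] d L
    by (auto simp: has_weak_deriv_iff)
  obtain \<psi> where \<psi>: "test_fun L (\<lambda>x. complex_of_real (\<psi> x))" "(LBINT x. complex_of_real (\<psi> x)) = 1"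
    using normalized_test_fun[OF L] by metis
  define c where "c = (LBINT x. rep_L2 v x * of_real (\<psi> x))"
  have cc: "continuous_on {0..L} (\<lambda>x. c)" by (rule continuous_on_const)
  have "v - emb L (\<lambda>x. c) = 0"
  proof (rule test_fun_dense)
    show "v - emb L (\<lambda>x. c) \<in> L2_on L"
      using v emb_L2_on[OF cc] by (auto simp: has_weak_deriv_iff intro: L2_on_diff)
    fix \<eta> assume t: "test_fun L \<eta>"
    define I where "I = (LBINT x. \<eta> x)"
    \<comment> \<open>Subtracting \<open>I\<close> times the normalised bump leaves mean zero, hence
      the derivative of a test function.\<close>
    have t2: "test_fun L (\<lambda>x. \<eta> x + (- I) * of_real (\<psi> x))"
      by (rule test_fun_add[OF t test_fun_scale[OF \<psi>(1)]])
    have i: "integrable lborel \<eta>" "integrable lborel (\<lambda>x. complex_of_real (\<psi> x))"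
      using integrable_test_fun t \<psi>(1) by auto
    have "(LBINT x. \<eta> x + (- I) * of_real (\<psi> x)) = (LBINT x. \<eta> x) + (- I) * (LBINT x. complex_of_real (\<psi> x))"
      using i by (subst Bochner_Integration.integral_add) auto
    also have "\<dots> = 0" unfolding \<psi>(2) I_def by simp
    finally obtain \<phi> where \<phi>: "test_fun L \<phi>" "vderiv \<phi> = (\<lambda>x. \<eta> x + (- I) * of_real (\<psi> x))"
      using test_fun_primitive[OF t2] by metis
    have "inner v (abs_L2 (vderiv \<phi>)) = 0" using v \<phi>(1) by (auto simp: has_weak_deriv_iff)
    then have "inner v (abs_L2 \<eta>) = inner v (I *\<^sub>C abs_L2 (\<lambda>x. of_real (\<psi> x)))"
      unfolding \<phi>(2) abs_L2_add[OF sq_integrable_test_fun[OF t] sq_integrable_test_fun[OF test_fun_scale[OF \<psi>(1)]], symmetric]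
        abs_L2_test_scale[OF \<psi>(1), symmetric]
      using scaleC_scaleC[of "-1" I "abs_L2 (\<lambda>x. of_real (\<psi> x))", symmetric]
      by (simp add: inner_add_right uminus_L2_def[symmetric])
    also have "\<dots> = inner (cnj I *\<^sub>C v) (abs_L2 (\<lambda>x. of_real (\<psi> x)))" by (simp add: inner_scaleC)
    also have "\<dots> = Re (cnj I * c)"
    proof -
      have "cnj I *\<^sub>C v = abs_L2 (\<lambda>x. cnj I * rep_L2 v x)"
        using abs_L2_scaleC[OF sq_integrable_rep_L2[of v], of "cnj I"] by (simp add: abs_rep_L2)
      then have "inner (cnj I *\<^sub>C v) (abs_L2 (\<lambda>x. of_real (\<psi> x))) = Re (LBINT x. cnj I * rep_L2 v x * of_real (\<psi> x))"
        using inner_abs_L2[OF sq_integrable_scale[OF sq_integrable_rep_L2[of v], of "cnj I"] sq_integrable_test_fun[OF \<psi>(1)]]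
        by simp
      then show ?thesis by (simp add: c_def mult.assoc)
    qed
    finally have 1: "inner v (abs_L2 \<eta>) = Re (cnj I * c)" .
    have "inner (emb L (\<lambda>x. c)) (abs_L2 \<eta>) = Re (LBINT x. (indicator {0..L} x *\<^sub>R c) * cnj (\<eta> x))"
      unfolding emb_def by (rule inner_abs_L2[OF sq_integrable_continuous[OF cc] sq_integrable_test_fun[OF t]])
    also have "(LBINT x. (indicator {0..L} x *\<^sub>R c) * cnj (\<eta> x)) = (LBINT x. c * cnj (\<eta> x))"
      by (intro Bochner_Integration.integral_cong) (use test_fun_outside[OF t] in \<open>auto simp: indicator_def\<close>)
    also have "\<dots> = c * cnj I" by (simp add: I_def)
    finally show "inner (v - emb L (\<lambda>x. c)) (abs_L2 \<eta>) = 0" using 1 by (simp add: inner_diff_left mult.commute)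
  qed
  then have "u = emb L (\<lambda>x. c) + emb L (prim w)" by (simp add: v_def algebra_simps)
  then show ?thesis using that emb_add[OF cc continuous_prim_Icc] by simp
qed

text \<open>The representatives \<open>c n + prim (w n)\<close> are uniformly bounded and uniformly
  Hoelder continuous, so Arzela-Ascoli gives uniform, and thus L^2, convergence.\<close>

lemma rellich:
  assumes L: "0 < L" and d: "\<And>n. has_weak_deriv L (u n) (w n)"
    and bu: "\<And>n. norm (u n) \<le> C" and bw: "\<And>n. norm (w n) \<le> C"
  obtains r l where "strict_mono (r :: nat \<Rightarrow> nat)" "(\<lambda>n. u (r n)) \<longlonglongrightarrow> l"
proof -
  have C0: "0 \<le> C" using bu[of 0] norm_ge_zero order_trans by blast
  have "\<exists>c. u n = emb L (\<lambda>x. c + prim (w n) x)" for n using H1_repr[OF d L] by metis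
  then obtain c where c: "\<And>n. u n = emb L (\<lambda>x. c n + prim (w n) x)" by metis
  define f where "f n x = c n + prim (w n) x" for n x
  have cf: "continuous_on {0..L} (f n)" for n
    unfolding f_def by (intro continuous_intros continuous_prim_Icc)
  have bp: "cmod (prim (w n) x) \<le> sqrt L * C" if "x \<in> {0..L}" for n x
  proof -
    have "cmod (prim (w n) x) \<le> sqrt x * norm (w n)" using that by (intro prim_le) auto
    also have "\<dots> \<le> sqrt L * C" using that bw C0 by (intro mult_mono) auto
    finally show ?thesis .
  qed
  \<comment> \<open>The constant function is a difference of two functions bounded in L^2, and its
    own norm is \<open>cmod (c n) * sqrt L\<close>.\<close>
  have bc: "cmod (c n) \<le> C / sqrt L + sqrt L * C" for n
  proof -
    have s: "sq_integrable (indicator {0..L})"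
    by (rule sq_integrable_indicator[OF _ emeasure_interval_finite(1)]) simp
    have "emb L (\<lambda>x. c n) = u n - emb L (prim (w n))"
      using c[of n] emb_add[OF continuous_on_const continuous_prim_Icc, of L "c n" "w n"] by (simp add: algebra_simps)
    then have "norm (emb L (\<lambda>x. c n)) \<le> C + (sqrt L * C) * sqrt L"
      using norm_triangle_ineq4[of "u n" "emb L (prim (w n))"] bu[of n]
        norm_emb_le[OF continuous_prim_Icc[of L "w n"], of "sqrt L * C"] bp L by fastforce
    moreover have "(norm (emb L (\<lambda>x. c n)))\<^sup>2 = (cmod (c n) * sqrt L)\<^sup>2"
    proof -
      have "(norm (emb L (\<lambda>x. c n)))\<^sup>2 = (LBINT x. (cmod (c n))\<^sup>2 * indicator {0..L} x)"
        unfolding emb_def norm_abs_L2_sq[OF sq_integrable_continuous[OF continuous_on_const[of "{0..L}" "c n"]]]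
        by (intro Bochner_Integration.integral_cong) (auto simp: indicator_def)
      also have "\<dots> = (cmod (c n))\<^sup>2 * L" using L by simp
      finally show ?thesis using L by (simp add: power_mult_distrib)
    qed
    then have "norm (emb L (\<lambda>x. c n)) = cmod (c n) * sqrt L"
      using L by (simp add: power2_eq_iff_nonneg)
    moreover have "(C / sqrt L + sqrt L * C) * sqrt L = C + (sqrt L * C) * sqrt L"
      using L by (simp add: distrib_right)
    ultimately have "cmod (c n) * sqrt L \<le> (C / sqrt L + sqrt L * C) * sqrt L" by simp
    then show ?thesis by (rule mult_right_le_imp_le) (use L in simp)
  qed
  obtain g r where g: "continuous_on {0..L} g" "strict_mono (r :: nat \<Rightarrow> nat)"
    "\<And>e. 0 < e \<Longrightarrow> \<exists>N. \<forall>n x. n \<ge> N \<and> x \<in> {0..L} \<longrightarrow> norm (f (r n) x - g x) < e"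
  proof (rule Arzela_Ascoli[of "{0..L}" f "C / sqrt L + sqrt L * C + sqrt L * C"])
    show "cmod (f n x) \<le> C / sqrt L + sqrt L * C + sqrt L * C" if "x \<in> {0..L}" for n x
      unfolding f_def using norm_triangle_ineq[of "c n" "prim (w n) x"] bc[of n] bp[OF that, of n] by linarith
    fix x e :: real assume x: "x \<in> {0..L}" and e: "0 < e"
    \<comment> \<open>Solves \<open>sqrt \<delta> * (C + 1) = e\<close>; with \<open>C + 1\<close>
      in place of \<open>C\<close> there is no division by 0.\<close>
    define \<delta> where "\<delta> = (e / (C + 1))\<^sup>2"
    have \<delta>: "\<delta> > 0" using e C0 by (simp add: \<delta>_def)
    have "cmod (f n x - f n y) < e" if y: "y \<in> {0..L}" "norm (x - y) < \<delta>" for n y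
    proof -
      have "cmod (f n x - f n y) \<le> sqrt \<bar>x - y\<bar> * norm (w n)"
        using prim_diff_le_abs[of y x "w n"] x y by (simp add: f_def)
      also have "\<dots> \<le> sqrt \<bar>x - y\<bar> * (C + 1)" using bw[of n] by (intro mult_left_mono) auto
      also have "sqrt \<bar>x - y\<bar> < e / (C + 1)"
        using y(2) e C0 unfolding \<delta>_def by (intro real_less_lsqrt) auto
      then have "sqrt \<bar>x - y\<bar> * (C + 1) < e" using C0 by (simp add: field_simps)
      finally show ?thesis .
    qed
    then show "\<exists>d>0. \<forall>n y. y \<in> {0..L} \<and> norm (x - y) < d \<longrightarrow> norm (f n x - f n y) < e"
      using \<delta> by blast
  qed (auto intro: that)
  have "(\<lambda>n. u (r n)) \<longlonglongrightarrow> emb L g"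
  proof (rule metric_LIMSEQ_I)
    fix e :: real assume e: "e > 0"
    define e' where "e' = e / (2 * sqrt L)"
    have "e' > 0" using e L by (simp add: e'_def)
    then obtain N where N: "\<And>n x. n \<ge> N \<Longrightarrow> x \<in> {0..L} \<Longrightarrow> norm (f (r n) x - g x) < e'"
      using g(3) by blast
    have "dist (u (r n)) (emb L g) < e" if "n \<ge> N" for n
    proof -
      have "norm (emb L (f (r n)) - emb L g) \<le> e' * sqrt L"
        by (rule norm_emb_diff_le[OF cf g(1)]) (use L N[OF that] in \<open>auto intro: less_imp_le\<close>)
      also have "\<dots> < e" using e L by (simp add: e'_def field_simps)
      finally show ?thesis by (simp add: dist_norm c f_def[abs_def])
    qed
    then show "\<exists>no. \<forall>n\<ge>no. dist (u (r n)) (emb L g) < e" by blast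
  qed
  with g(2) show ?thesis by (rule that)
qed


section \<open>Coercivity, relative compactness and linear differential equations\<close>

lemma poincare:
  assumes "u \<in> H10 L" "has_weak_deriv L u w" "0 < L"
  shows "norm u \<le> L * norm w"
proof -
  have "norm (emb L (prim w)) \<le> (sqrt L * norm w) * sqrt L"
  proof (rule norm_emb_le[OF continuous_prim_Icc])
    fix x assume "x \<in> {0..L}"
    then have "cmod (prim w x) \<le> sqrt x * norm w" by (intro prim_le) auto
    also have "\<dots> \<le> sqrt L * norm w" using \<open>x \<in> {0..L}\<close> by (intro mult_right_mono) auto
    finally show "cmod (prim w x) \<le> sqrt L * norm w" .
  qed (use assms in simp)
  also have "\<dots> = L * norm w" using assms(3) by (simp add: mult.commute[of _ "norm w"] mult.assoc)
  finally show ?thesis using H10_repr(1)[OF assms] by simp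
qed

text \<open>
  Rotating \<open>(\<phi>, \<psi>)\<close> by the angle \<open>l x\<close> turns \<open>(\<phi>' + l \<psi>, \<psi>' - l \<phi>)\<close> into a plain derivative.
\<close>

lemma rotation_coercive_test:
  fixes l :: real
  assumes t: "test_fun L \<phi>" "test_fun L \<psi>" and L: "0 < L"
  defines "N \<equiv> norm (abs_L2 (vderiv \<phi>) + l *\<^sub>R abs_L2 \<psi>) + norm (abs_L2 (vderiv \<psi>) - l *\<^sub>R abs_L2 \<phi>)"
  shows "norm (abs_L2 \<phi>) \<le> 2 * L * N" "norm (abs_L2 \<psi>) \<le> 2 * L * N"
proof -
  define F where "F = abs_L2 (vderiv \<phi>) + l *\<^sub>R abs_L2 \<psi>"
  define G where "G = abs_L2 (vderiv \<psi>) - l *\<^sub>R abs_L2 \<phi>"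
  have F: "AE x in lborel. rep_L2 F x = vderiv \<phi> x + l * \<psi> x"
    unfolding F_def using rep_L2_add[of "abs_L2 (vderiv \<phi>)" "l *\<^sub>R abs_L2 \<psi>"] rep_L2_scaleR[of l "abs_L2 \<psi>"]
      rep_abs_L2[OF sq_integrable_test_fun[OF t(2)]] rep_abs_L2[OF sq_integrable_test_fun[OF test_fun_deriv[OF t(1)]]]
    by eventually_elim simp
  have G: "AE x in lborel. rep_L2 G x = vderiv \<psi> x - l * \<phi> x"
    unfolding G_def using rep_L2_diff[of "abs_L2 (vderiv \<psi>)" "l *\<^sub>R abs_L2 \<phi>"] rep_L2_scaleR[of l "abs_L2 \<phi>"]
      rep_abs_L2[OF sq_integrable_test_fun[OF t(1)]] rep_abs_L2[OF sq_integrable_test_fun[OF test_fun_deriv[OF t(2)]]]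
    by eventually_elim simp
  have c: "continuous_on A \<phi>" "continuous_on A (vderiv \<phi>)" "continuous_on A \<psi>" "continuous_on A (vderiv \<psi>)" for A
    using smooth_fun_continuous test_fun_smooth test_fun_deriv t by blast+
  have [measurable]: "\<phi> \<in> borel_measurable borel" "vderiv \<phi> \<in> borel_measurable borel"
      "\<psi> \<in> borel_measurable borel" "vderiv \<psi> \<in> borel_measurable borel"
    using test_fun_measurable test_fun_deriv t by blast+
  \<comment> \<open>The two equations for \<open>p\<close> and \<open>q\<close> make \<open>p *
    (vderiv \<phi> + l * \<psi>) + q * (vderiv \<psi> - l * \<phi>)\<close> the derivative of
    \<open>p * \<phi> + q * \<psi>\<close>. Bounded multiplication costs nothing in L^2.\<close>
  have rot: "cmod (p x * \<phi> x + q x * \<psi> x) \<le> sqrt L * N"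
    if pq: "\<And>x. (p has_real_derivative - l * q x) (at x)" "\<And>x. (q has_real_derivative l * p x) (at x)"
      and b: "\<And>x. \<bar>p x\<bar> \<le> 1" "\<And>x. \<bar>q x\<bar> \<le> 1" and x: "x \<in> {0..L}" for p q :: "real \<Rightarrow> real" and x
  proof -
    have cont: "continuous_on A p" "continuous_on A q" for A
      using pq DERIV_isCont by (blast intro: continuous_at_imp_continuous_on)+
    have [measurable]: "p \<in> borel_measurable borel" "q \<in> borel_measurable borel"
      using cont by (auto intro: borel_measurable_continuous_onI)
    interpret p: bounded_multiplier p 1 by standard (use b in auto)
    interpret q: bounded_multiplier q 1 by standard (use b in auto)
    define h where "h y = p y * (vderiv \<phi> y + l * \<psi> y) + q y * (vderiv \<psi> y - l * \<phi> y)" for y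
    have [measurable]: "h \<in> borel_measurable borel" unfolding h_def by measurable
    have "prim (p \<odot> F + q \<odot> G) x = (LBINT y:{0..x}. h y)"
      unfolding prim_def
    proof (rule set_lebesgue_integral_cong_AE)
      have "AE y in lborel. rep_L2 (p \<odot> F + q \<odot> G) y = h y"
        using F G p.rep_fn_mult[of F] q.rep_fn_mult[of G] rep_L2_add[of "p \<odot> F" "q \<odot> G"]
        by eventually_elim (simp add: h_def)
      then show "AE y in lborel. y \<in> {0..x} \<longrightarrow> rep_L2 (p \<odot> F + q \<odot> G) y = h y" by auto
    qed auto
    also have "\<dots> = (p x * \<phi> x + q x * \<psi> x) - (p 0 * \<phi> 0 + q 0 * \<psi> 0)"
      unfolding set_lebesgue_integral_def
    proof (rule integral_FTC_atLeastAtMost)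
      have pr: "((\<lambda>y. complex_of_real (f y) * g y) has_vector_derivative of_real (f y) * g' y + of_real (f' y) * g y) (at y)"
        if "(f has_real_derivative f' y) (at y)" "(g has_vector_derivative g' y) (at y)" for f f' g g' and y :: real
        using has_vector_derivative_mult[OF has_vector_derivative_of_real[OF that(1)] that(2)]
        by simp
      have "((\<lambda>y. p y * \<phi> y + q y * \<psi> y) has_vector_derivative
          (p y * vderiv \<phi> y + of_real (- l * q y) * \<phi> y) + (q y * vderiv \<psi> y + of_real (l * p y) * \<psi> y)) (at y)" for y
        using has_vector_derivative_add[OF pr[of p "\<lambda>y. - l * q y" y \<phi> "vderiv \<phi>", OF pq(1) test_fun_has_deriv[OF t(1)]]
          pr[of q "\<lambda>y. l * p y" y \<psi> "vderiv \<psi>", OF pq(2) test_fun_has_deriv[OF t(2)]]] .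
      moreover have "(p y * vderiv \<phi> y + of_real (- l * q y) * \<phi> y) + (q y * vderiv \<psi> y + of_real (l * p y) * \<psi> y) = h y" for y
        by (simp add: h_def algebra_simps)
      ultimately show "((\<lambda>y. p y * \<phi> y + q y * \<psi> y) has_vector_derivative h y) (at y within {0..x})" for y
        using has_vector_derivative_at_within by fastforce
      show "continuous_on {0..x} h" unfolding h_def by (intro continuous_intros c cont)
    qed (use x in simp)
    also have "\<dots> = p x * \<phi> x + q x * \<psi> x" using test_fun_outside[OF t(1), of 0] test_fun_outside[OF t(2), of 0] by simp
    finally have "cmod (p x * \<phi> x + q x * \<psi> x) \<le> sqrt x * norm (p \<odot> F + q \<odot> G)"
      using prim_le[of x "p \<odot> F + q \<odot> G"] x by simp
    also have "\<dots> \<le> sqrt L * (norm F + norm G)"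
      using norm_triangle_ineq[of "p \<odot> F" "q \<odot> G"] p.norm_fn_mult_le[of F] q.norm_fn_mult_le[of G] x
      by (intro mult_mono) auto
    finally show ?thesis by (simp add: N_def F_def G_def)
  qed
  have N0: "0 \<le> N" by (simp add: N_def)
  have a: "cmod (cos (l * x) * \<phi> x + sin (l * x) * \<psi> x) \<le> sqrt L * N" if "x \<in> {0..L}" for x
    by (rule rot[of "\<lambda>x. cos (l * x)" "\<lambda>x. sin (l * x)"]) (use that in \<open>auto intro!: derivative_eq_intros\<close>)
  have b: "cmod ((- sin (l * x)) * \<phi> x + cos (l * x) * \<psi> x) \<le> sqrt L * N" if "x \<in> {0..L}" for x
  proof -
    have "((\<lambda>x. - sin (l * x)) has_real_derivative - l * cos (l * x)) (at x)"
      "((\<lambda>x. cos (l * x)) has_real_derivative l * - sin (l * x)) (at x)" for x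
      by (auto intro!: derivative_eq_intros)
    from rot[OF this _ _ that] show ?thesis by simp
  qed
  have mult_le: "cmod (complex_of_real r * z) \<le> m" if "cmod z \<le> m" "\<bar>r\<bar> \<le> 1" for r z m
    using mult_mono[OF that(2,1)] by (simp add: norm_mult)
  have trig: "of_real (cos y) * (of_real (cos y) * z) + of_real (sin y) * (of_real (sin y) * z) = (z :: complex)" for y z
  proof -
    have "of_real (cos y) * (of_real (cos y) * z) + of_real (sin y) * (of_real (sin y) * z)
        = of_real ((cos y)\<^sup>2 + (sin y)\<^sup>2) * z"
      by (simp only: of_real_add of_real_mult power2_eq_square distrib_right mult.assoc)
    then show ?thesis by simp
  qed
  \<comment> \<open>Undoing the rotation writes each function as a combination of the two bounded
    quantities, hence the factor 2.\<close>
  have "cmod (\<phi> x) \<le> 2 * (sqrt L * N)" "cmod (\<psi> x) \<le> 2 * (sqrt L * N)" if x: "x \<in> {0..L}" for x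
  proof -
    define A where "A = cos (l * x) * \<phi> x + sin (l * x) * \<psi> x"
    define B where "B = (- sin (l * x)) * \<phi> x + cos (l * x) * \<psi> x"
    have "\<phi> x = of_real (cos (l * x)) * A - of_real (sin (l * x)) * B"
      "\<psi> x = of_real (sin (l * x)) * A + of_real (cos (l * x)) * B"
      using trig[of "l * x" "\<phi> x"] trig[of "l * x" "\<psi> x"] by (simp_all add: A_def B_def algebra_simps)
    moreover have "cmod (of_real (cos (l * x)) * A) \<le> sqrt L * N" "cmod (of_real (sin (l * x)) * B) \<le> sqrt L * N"
      "cmod (of_real (sin (l * x)) * A) \<le> sqrt L * N" "cmod (of_real (cos (l * x)) * B) \<le> sqrt L * N"
      using a[OF x] b[OF x] by (auto intro!: mult_le simp: A_def B_def)
    ultimately show "cmod (\<phi> x) \<le> 2 * (sqrt L * N)" "cmod (\<psi> x) \<le> 2 * (sqrt L * N)"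
      using norm_triangle_ineq4[of "of_real (cos (l * x)) * A" "of_real (sin (l * x)) * B"]
        norm_triangle_ineq[of "of_real (sin (l * x)) * A" "of_real (cos (l * x)) * B"] by auto
  qed
  then have "norm (emb L \<phi>) \<le> 2 * (sqrt L * N) * sqrt L" "norm (emb L \<psi>) \<le> 2 * (sqrt L * N) * sqrt L"
    using L by (auto intro!: norm_emb_le c)
  moreover have "2 * (sqrt L * N) * sqrt L = 2 * L * N"
    using L by (simp add: mult.commute[of _ N] mult.assoc mult.left_commute[of _ N])
  ultimately show "norm (abs_L2 \<phi>) \<le> 2 * L * N" "norm (abs_L2 \<psi>) \<le> 2 * L * N"
    using emb_test t by simp_all
qed

text \<open>Extends the test function estimate by density. Absorbing the coupling terms with the
  Poincare inequality instead would require l L to be small.\<close>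

lemma rotation_coercive:
  assumes u: "u \<in> H10 L" "has_weak_deriv L u u'" and v: "v \<in> H10 L" "has_weak_deriv L v v'" and L: "0 < L"
  shows "norm u \<le> 2 * L * (norm (u' + l *\<^sub>R v) + norm (v' - l *\<^sub>R u))"
    and "norm v \<le> 2 * L * (norm (u' + l *\<^sub>R v) + norm (v' - l *\<^sub>R u))"
proof -
  obtain \<phi> where \<phi>: "\<And>n. test_fun L (\<phi> n)" "(\<lambda>n. abs_L2 (\<phi> n)) \<longlonglongrightarrow> u" "(\<lambda>n. abs_L2 (vderiv (\<phi> n))) \<longlonglongrightarrow> u'"
    using H10_approx_seq[OF u] by metis
  obtain \<psi> where \<psi>: "\<And>n. test_fun L (\<psi> n)" "(\<lambda>n. abs_L2 (\<psi> n)) \<longlonglongrightarrow> v" "(\<lambda>n. abs_L2 (vderiv (\<psi> n))) \<longlonglongrightarrow> v'"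
    using H10_approx_seq[OF v] by metis
  have lim: "(\<lambda>n. 2 * L * (norm (abs_L2 (vderiv (\<phi> n)) + l *\<^sub>R abs_L2 (\<psi> n)) + norm (abs_L2 (vderiv (\<psi> n)) - l *\<^sub>R abs_L2 (\<phi> n))))
      \<longlonglongrightarrow> 2 * L * (norm (u' + l *\<^sub>R v) + norm (v' - l *\<^sub>R u))"
    by (intro tendsto_intros \<phi> \<psi>)
  show "norm u \<le> 2 * L * (norm (u' + l *\<^sub>R v) + norm (v' - l *\<^sub>R u))"
    by (rule LIMSEQ_le[OF tendsto_norm[OF \<phi>(2)] lim]) (use rotation_coercive_test(1)[OF \<phi>(1) \<psi>(1) L] in blast)
  show "norm v \<le> 2 * L * (norm (u' + l *\<^sub>R v) + norm (v' - l *\<^sub>R u))"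
    by (rule LIMSEQ_le[OF tendsto_norm[OF \<psi>(2)] lim]) (use rotation_coercive_test(2)[OF \<phi>(1) \<psi>(1) L] in blast)
qed

text \<open>Quantifying over all subsequences \<open>r\<close> makes the notion stable under
  pairing: the components are handled by successive extraction.\<close>

definition seq_precompact :: "(nat \<Rightarrow> 'a::topological_space) \<Rightarrow> bool"
  where "seq_precompact f \<longleftrightarrow>
    (\<forall>r. strict_mono (r :: nat \<Rightarrow> nat) \<longrightarrow> (\<exists>s l. strict_mono (s :: nat \<Rightarrow> nat) \<and> (\<lambda>n. f (r (s n))) \<longlonglongrightarrow> l))"

lemma seq_precompact_LIMSEQ:
  assumes "f \<longlonglongrightarrow> l" shows "seq_precompact f"
  unfolding seq_precompact_def
proof (intro allI impI)
  fix r :: "nat \<Rightarrow> nat" assume "strict_mono r"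
  then have "(\<lambda>n. f (r (id n))) \<longlonglongrightarrow> l" using LIMSEQ_subseq_LIMSEQ[OF assms] by (simp add: o_def)
  then show "\<exists>s l. strict_mono (s :: nat \<Rightarrow> nat) \<and> (\<lambda>n. f (r (s n))) \<longlonglongrightarrow> l"
    using strict_mono_id by blast
qed

lemma seq_precompact_Pair:
  assumes "seq_precompact f" "seq_precompact g"
  shows "seq_precompact (\<lambda>n. (f n, g n))"
  unfolding seq_precompact_def
proof (intro allI impI)
  fix r :: "nat \<Rightarrow> nat" assume r: "strict_mono r"
  obtain s l where s: "strict_mono (s :: nat \<Rightarrow> nat)" "(\<lambda>n. f (r (s n))) \<longlonglongrightarrow> l"
    using assms(1) r unfolding seq_precompact_def by blast
  have "strict_mono (\<lambda>n. r (s n))" using r s(1) by (simp add: strict_mono_def)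
  then obtain s' l' where s': "strict_mono (s' :: nat \<Rightarrow> nat)" "(\<lambda>n. g (r (s (s' n)))) \<longlonglongrightarrow> l'"
    using assms(2) unfolding seq_precompact_def by blast
  have "(\<lambda>n. f (r (s (s' n)))) \<longlonglongrightarrow> l" using LIMSEQ_subseq_LIMSEQ[OF s(2) s'(1)] by (simp add: o_def)
  then have "(\<lambda>n. (f (r (s (s' n))), g (r (s (s' n))))) \<longlonglongrightarrow> (l, l')" using s'(2) by (rule tendsto_Pair)
  moreover have "strict_mono (\<lambda>n. s (s' n))" using s(1) s'(1) by (simp add: strict_mono_def)
  ultimately show "\<exists>s l. strict_mono (s :: nat \<Rightarrow> nat) \<and> (\<lambda>n. (f (r (s n)), g (r (s n)))) \<longlonglongrightarrow> l" by blast
qed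

lemma seq_precompact_compose:
  assumes f: "seq_precompact f" and h: "\<And>l. isCont h l"
  shows "seq_precompact (\<lambda>n. h (f n))"
  unfolding seq_precompact_def
proof (intro allI impI)
  fix r :: "nat \<Rightarrow> nat" assume r: "strict_mono r"
  obtain s l where s: "strict_mono (s :: nat \<Rightarrow> nat)" "(\<lambda>n. f (r (s n))) \<longlonglongrightarrow> l"
    using f r unfolding seq_precompact_def by blast
  then show "\<exists>s l. strict_mono (s :: nat \<Rightarrow> nat) \<and> (\<lambda>n. h (f (r (s n)))) \<longlonglongrightarrow> l"
    using isCont_tendsto_compose[OF h s(2)] by blast
qed

lemma seq_precompact_scaleR: "seq_precompact f \<Longrightarrow> seq_precompact (\<lambda>n. c *\<^sub>R (f n :: 'a::real_normed_vector))"
  by (rule seq_precompact_compose[where h = "\<lambda>x. c *\<^sub>R x"]) (auto intro: continuous_intros)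

lemma seq_precompact_diff:
  assumes "seq_precompact f" "seq_precompact g"
  shows "seq_precompact (\<lambda>n. f n - g n :: 'a::real_normed_vector)"
  using seq_precompact_compose[OF seq_precompact_Pair[OF assms], of "\<lambda>p. fst p - snd p"]
  by (auto intro: continuous_intros)

lemma seq_precompact_rellich:
  assumes L: "0 < L" and d: "\<And>n. has_weak_deriv L (u n) (w n)"
    and b: "bounded (range u)" "bounded (range w)"
  shows "seq_precompact u"
  unfolding seq_precompact_def
proof (intro allI impI)
  fix r :: "nat \<Rightarrow> nat"
  obtain C1 C2 where C: "\<And>n. norm (u n) \<le> C1" "\<And>n. norm (w n) \<le> C2"
    using b by (auto simp: bounded_iff)
  show "\<exists>s l. strict_mono (s :: nat \<Rightarrow> nat) \<and> (\<lambda>n. u (r (s n))) \<longlonglongrightarrow> l"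
    using rellich[OF L d, of r "max C1 C2"] C by (metis max.coboundedI1 max.coboundedI2)
qed

lemma bounded_range_mono:
  fixes f :: "nat \<Rightarrow> 'a::real_normed_vector" and g :: "nat \<Rightarrow> 'b::real_normed_vector"
  assumes "bounded (range g)" "\<And>n. norm (f n) \<le> K * norm (g n)" "0 \<le> K"
  shows "bounded (range f)"
proof -
  obtain C where C: "\<And>n. norm (g n) \<le> C" using assms(1) by (auto simp: bounded_iff)
  have "norm (f n) \<le> K * C" for n using assms(2)[of n] mult_left_mono[OF C assms(3), of n] by linarith
  then show ?thesis by (auto simp: bounded_iff)
qed

text \<open>Turns a weak equation with continuous right-hand side into a classical one: the Lebesgue
  primitive agrees with the gauge integral, for which the fundamental theorem holds at interior
  points.\<close>

lemma prim_emb_deriv: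
  assumes h: "continuous_on {0..L} h" and x: "x \<in> {0<..<L}"
  shows "(prim (emb L h) has_vector_derivative h x) (at x)"
proof -
  have eq: "prim (emb L h) y = integral {0..y} h" if y: "y \<in> {0..L}" for y
  proof -
    have si: "set_integrable lborel {0..y} h"
      by (rule borel_integrable_atLeastAtMost') (use y in \<open>auto intro: continuous_on_subset[OF h]\<close>)
    have m: "set_borel_measurable lborel {0..y} h"
      using si unfolding set_integrable_def set_borel_measurable_def by auto
    have "prim (emb L h) y = (LBINT z:{0..y}. h z)"
      unfolding prim_def set_lebesgue_integral_def
    proof (rule integral_cong_AE)
      show "AE z in lborel. indicat_real {0..y} z *\<^sub>R rep_L2 (emb L h) z = indicat_real {0..y} z *\<^sub>R h z"
        using rep_emb[OF h] by eventually_elim (use y in \<open>auto simp: indicator_def\<close>)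
    qed (use m in \<open>auto simp: set_borel_measurable_def\<close>)
    also have "\<dots> = integral {0..y} h" by (rule set_borel_integral_eq_integral(2)[OF si])
    finally show ?thesis .
  qed
  have "((\<lambda>y. integral {0..y} h) has_vector_derivative h x) (at x within {0..L})"
    by (rule integral_has_vector_derivative[OF h]) (use x in auto)
  then have "((\<lambda>y. integral {0..y} h) has_vector_derivative h x) (at x)"
    using x at_within_Icc_at[of 0 x L] by simp
  then show ?thesis
    by (rule has_vector_derivative_transform_within_open[of _ _ _ "{0<..<L}"]) (use x eq in auto)
qed

text \<open>Gronwall: the derivative of the squared norm is at most \<open>2 * C\<close> times it,
  so the squared norm weighted with \<open>exp (- (2 * C) * z)\<close> does not increase.\<close>

lemma linear_ode_zero_forward:
  fixes y :: "real \<Rightarrow> 'a::real_inner"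
  assumes d: "\<And>x. x \<in> {a<..<b} \<Longrightarrow> (y has_vector_derivative y' x) (at x)"
    and le: "\<And>x. x \<in> {a<..<b} \<Longrightarrow> norm (y' x) \<le> C * norm (y x)"
    and x0: "x0 \<in> {a<..<b}" "y x0 = 0" and x: "x \<in> {a<..<b}" "x0 \<le> x"
  shows "y x = 0"
proof -
  define E where "E z = exp (- (2 * C) * z) * (norm (y z))\<^sup>2" for z
  have "\<exists>D. (E has_real_derivative D) (at z) \<and> D \<le> 0" if z: "z \<in> {a<..<b}" for z
  proof -
    have "((\<lambda>z. inner (y z) (y z)) has_derivative (\<lambda>h. inner (y z) (h *\<^sub>R y' z) + inner (h *\<^sub>R y' z) (y z))) (at z)"
      using d[OF z] unfolding has_vector_derivative_def by (intro has_derivative_inner)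
    then have n: "((\<lambda>z. (norm (y z))\<^sup>2) has_real_derivative 2 * inner (y' z) (y z)) (at z)"
      unfolding has_field_derivative_def power2_norm_eq_inner
      by (rule has_derivative_eq_rhs) (auto simp: inner_commute algebra_simps)
    have "(E has_real_derivative (exp (- (2 * C) * z) * (- (2 * C))) * (norm (y z))\<^sup>2
        + (2 * inner (y' z) (y z)) * exp (- (2 * C) * z)) (at z)"
      unfolding E_def by (rule DERIV_mult) (auto intro!: derivative_eq_intros n)
    moreover have "inner (y' z) (y z) \<le> C * (norm (y z))\<^sup>2"
    proof -
      have "inner (y' z) (y z) \<le> norm (y' z) * norm (y z)" by (rule norm_cauchy_schwarz)
      also have "\<dots> \<le> C * norm (y z) * norm (y z)" by (intro mult_right_mono le z) auto
      finally show ?thesis by (simp add: power2_eq_square mult.assoc)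
    qed
    then have "exp (- (2 * C) * z) * (2 * inner (y' z) (y z) - 2 * C * (norm (y z))\<^sup>2) \<le> 0"
      by (intro mult_nonneg_nonpos) auto
    then have "(exp (- (2 * C) * z) * (- (2 * C))) * (norm (y z))\<^sup>2 + (2 * inner (y' z) (y z)) * exp (- (2 * C) * z) \<le> 0"
      by (simp add: algebra_simps)
    ultimately show ?thesis by blast
  qed
  then have "E x \<le> E x0"
    by (rule DERIV_nonpos_imp_nonincreasing[OF x(2)]) (use x x0(1) in auto)
  then have "exp (- (2 * C) * x) * (norm (y x))\<^sup>2 \<le> 0" using x0(2) by (simp add: E_def)
  then show ?thesis by (simp add: mult_le_0_iff not_le)
qed

text \<open>Points left of \<open>x0\<close> are reached by reflecting the variable.\<close>

lemma linear_ode_zero: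
  fixes y :: "real \<Rightarrow> 'a::real_inner"
  assumes d: "\<And>x. x \<in> {a<..<b} \<Longrightarrow> (y has_vector_derivative y' x) (at x)"
    and le: "\<And>x. x \<in> {a<..<b} \<Longrightarrow> norm (y' x) \<le> C * norm (y x)"
    and x0: "x0 \<in> {a<..<b}" "y x0 = 0" and x: "x \<in> {a<..<b}"
  shows "y x = 0"
proof (cases "x0 \<le> x")
  case True
  then show ?thesis using linear_ode_zero_forward[OF d le x0 x] by blast
next
  case False
  have "y (- (- x)) = 0"
  proof (rule linear_ode_zero_forward[of "- b" "- a" "\<lambda>x. y (- x)" "\<lambda>x. - y' (- x)" C "- x0" "- x"])
    fix z assume z: "z \<in> {- b<..<- a}"
    have m: "(uminus has_vector_derivative (- 1 :: real)) (at z)" by (auto intro!: derivative_eq_intros)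
    have "(y has_vector_derivative y' (- z)) (at (- z))" using d[of "- z"] z by auto
    from vector_diff_chain_at[OF m this]
    show "((\<lambda>x. y (- x)) has_vector_derivative - y' (- z)) (at z)" by (simp add: o_def)
    show "norm (- y' (- z)) \<le> C * norm (y (- z))" using le[of "- z"] z by auto
  qed (use x x0 False in auto)
  then show ?thesis by simp
qed

text \<open>A nonzero value would persist on a small interval, which has positive measure.\<close>

lemma AE_zero_imp_zero:
  fixes f :: "real \<Rightarrow> complex"
  assumes ae: "AE x in lborel. x \<in> {a<..<b} \<longrightarrow> f x = 0" and c: "continuous_on {a<..<b} f" and x: "x \<in> {a<..<b}"
  shows "f x = 0"
proof (rule ccontr)
  assume "f x \<noteq> 0"
  have "open ({a<..<b} \<inter> f -` (- {0}))"
    by (rule continuous_open_preimage[OF c]) auto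
  moreover have "x \<in> {a<..<b} \<inter> f -` (- {0})" using x \<open>f x \<noteq> 0\<close> by simp
  ultimately obtain e where e: "e > 0" "ball x e \<subseteq> {a<..<b} \<inter> f -` (- {0})"
    by (meson openE)
  have "AE y in lborel. y \<notin> {x - e<..<x + e}"
    using ae
  proof eventually_elim
    case (elim y)
    show ?case
    proof
      assume "y \<in> {x - e<..<x + e}"
      then have "y \<in> ball x e" by (auto simp: dist_real_def)
      then show False using e(2) elim by auto
    qed
  qed
  then have "emeasure lborel {x - e<..<x + e} = 0"
    by (subst (asm) AE_iff_measurable[of "{x - e<..<x + e}"]) auto
  then show False using e(1) by simp
qed

lemma vector_derivative_zero:
  fixes f :: "real \<Rightarrow> 'a::real_normed_vector"
  assumes "(f has_vector_derivative f') (at x)" "\<And>y. y \<in> {a<..<b} \<Longrightarrow> f y = 0" "x \<in> {a<..<b}"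
  shows "f' = 0"
proof -
  have "(f has_vector_derivative 0) (at x)"
    by (rule has_vector_derivative_transform_within_open[of "\<lambda>x. 0" _ _ "{a<..<b}"]) (use assms in auto)
  then show ?thesis using vector_derivative_unique_at[OF assms(1)] by blast
qed


section \<open>The energy space\<close>

lemma norm_Pair_sq: "(norm (a, b))\<^sup>2 = (norm a)\<^sup>2 + (norm b)\<^sup>2"
  by (simp add: norm_Pair)

lemma norm_scaleC_state: "norm (c *\<^sub>C (x :: state)) = cmod c * norm x"
proof -
  obtain a1 a2 a3 a4 a5 a6 where x: "x = (a1, a2, a3, a4, a5, a6)" by (cases x)
  have "(norm (c *\<^sub>C x))\<^sup>2 = (cmod c * norm x)\<^sup>2"
    unfolding x scaleC_prod_def fst_conv snd_conv norm_Pair_sq norm_scaleC power_mult_distrib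
    by (simp add: algebra_simps)
  then show ?thesis by (simp add: power2_eq_iff_nonneg)
qed

lemma inner_ii_scaleC_state: "inner (\<i> *\<^sub>C (x :: state)) x = 0"
  by (cases x) (simp add: scaleC_prod_def inner_ii_scaleC_self)

lemma scaleC_Complex: "Complex a b *\<^sub>C x = a *\<^sub>R x + b *\<^sub>R (\<i> *\<^sub>C (x :: 'a::complex_vector))"
proof -
  have "Complex a b = of_real a + of_real b * \<i>" by (simp add: complex_eq_iff)
  then show ?thesis by (simp add: scaleR_scaleC scaleC_scaleC scaleC_add_left)
qed

lemma integrable_rep_L2_sq [simp]: "integrable lborel (\<lambda>x. (cmod (rep_L2 u x))\<^sup>2)"
  using sq_integrable_rep_L2[of u] by (simp add: sq_integrable_def)

lemma weak_deriv_add: "u \<in> H1 L \<Longrightarrow> v \<in> H1 L \<Longrightarrow> weak_deriv L (u + v) = weak_deriv L u + weak_deriv L v"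
  by (rule weak_deriv_eq[OF has_weak_deriv_add]) (auto simp: H1_iff)

lemma weak_deriv_diff: "u \<in> H1 L \<Longrightarrow> v \<in> H1 L \<Longrightarrow> weak_deriv L (u - v) = weak_deriv L u - weak_deriv L v"
  by (rule weak_deriv_eq[OF has_weak_deriv_diff]) (auto simp: H1_iff)

lemma weak_deriv_scaleC: "u \<in> H1 L \<Longrightarrow> weak_deriv L (c *\<^sub>C u) = c *\<^sub>C weak_deriv L u"
  by (rule weak_deriv_eq[OF has_weak_deriv_scaleC]) (auto simp: H1_iff)

lemma weak_deriv_scaleR: "u \<in> H1 L \<Longrightarrow> weak_deriv L (c *\<^sub>R u) = c *\<^sub>R weak_deriv L u"
  by (simp add: scaleR_scaleC weak_deriv_scaleC)

lemma H1_add: "u \<in> H1 L \<Longrightarrow> v \<in> H1 L \<Longrightarrow> u + v \<in> H1 L"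
  and H1_diff: "u \<in> H1 L \<Longrightarrow> v \<in> H1 L \<Longrightarrow> u - v \<in> H1 L"
  and H1_scaleR: "u \<in> H1 L \<Longrightarrow> c *\<^sub>R u \<in> H1 L"
  unfolding H1_def using has_weak_deriv_add has_weak_deriv_diff has_weak_deriv_scaleR by blast+

lemma H1_L2_on: "u \<in> H1 L \<Longrightarrow> u \<in> L2_on L" "u \<in> H1 L \<Longrightarrow> weak_deriv L u \<in> L2_on L"
  by (auto simp: H1_iff has_weak_deriv_iff)

lemma convergent_if_dominated:
  fixes f :: "nat \<Rightarrow> 'a::banach" and g :: "nat \<Rightarrow> 'b::real_normed_vector" and h :: "nat \<Rightarrow> 'c::real_normed_vector"
  assumes "convergent g" "convergent h" "0 \<le> K"
    and le: "\<And>i j. norm (f i - f j) \<le> K * (norm (g i - g j) + norm (h i - h j))"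
  shows "convergent f"
proof -
  have "Cauchy f"
  proof (rule metric_CauchyI)
    fix e :: real assume "e > 0"
    define c where "c = K + 1"
    have c: "c > 0" "K \<le> c" using assms(3) by (simp_all add: c_def)
    have e': "e / (2 * c) > 0" using c \<open>e > 0\<close> by simp
    obtain M1 where M1: "\<And>i j. i \<ge> M1 \<Longrightarrow> j \<ge> M1 \<Longrightarrow> dist (g i) (g j) < e / (2 * c)"
      using metric_CauchyD[OF convergent_Cauchy[OF assms(1)] e'] by blast
    obtain M2 where M2: "\<And>i j. i \<ge> M2 \<Longrightarrow> j \<ge> M2 \<Longrightarrow> dist (h i) (h j) < e / (2 * c)"
      using metric_CauchyD[OF convergent_Cauchy[OF assms(2)] e'] by blast
    have "dist (f i) (f j) < e" if ij: "i \<ge> max M1 M2" "j \<ge> max M1 M2" for i j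
    proof -
      have "norm (f i - f j) \<le> c * (norm (g i - g j) + norm (h i - h j))"
        using le[of i j] mult_right_mono[OF c(2), of "norm (g i - g j) + norm (h i - h j)"] by simp
      also have "\<dots> < c * (e / (2 * c) + e / (2 * c))"
        using M1[of i j] M2[of i j] ij c by (intro mult_strict_left_mono add_strict_mono) (auto simp: dist_norm)
      also have "\<dots> = e" using c by (simp add: field_simps)
      finally show ?thesis by (simp add: dist_norm)
    qed
    then show "\<exists>M. \<forall>m\<ge>M. \<forall>n\<ge>M. dist (f m) (f n) < e" by blast
  qed
  then show ?thesis by (rule Cauchy_convergent)
qed

locale bresse =
  fixes \<rho>1 \<rho>2 k1 k2 k3 l L \<alpha> \<beta> d0 :: real
  assumes pos: "0 < \<rho>1" "0 < \<rho>2" "0 < k1" "0 < k2" "0 < k3" "0 < l" "0 < L"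
    and damped: "0 < \<alpha>" "\<alpha> < \<beta>" "\<beta> < L" "0 < d0"
begin

abbreviation "d \<equiv> damping \<alpha> \<beta> d0"
abbreviation "X \<equiv> bresse_space L"
abbreviation "N \<equiv> bresse_norm \<rho>1 \<rho>2 k1 k2 k3 l L"
abbreviation "Dom \<equiv> bresse_dom k3 l L d"
abbreviation "A \<equiv> bresse_op \<rho>1 \<rho>2 k1 k2 k3 l L d"
abbreviation "wd \<equiv> weak_deriv L"

text \<open>The energy norm is the norm of \<open>L2\<^sup>6\<close> pulled back along \<open>J\<close>.\<close>

fun J :: "state \<Rightarrow> state"
  where "J (v1, v2, v3, v4, v5, v6) =
    (sqrt k1 *\<^sub>R (wd v1 + v3 + l *\<^sub>R v5), sqrt \<rho>1 *\<^sub>R v2, sqrt k2 *\<^sub>R wd v3, sqrt \<rho>2 *\<^sub>R v4,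
     sqrt k3 *\<^sub>R (wd v5 - l *\<^sub>R v1), sqrt \<rho>1 *\<^sub>R v6)"

declare J.simps [simp del]

lemma X_iff: "(v1, v2, v3, v4, v5, v6) \<in> X \<longleftrightarrow>
    v1 \<in> H10 L \<and> v2 \<in> L2_on L \<and> v3 \<in> H10 L \<and> v4 \<in> L2_on L \<and> v5 \<in> H10 L \<and> v6 \<in> L2_on L"
  by (simp add: bresse_space_def)

lemma X_cases:
  assumes "U \<in> X"
  obtains v1 v2 v3 v4 v5 v6 where "U = (v1, v2, v3, v4, v5, v6)" "v1 \<in> H10 L" "v2 \<in> L2_on L" "v3 \<in> H10 L"
    "v4 \<in> L2_on L" "v5 \<in> H10 L" "v6 \<in> L2_on L"
  using assms X_iff by (metis prod_cases6)

lemma X_add: "U \<in> X \<Longrightarrow> V \<in> X \<Longrightarrow> U + V \<in> X"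
  by (elim X_cases) (simp add: X_iff H10_add L2_on_add)

lemma X_scaleC: "U \<in> X \<Longrightarrow> c *\<^sub>C U \<in> X"
  by (elim X_cases) (simp add: X_iff H10_scaleC L2_on_scaleC scaleC_prod_def)

lemma X_scaleR: "U \<in> X \<Longrightarrow> r *\<^sub>R U \<in> X"
  by (simp add: scaleR_scaleC X_scaleC)

lemma X_diff: "U \<in> X \<Longrightarrow> V \<in> X \<Longrightarrow> U - V \<in> X"
  using X_add[of U "(-1) *\<^sub>R V"] X_scaleR[of V "-1"] by simp

lemma X_zero: "0 \<in> X"
  using pos by (simp add: zero_prod_def X_iff H10_zero L2_on_zero)

lemma J_add: "U \<in> X \<Longrightarrow> V \<in> X \<Longrightarrow> J (U + V) = J U + J V"
  by (elim X_cases) (simp add: J.simps H10_H1 weak_deriv_add algebra_simps)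

lemma J_scaleC: "U \<in> X \<Longrightarrow> J (c *\<^sub>C U) = c *\<^sub>C J U"
proof -
  have c: "r *\<^sub>R c *\<^sub>C x = c *\<^sub>C r *\<^sub>R x" for r and x :: L2
    by (simp add: scaleR_scaleC scaleC_scaleC mult.commute)
  have m: "c *\<^sub>C (x - y) = c *\<^sub>C x - c *\<^sub>C y" for x y :: L2
    using scaleC_add_right[of c "x - y" y] by (simp add: algebra_simps)
  show "U \<in> X \<Longrightarrow> J (c *\<^sub>C U) = c *\<^sub>C J U"
    by (elim X_cases) (simp add: J.simps H10_H1 weak_deriv_scaleC scaleC_prod_def c scaleC_add_right[symmetric] m[symmetric])
qed

lemma J_scaleR: "U \<in> X \<Longrightarrow> J (r *\<^sub>R U) = r *\<^sub>R J U"
  by (simp add: scaleR_scaleC J_scaleC)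

lemma J_diff: "U \<in> X \<Longrightarrow> V \<in> X \<Longrightarrow> J (U - V) = J U - J V"
  using J_add[of U "(-1) *\<^sub>R V"] X_scaleR[of V "-1"] J_scaleR[of V "-1"] by simp

lemma norm_J_sq: "(norm (J (v1, v2, v3, v4, v5, v6)))\<^sup>2 =
    k1 * (norm (wd v1 + v3 + l *\<^sub>R v5))\<^sup>2 + \<rho>1 * (norm v2)\<^sup>2 + k2 * (norm (wd v3))\<^sup>2 + \<rho>2 * (norm v4)\<^sup>2
    + k3 * (norm (wd v5 - l *\<^sub>R v1))\<^sup>2 + \<rho>1 * (norm v6)\<^sup>2"
  unfolding J.simps norm_Pair_sq using pos by (simp add: power_mult_distrib)

lemma inner_J: "inner (J (u1, u2, u3, u4, u5, u6)) (J (v1, v2, v3, v4, v5, v6)) =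
    k1 * inner (wd u1 + u3 + l *\<^sub>R u5) (wd v1 + v3 + l *\<^sub>R v5) + \<rho>1 * inner u2 v2 + k2 * inner (wd u3) (wd v3)
    + \<rho>2 * inner u4 v4 + k3 * inner (wd u5 - l *\<^sub>R u1) (wd v5 - l *\<^sub>R v1) + \<rho>1 * inner u6 v6"
proof -
  have s: "sqrt k * (sqrt k * x) = k * x" if "0 < k" for k x :: real
    using that by (simp add: mult.assoc[symmetric])
  show ?thesis unfolding J.simps inner_Pair inner_scaleR_left inner_scaleR_right
    using pos by (simp add: s add.assoc)
qed

lemma norm_J:
  assumes "U \<in> X" shows "norm (J U) = N U"
proof -
  obtain v1 v2 v3 v4 v5 v6 where U: "U = (v1, v2, v3, v4, v5, v6)" "v1 \<in> H10 L" "v2 \<in> L2_on L" "v3 \<in> H10 L"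
    "v4 \<in> L2_on L" "v5 \<in> H10 L" "v6 \<in> L2_on L"
    using X_cases[OF assms] by metis
  have z: "AE x in lborel. x \<notin> {0<..<L} \<longrightarrow> rep_L2 u x = 0" if "u \<in> L2_on L" for u
    using that by (simp add: L2_on_def)
  have S: "wd v1 + v3 + l *\<^sub>R v5 \<in> L2_on L" and R: "wd v3 \<in> L2_on L" and G: "wd v5 - l *\<^sub>R v1 \<in> L2_on L"
    using U(2,4,6)[THEN H10_L2_on] U(2,4,6)[THEN H10_H1, THEN H1_L2_on(2)]
    by (simp_all add: L2_on_add L2_on_diff L2_on_scaleR)
  have "N U = sqrt (LBINT x. k1 * (cmod (rep_L2 (wd v1 + v3 + l *\<^sub>R v5) x))\<^sup>2 + \<rho>1 * (cmod (rep_L2 v2 x))\<^sup>2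
      + k2 * (cmod (rep_L2 (wd v3) x))\<^sup>2 + \<rho>2 * (cmod (rep_L2 v4 x))\<^sup>2
      + k3 * (cmod (rep_L2 (wd v5 - l *\<^sub>R v1) x))\<^sup>2 + \<rho>1 * (cmod (rep_L2 v6 x))\<^sup>2)"
    unfolding U(1) bresse_norm.simps
  proof (rule arg_cong[where f = sqrt], rule set_integral_L2_on)
    show "AE x in lborel. x \<notin> {0<..<L} \<longrightarrow> k1 * (cmod (rep_L2 (wd v1 + v3 + l *\<^sub>R v5) x))\<^sup>2 + \<rho>1 * (cmod (rep_L2 v2 x))\<^sup>2
      + k2 * (cmod (rep_L2 (wd v3) x))\<^sup>2 + \<rho>2 * (cmod (rep_L2 v4 x))\<^sup>2
      + k3 * (cmod (rep_L2 (wd v5 - l *\<^sub>R v1) x))\<^sup>2 + \<rho>1 * (cmod (rep_L2 v6 x))\<^sup>2 = 0"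
      using z[OF S] z[OF R] z[OF G] z[OF U(3)] z[OF U(5)] z[OF U(7)] by eventually_elim auto
  qed measurable
  also have "\<dots> = sqrt ((norm (J U))\<^sup>2)"
    unfolding U(1) norm_J_sq norm_L2_sq by simp
  finally show ?thesis by simp
qed

text \<open>The summand \<open>L / sqrt k2\<close> is the Poincare bound for \<open>v3\<close>; the
  rest is \<open>rotation_coercive\<close> for \<open>v1\<close> and \<open>v5\<close>, after
  \<open>v3\<close> has been moved out of the shear term. The sum serves all three
  components.\<close>

definition coer :: real where "coer = L / sqrt k2 + 2 * L * ((1 / sqrt k1 + L / sqrt k2) + 1 / sqrt k3)"

lemma coer_nonneg: "0 \<le> coer" using pos by (simp add: coer_def)

lemma norm_component_le:
  assumes "k * x\<^sup>2 \<le> y\<^sup>2" "0 < k" "0 \<le> y" shows "x \<le> (1 / sqrt k) * y"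
proof -
  have "(sqrt k * x)\<^sup>2 \<le> y\<^sup>2" using assms by (simp add: power_mult_distrib)
  then have "sqrt k * x \<le> y" using assms(3) by (rule power2_le_imp_le)
  then show ?thesis using assms(2) by (simp add: field_simps)
qed

lemma J_components:
  fixes v1 v2 v3 v4 v5 v6 defines "n \<equiv> norm (J (v1, v2, v3, v4, v5, v6))"
  shows "norm (wd v1 + v3 + l *\<^sub>R v5) \<le> (1 / sqrt k1) * n" "norm v2 \<le> (1 / sqrt \<rho>1) * n" "norm (wd v3) \<le> (1 / sqrt k2) * n"
    "norm v4 \<le> (1 / sqrt \<rho>2) * n" "norm (wd v5 - l *\<^sub>R v1) \<le> (1 / sqrt k3) * n" "norm v6 \<le> (1 / sqrt \<rho>1) * n"
proof -
  have nn: "0 \<le> k1 * (norm (wd v1 + v3 + l *\<^sub>R v5))\<^sup>2" "0 \<le> \<rho>1 * (norm v2)\<^sup>2" "0 \<le> k2 * (norm (wd v3))\<^sup>2"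
    "0 \<le> \<rho>2 * (norm v4)\<^sup>2" "0 \<le> k3 * (norm (wd v5 - l *\<^sub>R v1))\<^sup>2" "0 \<le> \<rho>1 * (norm v6)\<^sup>2"
    using pos by auto
  have e: "n\<^sup>2 = k1 * (norm (wd v1 + v3 + l *\<^sub>R v5))\<^sup>2 + \<rho>1 * (norm v2)\<^sup>2 + k2 * (norm (wd v3))\<^sup>2 + \<rho>2 * (norm v4)\<^sup>2
    + k3 * (norm (wd v5 - l *\<^sub>R v1))\<^sup>2 + \<rho>1 * (norm v6)\<^sup>2" and n0: "0 \<le> n"
    unfolding n_def by (rule norm_J_sq) simp
  show "norm (wd v1 + v3 + l *\<^sub>R v5) \<le> (1 / sqrt k1) * n" "norm v2 \<le> (1 / sqrt \<rho>1) * n" "norm (wd v3) \<le> (1 / sqrt k2) * n"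
    "norm v4 \<le> (1 / sqrt \<rho>2) * n" "norm (wd v5 - l *\<^sub>R v1) \<le> (1 / sqrt k3) * n" "norm v6 \<le> (1 / sqrt \<rho>1) * n"
    by (rule norm_component_le[OF _ _ n0]; use nn e pos in linarith)+
qed

lemma coercive:
  assumes "(v1, v2, v3, v4, v5, v6) \<in> X"
  defines "n \<equiv> norm (J (v1, v2, v3, v4, v5, v6))"
  shows "norm v1 \<le> coer * n" "norm v3 \<le> coer * n" "norm v5 \<le> coer * n"
proof -
  have v: "v1 \<in> H10 L" "v3 \<in> H10 L" "v5 \<in> H10 L" using assms(1) by (auto simp: X_iff)
  note c = J_components[where ?v1.0 = "v1" and ?v2.0 = "v2" and ?v3.0 = "v3" and ?v4.0 = "v4" and ?v5.0 = "v5" and ?v6.0 = "v6", folded n_def]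
  have n0: "0 \<le> n" by (simp add: n_def)
  have "norm v3 \<le> L * norm (wd v3)" using poincare[OF v(2) H10_weak_deriv[OF v(2)]] pos by simp
  also have "\<dots> \<le> L * ((1 / sqrt k2) * n)" using c(3) pos by (intro mult_left_mono) auto
  finally have v3: "norm v3 \<le> (L / sqrt k2) * n" by simp
  have "norm (wd v1 + l *\<^sub>R v5) \<le> norm (wd v1 + v3 + l *\<^sub>R v5) + norm v3"
    using norm_triangle_ineq4[of "wd v1 + v3 + l *\<^sub>R v5" v3] by (simp add: algebra_simps)
  then have F: "norm (wd v1 + l *\<^sub>R v5) \<le> (1 / sqrt k1 + L / sqrt k2) * n"
    using c(1) v3 by (simp add: distrib_right)
  have "2 * L * (norm (wd v1 + l *\<^sub>R v5) + norm (wd v5 - l *\<^sub>R v1))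
      \<le> 2 * L * (((1 / sqrt k1 + L / sqrt k2) + 1 / sqrt k3) * n)"
    using F c(5) pos by (intro mult_left_mono) (auto simp: distrib_right)
  also have "\<dots> \<le> coer * n"
  proof -
    have "2 * L * ((1 / sqrt k1 + L / sqrt k2) + 1 / sqrt k3) * n \<le> coer * n"
      using pos by (intro mult_right_mono n0) (simp add: coer_def)
    then show ?thesis by (simp add: mult.assoc)
  qed
  finally have le: "2 * L * (norm (wd v1 + l *\<^sub>R v5) + norm (wd v5 - l *\<^sub>R v1)) \<le> coer * n" .
  show "norm v1 \<le> coer * n" "norm v5 \<le> coer * n"
    using order_trans[OF rotation_coercive(1)[OF v(1) H10_weak_deriv[OF v(1)] v(3) H10_weak_deriv[OF v(3)]] le]
      order_trans[OF rotation_coercive(2)[OF v(1) H10_weak_deriv[OF v(1)] v(3) H10_weak_deriv[OF v(3)]] le] pos by auto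
  have "L / sqrt k2 \<le> coer" using pos by (simp add: coer_def)
  then show "norm v3 \<le> coer * n" using v3 mult_right_mono[OF _ n0] order_trans by blast
qed

lemma J_eq_0:
  assumes "U \<in> X" "J U = 0" shows "U = 0"
proof -
  obtain v1 v2 v3 v4 v5 v6 where U: "U = (v1, v2, v3, v4, v5, v6)" using prod_cases6 by metis
  have X: "(v1, v2, v3, v4, v5, v6) \<in> X" and J0: "J (v1, v2, v3, v4, v5, v6) = 0" using assms U by auto
  have "v1 = 0" "v3 = 0" "v5 = 0"
    using coercive[OF X] unfolding J0 by simp_all
  moreover have "v2 = 0" "v4 = 0" "v6 = 0"
    using J_components(2,4,6)[where ?v1.0 = v1 and ?v2.0 = v2 and ?v3.0 = v3 and ?v4.0 = v4 and ?v5.0 = v5 and ?v6.0 = v6] unfolding J0 by simp_all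
  ultimately show ?thesis by (simp add: U zero_prod_def)
qed

lemma inj_on_J: "inj_on J X"
proof (rule inj_onI)
  fix U V assume "U \<in> X" "V \<in> X" "J U = J V"
  then show "U = V" using J_eq_0[OF X_diff, of U V] by (simp add: J_diff)
qed

lemma subspace_JX: "subspace (J ` X)"
  unfolding subspace_def
proof (intro conjI ballI allI)
  have "J (0 - 0) = J 0 - J 0" by (rule J_diff[OF X_zero X_zero])
  then show "0 \<in> J ` X" using X_zero by (auto intro: image_eqI[of _ _ 0])
  show "x + y \<in> J ` X" if xy: "x \<in> J ` X" "y \<in> J ` X" for x y
  proof -
    obtain U V where "x = J U" "U \<in> X" "y = J V" "V \<in> X" using xy by blast
    then show ?thesis using X_add[of U V] J_add[of U V] by (auto intro: image_eqI[of _ _ "U + V"])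
  qed
  show "c *\<^sub>R x \<in> J ` X" if x: "x \<in> J ` X" for c x
  proof -
    obtain U where "x = J U" "U \<in> X" using x by blast
    then show ?thesis using X_scaleR[of U c] J_scaleR[of U c] by (auto intro: image_eqI[of _ _ "c *\<^sub>R U"])
  qed
qed

text \<open>By coercivity, convergent images have convergent components; the limits of the strain
  expressions identify the weak derivatives of the limit, and \<open>H10\<close> is closed under
  such convergence.\<close>

lemma closed_JX: "closed (J ` X)"
  unfolding closed_sequential_limits
proof (intro allI impI, elim conjE)
  fix h m assume h: "\<forall>n. h n \<in> J ` X" and m: "h \<longlonglongrightarrow> m"
  have "\<exists>U. U \<in> X \<and> h n = J U" for n using h by blast
  then obtain U where UX: "\<And>n. U n \<in> X" and hU: "\<And>n. h n = J (U n)" by metis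
  define v1 where "v1 n = fst (U n)" for n
  define v2 where "v2 n = fst (snd (U n))" for n
  define v3 where "v3 n = fst (snd (snd (U n)))" for n
  define v4 where "v4 n = fst (snd (snd (snd (U n))))" for n
  define v5 where "v5 n = fst (snd (snd (snd (snd (U n)))))" for n
  define v6 where "v6 n = snd (snd (snd (snd (snd (U n)))))" for n
  have U: "U n = (v1 n, v2 n, v3 n, v4 n, v5 n, v6 n)" for n
    by (simp add: v1_def v2_def v3_def v4_def v5_def v6_def)
  have vX: "v1 n \<in> H10 L" "v2 n \<in> L2_on L" "v3 n \<in> H10 L" "v4 n \<in> L2_on L" "v5 n \<in> H10 L" "v6 n \<in> L2_on L" for n
    using UX[of n] by (auto simp: U X_iff)
  have cJ: "convergent h" using m convergent_def by blast
  \<comment> \<open>\<open>convergent_if_dominated\<close> expects two controlling sequences; here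
    \<open>h\<close> takes both places.\<close>
  have le: "norm (a i - a j) \<le> K * norm (h i - h j) \<Longrightarrow> norm (a i - a j) \<le> K * (norm (h i - h j) + norm (h i - h j))"
    if "0 \<le> K" for a :: "nat \<Rightarrow> L2" and K i j using mult_nonneg_nonneg[OF that norm_ge_zero[of "h i - h j"]]
    by (simp add: distrib_left)
  have comp: "h i - h j = J (v1 i - v1 j, v2 i - v2 j, v3 i - v3 j, v4 i - v4 j, v5 i - v5 j, v6 i - v6 j)"
      "(v1 i - v1 j, v2 i - v2 j, v3 i - v3 j, v4 i - v4 j, v5 i - v5 j, v6 i - v6 j) \<in> X" for i j
    using J_diff[OF UX UX, of i j] X_diff[OF UX UX, of i j] by (simp_all add: hU U del: J.simps)
  note cm = J_components[where ?v1.0 = "v1 i - v1 j" and ?v2.0 = "v2 i - v2 j" and ?v3.0 = "v3 i - v3 j" and ?v4.0 = "v4 i - v4 j" and ?v5.0 = "v5 i - v5 j" and ?v6.0 = "v6 i - v6 j" for i j, folded comp(1)]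
  note co = coercive[OF comp(2), folded comp(1)]
  have wdd: "wd (v1 i - v1 j) = wd (v1 i) - wd (v1 j)" "wd (v3 i - v3 j) = wd (v3 i) - wd (v3 j)"
      "wd (v5 i - v5 j) = wd (v5 i) - wd (v5 j)" for i j
    by (rule weak_deriv_diff[OF H10_H1[OF vX(1)] H10_H1[OF vX(1)]] weak_deriv_diff[OF H10_H1[OF vX(3)] H10_H1[OF vX(3)]]
      weak_deriv_diff[OF H10_H1[OF vX(5)] H10_H1[OF vX(5)]])+
  have cv: "convergent v1" "convergent v3" "convergent v5"
    by (rule convergent_if_dominated[OF cJ cJ coer_nonneg], rule le[OF coer_nonneg], rule co)+
  have cv2: "convergent v2"
    by (rule convergent_if_dominated[OF cJ cJ, of "1 / sqrt \<rho>1"])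
      ((use pos in simp), (rule le, (use pos in simp), rule cm))
  have cv4: "convergent v4"
    by (rule convergent_if_dominated[OF cJ cJ, of "1 / sqrt \<rho>2"])
      ((use pos in simp), (rule le, (use pos in simp), rule cm))
  have cv6: "convergent v6"
    by (rule convergent_if_dominated[OF cJ cJ, of "1 / sqrt \<rho>1"])
      ((use pos in simp), (rule le, (use pos in simp), rule cm))
  have cR: "convergent (\<lambda>n. wd (v3 n))"
    by (rule convergent_if_dominated[OF cJ cJ, of "1 / sqrt k2"])
      ((use pos in simp), (rule le[where a = "\<lambda>n. wd (v3 n)"], (use pos in simp), (use cm(3) in \<open>simp add: wdd\<close>)))
  have cS: "convergent (\<lambda>n. wd (v1 n) + v3 n + l *\<^sub>R v5 n)"
  proof (rule convergent_if_dominated[OF cJ cJ, of "1 / sqrt k1"])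
    show "norm (wd (v1 i) + v3 i + l *\<^sub>R v5 i - (wd (v1 j) + v3 j + l *\<^sub>R v5 j)) \<le> 1 / sqrt k1 * (norm (h i - h j) + norm (h i - h j))" for i j
      by (rule le[where a = "\<lambda>n. wd (v1 n) + v3 n + l *\<^sub>R v5 n"])
        (use pos cm(1)[of i j] in \<open>simp_all add: wdd algebra_simps\<close>)
  qed (use pos in simp)
  have cG: "convergent (\<lambda>n. wd (v5 n) - l *\<^sub>R v1 n)"
  proof (rule convergent_if_dominated[OF cJ cJ, of "1 / sqrt k3"])
    show "norm (wd (v5 i) - l *\<^sub>R v1 i - (wd (v5 j) - l *\<^sub>R v1 j)) \<le> 1 / sqrt k3 * (norm (h i - h j) + norm (h i - h j))" for i j
      by (rule le[where a = "\<lambda>n. wd (v5 n) - l *\<^sub>R v1 n"])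
        (use pos cm(5)[of i j] in \<open>simp_all add: wdd algebra_simps\<close>)
  qed (use pos in simp)
  define a1 where "a1 = lim v1"
  define a2 where "a2 = lim v2"
  define a3 where "a3 = lim v3"
  define a4 where "a4 = lim v4"
  define a5 where "a5 = lim v5"
  define a6 where "a6 = lim v6"
  define b3 where "b3 = lim (\<lambda>n. wd (v3 n))"
  define s where "s = lim (\<lambda>n. wd (v1 n) + v3 n + l *\<^sub>R v5 n)"
  define g where "g = lim (\<lambda>n. wd (v5 n) - l *\<^sub>R v1 n)"
  have lim: "v1 \<longlonglongrightarrow> a1" "v2 \<longlonglongrightarrow> a2" "v3 \<longlonglongrightarrow> a3" "v4 \<longlonglongrightarrow> a4"
      "v5 \<longlonglongrightarrow> a5" "v6 \<longlonglongrightarrow> a6" "(\<lambda>n. wd (v3 n)) \<longlonglongrightarrow> b3" "(\<lambda>n. wd (v1 n) + v3 n + l *\<^sub>R v5 n) \<longlonglongrightarrow> s"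
      "(\<lambda>n. wd (v5 n) - l *\<^sub>R v1 n) \<longlonglongrightarrow> g"
    unfolding a1_def a2_def a3_def a4_def a5_def a6_def b3_def s_def g_def
    by (rule convergent_LIMSEQ_iff[THEN iffD1], rule cv cv2 cv4 cv6 cR cS cG)+
  \<comment> \<open>The derivative of \<open>v1\<close> is not itself a component of
    \<open>J\<close>; it is recovered from the shear once \<open>v3\<close> and \<open>v5\<close>
    converge.\<close>
  have b1: "(\<lambda>n. wd (v1 n)) \<longlonglongrightarrow> s - a3 - l *\<^sub>R a5"
    using tendsto_diff[OF tendsto_diff[OF lim(8) lim(3)] tendsto_scaleR[OF tendsto_const lim(5), of l]] by simp
  have b5: "(\<lambda>n. wd (v5 n)) \<longlonglongrightarrow> g + l *\<^sub>R a1"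
    using tendsto_add[OF lim(9) tendsto_scaleR[OF tendsto_const lim(1), of l]] by simp
  have d1: "has_weak_deriv L a1 (s - a3 - l *\<^sub>R a5)" "a1 \<in> H10 L"
    using has_weak_deriv_tendsto[OF H10_weak_deriv[OF vX(1)] lim(1) b1] H10_tendsto[OF vX(1) H10_weak_deriv[OF vX(1)] lim(1) b1] by auto
  have d3: "has_weak_deriv L a3 b3" "a3 \<in> H10 L"
    using has_weak_deriv_tendsto[OF H10_weak_deriv[OF vX(3)] lim(3,7)] H10_tendsto[OF vX(3) H10_weak_deriv[OF vX(3)] lim(3,7)] by auto
  have d5: "has_weak_deriv L a5 (g + l *\<^sub>R a1)" "a5 \<in> H10 L"
    using has_weak_deriv_tendsto[OF H10_weak_deriv[OF vX(5)] lim(5) b5] H10_tendsto[OF vX(5) H10_weak_deriv[OF vX(5)] lim(5) b5] by auto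
  have "(a1, a2, a3, a4, a5, a6) \<in> X"
    unfolding X_iff using d1(2) d3(2) d5(2) closed_sequentially[OF closed_L2_on vX(2) lim(2)]
      closed_sequentially[OF closed_L2_on vX(4) lim(4)] closed_sequentially[OF closed_L2_on vX(6) lim(6)] by simp
  moreover have "h \<longlonglongrightarrow> J (a1, a2, a3, a4, a5, a6)"
  proof -
    have "(\<lambda>n. J (U n)) \<longlonglongrightarrow> (sqrt k1 *\<^sub>R s, sqrt \<rho>1 *\<^sub>R a2, sqrt k2 *\<^sub>R b3, sqrt \<rho>2 *\<^sub>R a4, sqrt k3 *\<^sub>R g, sqrt \<rho>1 *\<^sub>R a6)"
      unfolding U J.simps by (intro tendsto_Pair tendsto_scaleR tendsto_const lim)
    moreover have "J (a1, a2, a3, a4, a5, a6) = (sqrt k1 *\<^sub>R s, sqrt \<rho>1 *\<^sub>R a2, sqrt k2 *\<^sub>R b3, sqrt \<rho>2 *\<^sub>R a4, sqrt k3 *\<^sub>R g, sqrt \<rho>1 *\<^sub>R a6)"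
      by (simp add: J.simps weak_deriv_eq[OF d1(1)] weak_deriv_eq[OF d3(1)] weak_deriv_eq[OF d5(1)])
    ultimately show ?thesis by (simp add: hU[abs_def])
  qed
  ultimately show "m \<in> J ` X" using LIMSEQ_unique[OF m] by blast
qed

end


section \<open>Strong stability of the Bresse semigroup\<close>

text \<open>On the damped interval the derivative of \<open>Gf\<close> gives
  \<open>c8 *\<^sub>R Sf x + c9 *\<^sub>R V5 x = 0\<close>; differentiating this again, with
  \<open>Gf\<close> gone, leaves \<open>c8 * c5 + c9 * l\<close> times \<open>V1\<close>. In the
  application \<open>Sf\<close>, \<open>Rf\<close>, \<open>Gf\<close> represent the shear,
  \<open>wd v3\<close> and the axial strain.\<close>

lemma bresse_ode_vanish:
  fixes V1 V3 V5 Sf Rf Gf :: "real \<Rightarrow> complex" and l c4 c5 c6 c7 c8 c9 :: real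
  assumes ab: "0 < \<alpha>" "\<alpha> < \<beta>" "\<beta> < L"
    and dV1: "\<And>x. x \<in> {0<..<L} \<Longrightarrow> (V1 has_vector_derivative (Sf x - V3 x - l *\<^sub>R V5 x)) (at x)"
    and dV3: "\<And>x. x \<in> {0<..<L} \<Longrightarrow> (V3 has_vector_derivative Rf x) (at x)"
    and dV5: "\<And>x. x \<in> {0<..<L} \<Longrightarrow> (V5 has_vector_derivative (Gf x + l *\<^sub>R V1 x)) (at x)"
    and dSf: "\<And>x. x \<in> {0<..<L} \<Longrightarrow> (Sf has_vector_derivative (c4 *\<^sub>R Gf x + c5 *\<^sub>R V1 x)) (at x)"
    and dRf: "\<And>x. x \<in> {0<..<L} \<Longrightarrow> (Rf has_vector_derivative (c6 *\<^sub>R Sf x + c7 *\<^sub>R V3 x)) (at x)"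
    and dGf: "\<And>x. x \<in> {0<..<L} \<Longrightarrow> (Gf has_vector_derivative (c8 *\<^sub>R Sf x + c9 *\<^sub>R V5 x)) (at x)"
    and nz: "c8 * c5 + c9 * l \<noteq> 0"
    and G0: "\<And>x. x \<in> {\<alpha><..<\<beta>} \<Longrightarrow> Gf x = 0"
    and cont: "continuous_on {0..L} V1" "continuous_on {0..L} V3" "continuous_on {0..L} V5"
    and V30: "V3 0 = 0" and V50: "V5 0 = 0" and x: "x \<in> {0..L}"
  shows "V1 x = 0" "V3 x = 0" "V5 x = 0"
proof -
  have sub: "x \<in> {0<..<L}" if "x \<in> {\<alpha><..<\<beta>}" for x using that ab by auto
  have e1: "c8 *\<^sub>R Sf x + c9 *\<^sub>R V5 x = 0" if "x \<in> {\<alpha><..<\<beta>}" for x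
    by (rule vector_derivative_zero[OF dGf[OF sub[OF that]] G0 that])
  have V1_0: "V1 x = 0" if x: "x \<in> {\<alpha><..<\<beta>}" for x
  proof -
    have "((\<lambda>x. c8 *\<^sub>R Sf x + c9 *\<^sub>R V5 x) has_vector_derivative
        c8 *\<^sub>R (c4 *\<^sub>R Gf x + c5 *\<^sub>R V1 x) + c9 *\<^sub>R (Gf x + l *\<^sub>R V1 x)) (at x)"
      by (intro has_vector_derivative_add bounded_linear.has_vector_derivative[OF bounded_linear_scaleR_right]
          dSf dV5 sub[OF x])
    from vector_derivative_zero[OF this e1 x] have "(c8 * c5 + c9 * l) *\<^sub>R V1 x = 0"
      using G0[OF x] by (simp add: scaleR_add_left)
    then show ?thesis using nz by simp
  qed
  have e2: "Sf x - V3 x - l *\<^sub>R V5 x = 0" if "x \<in> {\<alpha><..<\<beta>}" for x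
    by (rule vector_derivative_zero[OF dV1[OF sub[OF that]] V1_0 that])
  \<comment> \<open>Differentiating \<open>e2\<close> leaves only \<open>Rf\<close>, as
    \<open>Gf\<close> and \<open>V1\<close> are already 0.\<close>
  have R0: "Rf x = 0" if x: "x \<in> {\<alpha><..<\<beta>}" for x
  proof -
    have "((\<lambda>x. Sf x - V3 x - l *\<^sub>R V5 x) has_vector_derivative
        (c4 *\<^sub>R Gf x + c5 *\<^sub>R V1 x) - Rf x - l *\<^sub>R (Gf x + l *\<^sub>R V1 x)) (at x)"
      by (intro has_vector_derivative_diff bounded_linear.has_vector_derivative[OF bounded_linear_scaleR_right]
          dSf dV5 dV3 sub[OF x])
    from vector_derivative_zero[OF this e2 x] show ?thesis using G0[OF x] V1_0[OF x] by simp
  qed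
  have e3: "c6 *\<^sub>R Sf x + c7 *\<^sub>R V3 x = 0" if "x \<in> {\<alpha><..<\<beta>}" for x
    by (rule vector_derivative_zero[OF dRf[OF sub[OF that]] R0 that])
  define x0 where "x0 = (\<alpha> + \<beta>) / 2"
  have x0: "x0 \<in> {\<alpha><..<\<beta>}" using ab by (simp add: x0_def)
  define a b s where "a = V3 x0" and "b = V5 x0" and "s = Sf x0"
  have abs: "s = a + l *\<^sub>R b" "c6 *\<^sub>R s + c7 *\<^sub>R a = 0" "c8 *\<^sub>R s + c9 *\<^sub>R b = 0"
    using e1[OF x0] e2[OF x0] e3[OF x0] by (simp_all add: a_def b_def s_def algebra_simps)
  \<comment> \<open>The coefficient operator of the first-order system. By \<open>abs\<close> the
    values at \<open>x0\<close> form an equilibrium, so the deviation \<open>y\<close> from it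
    solves the same linear system and vanishes at \<open>x0\<close>.\<close>
  define M :: "complex \<times> complex \<times> complex \<times> complex \<times> complex \<times> complex \<Rightarrow>
      complex \<times> complex \<times> complex \<times> complex \<times> complex \<times> complex"
    where "M = (\<lambda>(p1, p3, p5, pS, pR, pG). (pS - p3 - l *\<^sub>R p5, pR, pG + l *\<^sub>R p1,
      c4 *\<^sub>R pG + c5 *\<^sub>R p1, c6 *\<^sub>R pS + c7 *\<^sub>R p3, c8 *\<^sub>R pS + c9 *\<^sub>R p5))"
  have "linear M"
    by (rule linearI) (auto simp: M_def algebra_simps)
  then have bl: "bounded_linear M" by (simp add: linear_conv_bounded_linear)
  define y where "y x = (V1 x, V3 x - a, V5 x - b, Sf x - s, Rf x, Gf x)" for x
  have y0: "y z = 0" if z: "z \<in> {0<..<L}" for z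
  proof (rule linear_ode_zero[of 0 L y "\<lambda>x. M (y x)" "onorm M" x0])
    fix x assume x: "x \<in> {0<..<L}"
    have c: "((\<lambda>x. f x - c) has_vector_derivative f') (at x)" if "(f has_vector_derivative f') (at x)" for f :: "real \<Rightarrow> complex" and f' c
      using has_vector_derivative_diff[OF that has_vector_derivative_const[of c]] by simp
    have "(y has_vector_derivative (Sf x - V3 x - l *\<^sub>R V5 x, Rf x, Gf x + l *\<^sub>R V1 x, c4 *\<^sub>R Gf x + c5 *\<^sub>R V1 x,
        c6 *\<^sub>R Sf x + c7 *\<^sub>R V3 x, c8 *\<^sub>R Sf x + c9 *\<^sub>R V5 x)) (at x)"
      unfolding y_def[abs_def] by (intro has_vector_derivative_Pair c dV1 dV3 dV5 dSf dRf dGf x)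
    moreover have "M (y x) = (Sf x - V3 x - l *\<^sub>R V5 x, Rf x, Gf x + l *\<^sub>R V1 x, c4 *\<^sub>R Gf x + c5 *\<^sub>R V1 x,
        c6 *\<^sub>R Sf x + c7 *\<^sub>R V3 x, c8 *\<^sub>R Sf x + c9 *\<^sub>R V5 x)"
    proof -
      have "c6 *\<^sub>R (Sf x - s) + c7 *\<^sub>R (V3 x - a) = (c6 *\<^sub>R Sf x + c7 *\<^sub>R V3 x) - (c6 *\<^sub>R s + c7 *\<^sub>R a)"
        "c8 *\<^sub>R (Sf x - s) + c9 *\<^sub>R (V5 x - b) = (c8 *\<^sub>R Sf x + c9 *\<^sub>R V5 x) - (c8 *\<^sub>R s + c9 *\<^sub>R b)"
        "(Sf x - s) - (V3 x - a) - l *\<^sub>R (V5 x - b) = (Sf x - V3 x - l *\<^sub>R V5 x) - (s - (a + l *\<^sub>R b))"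
        by (simp_all add: algebra_simps)
      then show ?thesis using abs by (simp add: M_def y_def)
    qed
    ultimately show "(y has_vector_derivative M (y x)) (at x)" by simp
    show "norm (M (y x)) \<le> onorm M * norm (y x)" by (rule onorm[OF bl])
  next
    show "x0 \<in> {0<..<L}" using sub[OF x0] .
    show "y x0 = 0" using V1_0[OF x0] R0[OF x0] G0[OF x0] by (simp add: y_def a_def b_def s_def zero_prod_def)
  qed (rule z)
  have L: "0 < L" using ab by simp
  have cl: "closure {0<..<L} = {0..L}" using L by simp
  have ext: "f x = c" if "continuous_on {0..L} f" "\<And>z. z \<in> {0<..<L} \<Longrightarrow> f z = c" "x \<in> {0..L}" for f :: "real \<Rightarrow> complex" and c x
    by (rule continuous_constant_on_closure[of "{0<..<L}" f c]) (use that cl in auto)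
  have all: "V1 x = 0" "V3 x = a" "V5 x = b" if "x \<in> {0..L}" for x
    by (rule ext[OF cont(1) _ that] ext[OF cont(2) _ that] ext[OF cont(3) _ that],
      use y0 in \<open>simp add: y_def zero_prod_def\<close>)+
  have "a = 0" "b = 0" using all[of 0] V30 V50 L by auto
  then show "V1 x = 0" "V3 x = 0" "V5 x = 0" using all[OF x] by auto
qed

lemma emb_scaleR:
  assumes "continuous_on {0..L} f" shows "r *\<^sub>R emb L f = emb L (\<lambda>x. r *\<^sub>R f x)"
proof -
  have "r *\<^sub>R emb L f = abs_L2 (\<lambda>x. of_real r * (indicator {0..L} x *\<^sub>R f x))"
    unfolding emb_def scaleR_scaleC by (rule abs_L2_scaleC[OF sq_integrable_continuous[OF assms]])
  then show ?thesis by (simp add: emb_def scaleR_conv_of_real mult.left_commute)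
qed

lemma emb_diff:
  assumes "continuous_on {0..L} f" "continuous_on {0..L} g"
  shows "emb L f - emb L g = emb L (\<lambda>x. f x - g x)"
proof -
  have "emb L f + - emb L g = emb L (\<lambda>x. f x + - g x)"
    using emb_add[OF assms(1) continuous_on_minus[OF assms(2)]] emb_scaleR[OF assms(2), of "-1"] by simp
  then show ?thesis by simp
qed

lemma (in bounded_multiplier) inner_fn_mult: "inner (d \<odot> u) v = inner u (d \<odot> v)"
proof -
  have "(LBINT x. rep_L2 (d \<odot> u) x * cnj (rep_L2 v x)) = (LBINT x. rep_L2 u x * cnj (rep_L2 (d \<odot> v) x))"
  proof (rule integral_cong_AE)
    show "AE x in lborel. rep_L2 (d \<odot> u) x * cnj (rep_L2 v x) = rep_L2 u x * cnj (rep_L2 (d \<odot> v) x)"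
      using rep_fn_mult[of u] rep_fn_mult[of v] by eventually_elim simp
  qed measurable
  then show ?thesis by (simp add: inner_L2_def)
qed

lemma scaleC_zero_right [simp]: "c *\<^sub>C (0 :: L2) = 0"
  using norm_scaleC[of c 0] by simp

context bresse begin

sublocale dm: bounded_multiplier d d0
proof
  show "d \<in> borel_measurable borel" unfolding damping_def by measurable
  show "\<bar>d x\<bar> \<le> d0" for x using damped by (simp add: damping_def)
qed

text \<open>\<open>d\<close> takes only the values 0 and \<open>d0\<close>, so d^2 = d0 d. The
  dissipation therefore controls the full norm of the damping term.\<close>

lemma norm_damping_sq: "(norm (d \<odot> z))\<^sup>2 = d0 * inner (d \<odot> z) z"
proof -
  have "d \<odot> d \<odot> z = d0 *\<^sub>R (d \<odot> z)"
    unfolding L2_eq_iff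
    using dm.rep_fn_mult[of z] dm.rep_fn_mult[of "d \<odot> z"] rep_L2_scaleR[of d0 "d \<odot> z"]
    by eventually_elim (simp add: damping_def)
  then have "inner (d \<odot> z) (d \<odot> z) = d0 * inner z (d \<odot> z)" using dm.inner_fn_mult[of z "d \<odot> z"] by simp
  then show ?thesis by (simp add: power2_norm_eq_inner inner_commute)
qed

abbreviation "shear v1 v3 v5 \<equiv> wd v1 + v3 + l *\<^sub>R v5"
abbreviation "damp v2 v6 \<equiv> d \<odot> (wd v6 - l *\<^sub>R v2)"
abbreviation "flux v1 v2 v5 v6 \<equiv> k3 *\<^sub>R (wd v5 - l *\<^sub>R v1) + damp v2 v6"

text \<open>The domain asks for regularity without the term \<open>l *\<^sub>R v1\<close>, while the
  operator differentiates the full flux; the discrepancy lies in H^1 because \<open>v1\<close>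
  does.\<close>

lemma Dom_D:
  assumes "(v1, v2, v3, v4, v5, v6) \<in> Dom"
  shows "v1 \<in> H10 L" "v2 \<in> H10 L" "v3 \<in> H10 L" "v4 \<in> H10 L" "v5 \<in> H10 L" "v6 \<in> H10 L"
    and "shear v1 v3 v5 \<in> H1 L" "wd v3 \<in> H1 L" "flux v1 v2 v5 v6 \<in> H1 L"
proof -
  have *: "(v1, v2, v3, v4, v5, v6) \<in> X" "wd v1 \<in> H1 L" "wd v3 \<in> H1 L" "v2 \<in> H10 L" "v4 \<in> H10 L" "v6 \<in> H10 L"
    "k3 *\<^sub>R wd v5 + damp v2 v6 \<in> H1 L"
    using assms by (auto simp: bresse_dom_def H2_def)
  show v: "v1 \<in> H10 L" "v2 \<in> H10 L" "v3 \<in> H10 L" "v4 \<in> H10 L" "v5 \<in> H10 L" "v6 \<in> H10 L"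
    using * by (auto simp: X_iff)
  show "shear v1 v3 v5 \<in> H1 L" by (intro H1_add H1_scaleR * H10_H1 v)
  show "wd v3 \<in> H1 L" by (rule *)
  have "(k3 *\<^sub>R wd v5 + damp v2 v6) - k3 *\<^sub>R l *\<^sub>R v1 \<in> H1 L"
    by (intro H1_diff H1_scaleR *(7) H10_H1 v)
  then show "flux v1 v2 v5 v6 \<in> H1 L" by (simp add: algebra_simps)
qed

text \<open>Three integrations by parts without boundary terms. The axial and damping terms of the
  second component combine to \<open>l / \<rho>1\<close> times the flux, so one flux enters two
  equations. Tested with the velocities it gives the dissipation, with the positions the case of
  eigenvalue 0.\<close>

lemma weak_form:
  assumes U: "(v1, v2, v3, v4, v5, v6) \<in> Dom" and f: "f1 \<in> H10 L" "f3 \<in> H10 L" "f5 \<in> H10 L"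
    and AU: "A (v1, v2, v3, v4, v5, v6) = (a1, a2, a3, a4, a5, a6)"
  shows "\<rho>1 * inner a2 f1 + \<rho>2 * inner a4 f3 + \<rho>1 * inner a6 f5
    = - (k1 * inner (shear v1 v3 v5) (shear f1 f3 f5) + k2 * inner (wd v3) (wd f3)
      + inner (flux v1 v2 v5 v6) (wd f5 - l *\<^sub>R f1))"
proof -
  define S R Q where "S = shear v1 v3 v5" and "R = wd v3" and "Q = flux v1 v2 v5 v6"
  have ibp: "inner (wd u) g = - inner u (wd g)" if "u \<in> H1 L" "g \<in> H10 L" for u g
    using integration_by_parts_H10[of L u "wd u" g "wd g"] that H10_weak_deriv by (simp add: H1_iff)
  have D: "S \<in> H1 L" "R \<in> H1 L" "Q \<in> H1 L"
    using Dom_D[OF U] by (simp_all add: S_def R_def Q_def)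
  have a: "a2 = (k1 / \<rho>1) *\<^sub>R wd S + (l / \<rho>1) *\<^sub>R Q" "a4 = (k2 / \<rho>2) *\<^sub>R wd R - (k1 / \<rho>2) *\<^sub>R S"
    "a6 = (1 / \<rho>1) *\<^sub>R wd Q - (l * k1 / \<rho>1) *\<^sub>R S"
    using AU by (auto simp: S_def R_def Q_def scaleR_add_right)
  have "\<rho>1 * inner a2 f1 = k1 * inner (wd S) f1 + l * inner Q f1"
    "\<rho>2 * inner a4 f3 = k2 * inner (wd R) f3 - k1 * inner S f3"
    "\<rho>1 * inner a6 f5 = inner (wd Q) f5 - l * k1 * inner S f5"
    unfolding a using pos by (simp_all add: inner_add_left inner_diff_left right_diff_distrib distrib_left)
  then show ?thesis
    unfolding S_def[symmetric] R_def[symmetric] Q_def[symmetric]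
      ibp[OF D(1) f(1)] ibp[OF D(2) f(2)] ibp[OF D(3) f(3)]
    by (simp add: inner_add_right inner_diff_right algebra_simps)
qed

text \<open>Tested with the velocities, the elastic part of the weak form cancels against the strain
  terms of the energy product, and only the damping part of the flux is left.\<close>

lemma dissipation:
  assumes U: "(v1, v2, v3, v4, v5, v6) \<in> Dom"
  shows "inner (J (A (v1, v2, v3, v4, v5, v6))) (J (v1, v2, v3, v4, v5, v6)) = - inner (damp v2 v6) (wd v6 - l *\<^sub>R v2)"
proof -
  obtain a2 a4 a6 where AU: "A (v1, v2, v3, v4, v5, v6) = (v2, a2, v4, a4, v6, a6)" by simp
  show ?thesis
    using weak_form[OF U Dom_D(2,4,6)[OF U] AU] unfolding AU inner_J
    by (simp add: inner_add_left inner_commute[of _ "wd v1 + v3 + l *\<^sub>R v5"] inner_commute[of "wd v4"]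
        inner_commute[of "wd v6 - l *\<^sub>R v2" "wd v5 - l *\<^sub>R v1"] del: bresse_op.simps)
qed

text \<open>A bound on \<open>A U\<close> bounds the weak derivatives of the velocities through the
  strains of its position components, and those of \<open>S\<close>, \<open>R\<close>,
  \<open>Q\<close> through its velocity components, so Rellich covers all of these. \<open>G\<close>
  is not covered directly and is recovered from \<open>Q\<close>.\<close>

lemma compactness:
  assumes U: "\<And>n. U n \<in> Dom" and bJ: "bounded (range (\<lambda>n. J (U n)))" and bJA: "bounded (range (\<lambda>n. J (A (U n))))"
    and lim: "(\<lambda>n. inner (J (A (U n))) (J (U n))) \<longlonglongrightarrow> 0"
  shows "seq_precompact (\<lambda>n. J (U n))"
proof -
  define v1 where "v1 n = fst (U n)" for n
  define v2 where "v2 n = fst (snd (U n))" for n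
  define v3 where "v3 n = fst (snd (snd (U n)))" for n
  define v4 where "v4 n = fst (snd (snd (snd (U n))))" for n
  define v5 where "v5 n = fst (snd (snd (snd (snd (U n)))))" for n
  define v6 where "v6 n = snd (snd (snd (snd (snd (U n)))))" for n
  have Un: "U n = (v1 n, v2 n, v3 n, v4 n, v5 n, v6 n)" for n
    by (simp add: v1_def v2_def v3_def v4_def v5_def v6_def)
  have D: "(v1 n, v2 n, v3 n, v4 n, v5 n, v6 n) \<in> Dom" for n using U[of n] by (simp only: Un)
  define S R G \<Theta> Q where "S n = shear (v1 n) (v3 n) (v5 n)" and "R n = wd (v3 n)" and "G n = wd (v5 n) - l *\<^sub>R v1 n"
    and "\<Theta> n = damp (v2 n) (v6 n)" and "Q n = flux (v1 n) (v2 n) (v5 n) (v6 n)" for n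
  define a2 where "a2 n = (k1 / \<rho>1) *\<^sub>R wd (S n) + (l * k3 / \<rho>1) *\<^sub>R G n + (l / \<rho>1) *\<^sub>R \<Theta> n" for n
  define a4 where "a4 n = (k2 / \<rho>2) *\<^sub>R wd (R n) - (k1 / \<rho>2) *\<^sub>R S n" for n
  define a6 where "a6 n = (1 / \<rho>1) *\<^sub>R wd (Q n) - (l * k1 / \<rho>1) *\<^sub>R S n" for n
  have AUn: "A (U n) = (v2 n, a2 n, v4 n, a4 n, v6 n, a6 n)" for n
    by (simp add: Un a2_def a4_def a6_def S_def R_def G_def \<Theta>_def Q_def)
  note cJ = J_components[where ?v1.0 = "v1 n" and ?v2.0 = "v2 n" and ?v3.0 = "v3 n" and ?v4.0 = "v4 n" and ?v5.0 = "v5 n" and ?v6.0 = "v6 n" for n,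
      folded Un S_def R_def G_def]
  note cA = J_components[where ?v1.0 = "v2 n" and ?v2.0 = "a2 n" and ?v3.0 = "v4 n" and ?v4.0 = "a4 n" and ?v5.0 = "v6 n" and ?v6.0 = "a6 n" for n,
      folded AUn]
  have s0: "0 \<le> 1 / sqrt k1" "0 \<le> 1 / sqrt k2" "0 \<le> 1 / sqrt k3" "0 \<le> 1 / sqrt \<rho>1" "0 \<le> 1 / sqrt \<rho>2" using pos by auto
  have bS: "bounded (range S)" and bv2: "bounded (range v2)" and bR: "bounded (range R)" and bv4: "bounded (range v4)"
    and bG: "bounded (range G)" and bv6: "bounded (range v6)"
    by (rule bounded_range_mono[OF bJ], rule cJ, rule s0)+
  have bAS: "bounded (range (\<lambda>n. shear (v2 n) (v4 n) (v6 n)))" and ba2: "bounded (range a2)"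
    and bw4: "bounded (range (\<lambda>n. wd (v4 n)))" and ba4: "bounded (range a4)"
    and bz: "bounded (range (\<lambda>n. wd (v6 n) - l *\<^sub>R v2 n))" and ba6: "bounded (range a6)"
    by (rule bounded_range_mono[OF bJA], rule cA, rule s0)+
  note br = bounded_plus_comp bounded_minus_comp bounded_scaleR_comp
  \<comment> \<open>The strain bounds mix derivatives with lower-order terms, which are bounded
    already because they are velocities.\<close>
  have "bounded (range (\<lambda>n. shear (v2 n) (v4 n) (v6 n) - v4 n - l *\<^sub>R v6 n))"
    by (intro br bAS bv4 bv6)
  then have bw2: "bounded (range (\<lambda>n. wd (v2 n)))" by simp
  have "bounded (range (\<lambda>n. (wd (v6 n) - l *\<^sub>R v2 n) + l *\<^sub>R v2 n))"
    by (intro br bz bv2)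
  then have bw6: "bounded (range (\<lambda>n. wd (v6 n)))" by simp
  have b\<Theta>: "bounded (range \<Theta>)"
    unfolding \<Theta>_def by (rule bounded_range_mono[OF bz dm.norm_fn_mult_le dm.M_nonneg])
  have "bounded (range (\<lambda>n. (\<rho>1 / k1) *\<^sub>R (a2 n - (l * k3 / \<rho>1) *\<^sub>R G n - (l / \<rho>1) *\<^sub>R \<Theta> n)))"
    by (intro br ba2 bG b\<Theta>)
  then have bwS: "bounded (range (\<lambda>n. wd (S n)))" using pos by (simp add: a2_def)
  have "bounded (range (\<lambda>n. (\<rho>2 / k2) *\<^sub>R (a4 n + (k1 / \<rho>2) *\<^sub>R S n)))"
    by (intro br ba4 bS)
  then have bwR: "bounded (range (\<lambda>n. wd (R n)))" using pos by (simp add: a4_def)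
  have "bounded (range (\<lambda>n. \<rho>1 *\<^sub>R (a6 n + (l * k1 / \<rho>1) *\<^sub>R S n)))"
    by (intro br ba6 bS)
  then have bwQ: "bounded (range (\<lambda>n. wd (Q n)))" using pos by (simp add: a6_def)
  have Q_eq: "Q n = k3 *\<^sub>R G n + \<Theta> n" for n by (simp add: Q_def G_def \<Theta>_def)
  have bQ: "bounded (range Q)" unfolding Q_eq[abs_def] by (intro br bG b\<Theta>)
  have H1: "has_weak_deriv L (S n) (wd (S n))" "has_weak_deriv L (R n) (wd (R n))" "has_weak_deriv L (Q n) (wd (Q n))"
      "has_weak_deriv L (v2 n) (wd (v2 n))" "has_weak_deriv L (v4 n) (wd (v4 n))" "has_weak_deriv L (v6 n) (wd (v6 n))" for n
    using Dom_D[OF D[of n]] by (simp_all add: H10_H1 H1_iff[symmetric] S_def R_def Q_def)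
  note rel = seq_precompact_rellich[OF pos(7)]
  have "\<Theta> \<longlonglongrightarrow> 0"
  proof -
    have "(norm (\<Theta> n))\<^sup>2 = d0 * - inner (J (A (U n))) (J (U n))" for n
      using dissipation[OF D[of n]] norm_damping_sq[of "wd (v6 n) - l *\<^sub>R v2 n"]
      by (simp add: \<Theta>_def Un del: bresse_op.simps)
    moreover have "(\<lambda>n. d0 * - inner (J (A (U n))) (J (U n))) \<longlonglongrightarrow> d0 * - 0"
      by (intro tendsto_mult tendsto_const tendsto_minus lim)
    ultimately have "(\<lambda>n. (norm (\<Theta> n))\<^sup>2) \<longlonglongrightarrow> 0" by simp
    then have "(\<lambda>n. sqrt ((norm (\<Theta> n))\<^sup>2)) \<longlonglongrightarrow> sqrt 0" by (rule tendsto_real_sqrt)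
    then show ?thesis by (simp add: tendsto_norm_zero_iff)
  qed
  \<comment> \<open>\<open>G\<close> is \<open>(Q - \<Theta>) / k3\<close>: a relatively compact
    sequence minus one that converges to 0.\<close>
  then have "seq_precompact (\<lambda>n. (1 / k3) *\<^sub>R (Q n - \<Theta> n))"
    by (intro seq_precompact_scaleR seq_precompact_diff seq_precompact_LIMSEQ rel[OF H1(3) bQ bwQ])
  then have G: "seq_precompact G" using pos by (simp add: Q_eq)
  show ?thesis
    unfolding Un J.simps S_def[symmetric] R_def[symmetric] G_def[symmetric]
    by (intro seq_precompact_Pair seq_precompact_scaleR G rel[OF H1(1) bS bwS] rel[OF H1(2) bR bwR]
        rel[OF H1(4) bv2 bw2] rel[OF H1(5) bv4 bw4] rel[OF H1(6) bv6 bw6])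
qed

lemma Dom_X:
  assumes "U \<in> Dom" shows "U \<in> X"
  using assms by (auto simp: bresse_dom_def)

text \<open>The damping term vanishes for such an eigenvector, so the flux reduces to
  \<open>k3 *\<^sub>R G\<close>; this gives \<open>G\<close> the H^1 regularity that the domain
  alone does not, and leaves a linear system with constant coefficients.\<close>

lemma no_imaginary_eigenvector:
  assumes U: "U \<in> Dom" and ev: "A U = Complex 0 \<omega> *\<^sub>C U"
  shows "U = 0"
proof -
  obtain v1 v2 v3 v4 v5 v6 where Ut: "U = (v1, v2, v3, v4, v5, v6)" using prod_cases6 by metis
  note D = Dom_D[OF U[unfolded Ut]]
  have UX: "U \<in> X" using Dom_X[OF U] .
  define S R G \<Theta> Q where "S = shear v1 v3 v5" and "R = wd v3" and "G = wd v5 - l *\<^sub>R v1"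
    and "\<Theta> = damp v2 v6" and "Q = flux v1 v2 v5 v6"
  have "inner (J (A U)) (J U) = 0"
  proof -
    have "J (A U) = \<omega> *\<^sub>R (\<i> *\<^sub>C J U)"
      using J_scaleC[OF UX, of "Complex 0 \<omega>"] scaleC_Complex[of 0 \<omega> "J U"] ev by simp
    then show ?thesis by (simp add: inner_ii_scaleC_state)
  qed
  then have "(norm \<Theta>)\<^sup>2 = 0"
    using dissipation[OF U[unfolded Ut]] norm_damping_sq[of "wd v6 - l *\<^sub>R v2"]
    by (simp add: \<Theta>_def Ut del: bresse_op.simps)
  then have \<Theta>0: "\<Theta> = 0" by simp
  have QG: "Q = k3 *\<^sub>R G" using \<Theta>0 by (simp add: Q_def G_def \<Theta>_def)
  define c where "c = Complex 0 \<omega>"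
  have comp: "v2 = c *\<^sub>C v1" "v4 = c *\<^sub>C v3" "v6 = c *\<^sub>C v5"
    and eqs: "(k1 / \<rho>1) *\<^sub>R wd S + (l * k3 / \<rho>1) *\<^sub>R G + (l / \<rho>1) *\<^sub>R \<Theta> = c *\<^sub>C v2"
      "(k2 / \<rho>2) *\<^sub>R wd R - (k1 / \<rho>2) *\<^sub>R S = c *\<^sub>C v4" "(1 / \<rho>1) *\<^sub>R wd Q - (l * k1 / \<rho>1) *\<^sub>R S = c *\<^sub>C v6"
    using ev unfolding c_def[symmetric] Ut S_def R_def G_def \<Theta>_def Q_def
      bresse_op.simps scaleC_prod_def fst_conv snd_conv prod.inject by blast+
  show ?thesis
  proof (cases "\<omega> = 0")
    case True
    have c0: "c *\<^sub>C x = 0" for x :: L2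
      using norm_scaleC[of c x] True by (simp add: c_def complex_norm)
    have AU: "A (v1, v2, v3, v4, v5, v6) = (0, 0, 0, 0, 0, 0)"
      using ev unfolding c_def[symmetric] Ut by (simp add: scaleC_prod_def c0 del: bresse_op.simps)
    \<comment> \<open>A stationary state tested with its own positions has zero elastic energy. This
      case is separate because the coefficient of \<open>V1\<close> below is proportional to
      \<open>\<omega>\<^sup>2\<close>.\<close>
    have "k1 * (norm S)\<^sup>2 + k2 * (norm R)\<^sup>2 + k3 * (norm G)\<^sup>2 = 0"
      using weak_form[OF U[unfolded Ut] D(1,3,5) AU]
      unfolding S_def[symmetric] R_def[symmetric] G_def[symmetric] \<Theta>_def[symmetric]
      by (simp add: \<Theta>0 power2_norm_eq_inner)
    moreover have "v2 = 0" "v4 = 0" "v6 = 0" using comp c0 by auto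
    ultimately have "(norm (J U))\<^sup>2 = 0"
      unfolding Ut norm_J_sq S_def[symmetric] R_def[symmetric] G_def[symmetric] by simp
    then show ?thesis using J_eq_0[OF UX] by simp
  next
    case False
    have cc: "c *\<^sub>C c *\<^sub>C x = (- (\<omega>\<^sup>2)) *\<^sub>R x" for x :: L2
    proof -
      have "c * c = of_real (- (\<omega>\<^sup>2))" by (simp add: c_def complex_eq_iff power2_eq_square)
      then show ?thesis by (simp add: scaleC_scaleC scaleR_scaleC)
    qed
    \<comment> \<open>Continuous representatives: all weak derivatives of the system turn out to be
      classes of continuous functions, so the equations hold pointwise.\<close>
    define V1 V3 V5 where "V1 = prim (wd v1)" and "V3 = prim (wd v3)" and "V5 = prim (wd v5)"
    note L = pos(7)
    have rep: "v1 = emb L V1" "v3 = emb L V3" "v5 = emb L V5"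
      unfolding V1_def V3_def V5_def by (rule H10_repr(1)[OF _ H10_weak_deriv L], rule D, rule D)+
    obtain cS where S_emb: "S = emb L (\<lambda>x. cS + prim (wd S) x)"
      using H1_repr[OF _ L, of S "wd S"] D(7) unfolding S_def[symmetric] H1_iff by metis
    obtain cR where R_emb: "R = emb L (\<lambda>x. cR + prim (wd R) x)"
      using H1_repr[OF _ L, of R "wd R"] D(8) unfolding R_def[symmetric] H1_iff by metis
    have GH: "G \<in> H1 L"
    proof -
      have "(1 / k3) *\<^sub>R Q \<in> H1 L" using D(9) by (intro H1_scaleR) (simp add: Q_def)
      then show ?thesis using QG pos by simp
    qed
    obtain cG where G_emb: "G = emb L (\<lambda>x. cG + prim (wd G) x)"
      using H1_repr[OF _ L, of G "wd G"] GH unfolding H1_iff by metis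
    define Sf Rf Gf where "Sf x = cS + prim (wd S) x" and "Rf x = cR + prim (wd R) x" and "Gf x = cG + prim (wd G) x" for x
    have emb: "S = emb L Sf" "R = emb L Rf" "G = emb L Gf"
      using S_emb R_emb G_emb by (simp_all add: Sf_def[abs_def] Rf_def[abs_def] Gf_def[abs_def])
    have cont: "continuous_on {0..L} V1" "continuous_on {0..L} V3" "continuous_on {0..L} V5"
        "continuous_on {0..L} Sf" "continuous_on {0..L} Rf" "continuous_on {0..L} Gf"
      unfolding V1_def V3_def V5_def Sf_def[abs_def] Rf_def[abs_def] Gf_def[abs_def]
      by (intro continuous_on_add continuous_on_const continuous_prim_Icc)+
    have w1: "wd v1 = emb L (\<lambda>x. Sf x - V3 x - l *\<^sub>R V5 x)"
    proof -
      have "wd v1 = S - v3 - l *\<^sub>R v5" by (simp add: S_def)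
      also have "\<dots> = emb L Sf - emb L V3 - l *\<^sub>R emb L V5" by (simp only: emb rep[symmetric])
      also have "\<dots> = emb L (\<lambda>x. Sf x - V3 x - l *\<^sub>R V5 x)"
        using cont by (simp add: emb_diff emb_scaleR continuous_on_diff continuous_on_scaleR)
      finally show ?thesis .
    qed
    have w3: "wd v3 = emb L Rf" using emb(2) by (simp add: R_def)
    have w5: "wd v5 = emb L (\<lambda>x. Gf x + l *\<^sub>R V1 x)"
    proof -
      have "wd v5 = G + l *\<^sub>R v1" by (simp add: G_def)
      also have "\<dots> = emb L Gf + l *\<^sub>R emb L V1" by (simp only: emb rep[symmetric])
      also have "\<dots> = emb L (\<lambda>x. Gf x + l *\<^sub>R V1 x)"
        using cont by (simp add: emb_add emb_scaleR continuous_on_scaleR)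
      finally show ?thesis .
    qed
    have comb: "p *\<^sub>R emb L f + q *\<^sub>R emb L g = emb L (\<lambda>x. p *\<^sub>R f x + q *\<^sub>R g x)"
      if "continuous_on {0..L} f" "continuous_on {0..L} g" for p q f g
      using that by (simp add: emb_add emb_scaleR continuous_on_scaleR)
    have wS: "wd S = emb L (\<lambda>x. (- (l * k3 / k1)) *\<^sub>R Gf x + (- (\<omega>\<^sup>2 * \<rho>1 / k1)) *\<^sub>R V1 x)"
    proof -
      have "(k1 / \<rho>1) *\<^sub>R wd S = - (l * k3 / \<rho>1) *\<^sub>R G + (- (\<omega>\<^sup>2)) *\<^sub>R v1"
        using eqs(1) unfolding comp(1) cc \<Theta>0 by (simp add: algebra_simps)
      then have "(\<rho>1 / k1) *\<^sub>R (k1 / \<rho>1) *\<^sub>R wd S = (\<rho>1 / k1) *\<^sub>R (- (l * k3 / \<rho>1) *\<^sub>R G + (- (\<omega>\<^sup>2)) *\<^sub>R v1)" by simp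
      then have "wd S = (- (l * k3 / k1)) *\<^sub>R G + (- (\<omega>\<^sup>2 * \<rho>1 / k1)) *\<^sub>R v1"
        using pos by (simp add: scaleR_add_right scaleR_diff_right mult.commute)
      also have "\<dots> = (- (l * k3 / k1)) *\<^sub>R emb L Gf + (- (\<omega>\<^sup>2 * \<rho>1 / k1)) *\<^sub>R emb L V1" by (simp only: emb rep[symmetric])
      finally show ?thesis unfolding comb[OF cont(6,1)] .
    qed
    have wR: "wd R = emb L (\<lambda>x. (k1 / k2) *\<^sub>R Sf x + (- (\<omega>\<^sup>2 * \<rho>2 / k2)) *\<^sub>R V3 x)"
    proof -
      have "(k2 / \<rho>2) *\<^sub>R wd R = (k1 / \<rho>2) *\<^sub>R S + (- (\<omega>\<^sup>2)) *\<^sub>R v3"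
        using eqs(2) unfolding comp(2) cc by (simp add: algebra_simps)
      then have "(\<rho>2 / k2) *\<^sub>R (k2 / \<rho>2) *\<^sub>R wd R = (\<rho>2 / k2) *\<^sub>R ((k1 / \<rho>2) *\<^sub>R S + (- (\<omega>\<^sup>2)) *\<^sub>R v3)" by simp
      then have "wd R = (k1 / k2) *\<^sub>R S + (- (\<omega>\<^sup>2 * \<rho>2 / k2)) *\<^sub>R v3"
        using pos by (simp add: scaleR_add_right scaleR_diff_right mult.commute)
      also have "\<dots> = (k1 / k2) *\<^sub>R emb L Sf + (- (\<omega>\<^sup>2 * \<rho>2 / k2)) *\<^sub>R emb L V3" by (simp only: emb rep[symmetric])
      finally show ?thesis unfolding comb[OF cont(4,2)] .
    qed
    have wG: "wd G = emb L (\<lambda>x. (l * k1 / k3) *\<^sub>R Sf x + (- (\<omega>\<^sup>2 * \<rho>1 / k3)) *\<^sub>R V5 x)"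
    proof -
      have "wd Q = k3 *\<^sub>R wd G" unfolding QG by (rule weak_deriv_scaleR[OF GH])
      then have "(k3 / \<rho>1) *\<^sub>R wd G = (l * k1 / \<rho>1) *\<^sub>R S + (- (\<omega>\<^sup>2)) *\<^sub>R v5"
        using eqs(3) unfolding comp(3) cc by (simp add: algebra_simps)
      then have "(\<rho>1 / k3) *\<^sub>R (k3 / \<rho>1) *\<^sub>R wd G = (\<rho>1 / k3) *\<^sub>R ((l * k1 / \<rho>1) *\<^sub>R S + (- (\<omega>\<^sup>2)) *\<^sub>R v5)" by simp
      then have "wd G = (l * k1 / k3) *\<^sub>R S + (- (\<omega>\<^sup>2 * \<rho>1 / k3)) *\<^sub>R v5"
        using pos by (simp add: scaleR_add_right scaleR_diff_right mult.commute)
      also have "\<dots> = (l * k1 / k3) *\<^sub>R emb L Sf + (- (\<omega>\<^sup>2 * \<rho>1 / k3)) *\<^sub>R emb L V5" by (simp only: emb rep[symmetric])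
      finally show ?thesis unfolding comb[OF cont(4,3)] .
    qed
    have G0: "Gf x = 0" if x: "x \<in> {\<alpha><..<\<beta>}" for x
    proof (rule AE_zero_imp_zero[OF _ _ x])
      \<comment> \<open>In an eigenvector the velocity strain inside the damping term is
        \<open>c\<close> times \<open>G\<close>, so absence of dissipation becomes a statement about
        \<open>G\<close>, as c \<noteq> 0.\<close>
      have "c *\<^sub>C (d \<odot> G) = 0"
      proof -
        have m: "c *\<^sub>C (p - q) = c *\<^sub>C p - c *\<^sub>C q" for p q :: L2
          using scaleC_add_right[of c "p - q" q] by (simp add: algebra_simps)
        have "wd v6 - l *\<^sub>R v2 = c *\<^sub>C G"
          unfolding comp G_def m weak_deriv_scaleC[OF H10_H1[OF D(5)]]
          by (simp add: scaleR_scaleC scaleC_scaleC mult.commute)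
        then show ?thesis using \<Theta>0 unfolding \<Theta>_def by (simp add: dm.fn_mult_scaleC)
      qed
      then have "norm (c *\<^sub>C (d \<odot> G)) = 0" by simp
      then have dG: "d \<odot> G = 0" using False by (simp add: norm_scaleC c_def complex_norm)
      show "AE x in lborel. x \<in> {\<alpha><..<\<beta>} \<longrightarrow> Gf x = 0"
        using dm.rep_fn_mult[of G] rep_L2_zero rep_emb[OF cont(6)] unfolding dG emb(3)[symmetric]
      proof eventually_elim
        case (elim x)
        then show ?case using damped by (auto simp: damping_def)
      qed
      show "continuous_on {\<alpha><..<\<beta>} Gf" by (rule continuous_on_subset[OF cont(6)]) (use damped in auto)
    qed
    have sh: "((\<lambda>x. k + f x) has_vector_derivative f') (at x)" if "(f has_vector_derivative f') (at x)"
      for f :: "real \<Rightarrow> complex" and f' k x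
      using has_vector_derivative_add[OF has_vector_derivative_const[of k] that] by simp
    have dV1: "(V1 has_vector_derivative (Sf x - V3 x - l *\<^sub>R V5 x)) (at x)" if "x \<in> {0<..<L}" for x
      unfolding V1_def w1
      by (rule prim_emb_deriv[OF _ that]) (intro continuous_on_diff continuous_on_scaleR continuous_on_const cont)
    have dV3: "(V3 has_vector_derivative Rf x) (at x)" if "x \<in> {0<..<L}" for x
      unfolding V3_def w3 by (rule prim_emb_deriv[OF cont(5) that])
    have dV5: "(V5 has_vector_derivative (Gf x + l *\<^sub>R V1 x)) (at x)" if "x \<in> {0<..<L}" for x
      unfolding V5_def w5
      by (rule prim_emb_deriv[OF _ that]) (intro continuous_on_add continuous_on_scaleR continuous_on_const cont)
    have dSf: "(Sf has_vector_derivative ((- (l * k3 / k1)) *\<^sub>R Gf x + (- (\<omega>\<^sup>2 * \<rho>1 / k1)) *\<^sub>R V1 x)) (at x)"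
      if "x \<in> {0<..<L}" for x
      unfolding Sf_def[abs_def] wS
      by (rule sh, rule prim_emb_deriv[OF _ that]) (intro continuous_on_add continuous_on_scaleR continuous_on_const cont)
    have dRf: "(Rf has_vector_derivative ((k1 / k2) *\<^sub>R Sf x + (- (\<omega>\<^sup>2 * \<rho>2 / k2)) *\<^sub>R V3 x)) (at x)"
      if "x \<in> {0<..<L}" for x
      unfolding Rf_def[abs_def] wR
      by (rule sh, rule prim_emb_deriv[OF _ that]) (intro continuous_on_add continuous_on_scaleR continuous_on_const cont)
    have dGf: "(Gf has_vector_derivative ((l * k1 / k3) *\<^sub>R Sf x + (- (\<omega>\<^sup>2 * \<rho>1 / k3)) *\<^sub>R V5 x)) (at x)"
      if "x \<in> {0<..<L}" for x
      unfolding Gf_def[abs_def] wG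
      by (rule sh, rule prim_emb_deriv[OF _ that]) (intro continuous_on_add continuous_on_scaleR continuous_on_const cont)
    \<comment> \<open>The contributions of the derivatives of \<open>Sf\<close> and
      \<open>V5\<close> are equal and of the same sign; l > 0 and \<omega> \<noteq> 0 make their sum
      nonzero.\<close>
    have "(l * k1 / k3) * (- (\<omega>\<^sup>2 * \<rho>1 / k1)) + (- (\<omega>\<^sup>2 * \<rho>1 / k3)) * l = - (2 * l * \<omega>\<^sup>2 * \<rho>1 / k3)"
      using pos by (simp add: field_simps)
    then have nz: "(l * k1 / k3) * (- (\<omega>\<^sup>2 * \<rho>1 / k1)) + (- (\<omega>\<^sup>2 * \<rho>1 / k3)) * l \<noteq> 0"
      using pos False by simp
    have "V3 0 = 0" "V5 0 = 0" by (simp_all add: V3_def V5_def prim_0)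
    note V0 = bresse_ode_vanish[OF damped(1-3) dV1 dV3 dV5 dSf dRf dGf nz G0 cont(1-3) this]
    have z: "emb L f = 0" if "continuous_on {0..L} f" "\<And>x. x \<in> {0..L} \<Longrightarrow> f x = 0" for f
      using norm_emb_le[OF that(1), of 0] that(2) L by simp
    have "v1 = 0" "v3 = 0" "v5 = 0"
      using z[OF cont(1) V0(1)] z[OF cont(2) V0(2)] z[OF cont(3) V0(3)] rep by simp_all
    then show ?thesis using comp by (simp add: Ut zero_prod_def)
  qed
qed

end

section \<open>Transfer of the abstract stability result to the energy space\<close>

locale bresse_semigroup = bresse +
  fixes T :: "real \<Rightarrow> state \<Rightarrow> state"
  assumes sg: "C0_contraction_semigroup X N T" and gn: "is_generator X N T Dom A"
begin

text \<open>The transport of \<open>T\<close> along the isometry \<open>J\<close>; off the image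
  \<open>inv_into\<close> returns an arbitrary value.\<close>

definition T_on_image :: "real \<Rightarrow> state \<Rightarrow> state"
  where "T_on_image t h = J (T t (inv_into X J h))"

lemma T_on_image_J: "U \<in> X \<Longrightarrow> T_on_image t (J U) = J (T t U)"
  by (simp add: T_on_image_def inv_into_f_f[OF inj_on_J])

lemma T_X: "0 \<le> t \<Longrightarrow> U \<in> X \<Longrightarrow> T t U \<in> X"
  using sg by (simp add: C0_contraction_semigroup_def)

lemma T_scaleC: "0 \<le> t \<Longrightarrow> U \<in> X \<Longrightarrow> T t (c *\<^sub>C U) = c *\<^sub>C T t U"
  using sg by (simp add: C0_contraction_semigroup_def)

sublocale cs: contraction_semigroup "J ` X" T_on_image
proof
  show "subspace (J ` X)" "closed (J ` X)" by (rule subspace_JX closed_JX)+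
  show "T_on_image t u \<in> J ` X" if "0 \<le> t" "u \<in> J ` X" for t u
    using that T_X by (auto simp: T_on_image_J)
  show "T_on_image t (u + v) = T_on_image t u + T_on_image t v" if t: "0 \<le> t" and uv: "u \<in> J ` X" "v \<in> J ` X" for t u v
  proof -
    obtain U V where "u = J U" "U \<in> X" "v = J V" "V \<in> X" using uv by blast
    then show ?thesis using sg t by (simp add: J_add[symmetric] T_on_image_J X_add T_X C0_contraction_semigroup_def)
  qed
  show "T_on_image t (c *\<^sub>R u) = c *\<^sub>R T_on_image t u" if t: "0 \<le> t" and u: "u \<in> J ` X" for t u c
  proof -
    obtain U where "u = J U" "U \<in> X" using u by blast
    then show ?thesis using t by (simp add: J_scaleR[symmetric] T_on_image_J X_scaleR T_X) (simp add: scaleR_scaleC T_scaleC)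
  qed
  show "T_on_image 0 u = u" if "u \<in> J ` X" for u
    using that sg by (auto simp: T_on_image_J C0_contraction_semigroup_def)
  show "T_on_image (s + t) u = T_on_image s (T_on_image t u)" if "0 \<le> s" "0 \<le> t" "u \<in> J ` X" for s t u
    using that sg by (auto simp: T_on_image_J T_X C0_contraction_semigroup_def)
  show "((\<lambda>t. T_on_image t u) \<longlongrightarrow> u) (at_right 0)" if u: "u \<in> J ` X" for u
  proof -
    obtain U where U: "u = J U" "U \<in> X" using u by blast
    have "((\<lambda>t. N (T t U - U)) \<longlongrightarrow> 0) (at_right 0)" using sg U by (simp add: C0_contraction_semigroup_def)
    moreover have "\<forall>\<^sub>F t in at_right 0. N (T t U - U) = norm (T_on_image t u - u)"
      using U by (auto simp: eventually_at_right_field norm_J[symmetric] X_diff T_X J_diff T_on_image_J intro!: exI[of _ 1])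
    ultimately have "((\<lambda>t. norm (T_on_image t u - u)) \<longlongrightarrow> 0) (at_right 0)" by (rule Lim_transform_eventually)
    then show ?thesis by (simp add: tendsto_norm_zero_iff LIM_zero_iff)
  qed
  show "norm (T_on_image t u) \<le> norm u" if t: "0 \<le> t" and u: "u \<in> J ` X" for t u
  proof -
    obtain U where U: "u = J U" "U \<in> X" using u by blast
    then show ?thesis using sg t by (simp add: T_on_image_J norm_J T_X C0_contraction_semigroup_def)
  qed
qed

text \<open>\<open>is_generator\<close> equates graphs, so membership in \<open>Dom\<close> is
  equivalent to existence of the limit in the energy norm, and \<open>J\<close> turns that norm into
  the Hilbert space norm.\<close>

lemma gen_J_iff:
  assumes "U \<in> X" "V \<in> X"
  shows "cs.gen (J U) (J V) \<longleftrightarrow> U \<in> Dom \<and> V = A U"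
proof -
  have ev: "\<forall>\<^sub>F h in at_right 0. N ((1 / h) *\<^sub>R (T h U - U) - V) = norm ((1 / h) *\<^sub>R (T_on_image h (J U) - J U) - J V)"
    using assms
    by (auto simp: eventually_at_right_field norm_J[symmetric] X_diff X_scaleR T_X J_diff J_scaleR T_on_image_J intro!: exI[of _ 1])
  have "cs.gen (J U) (J V) \<longleftrightarrow> ((\<lambda>h. norm ((1 / h) *\<^sub>R (T_on_image h (J U) - J U) - J V)) \<longlongrightarrow> 0) (at_right 0)"
    using assms unfolding cs.gen_def tendsto_norm_zero_iff LIM_zero_iff by simp
  also have "\<dots> \<longleftrightarrow> ((\<lambda>h. N ((1 / h) *\<^sub>R (T h U - U) - V)) \<longlongrightarrow> 0) (at_right 0)"
    by (rule tendsto_cong[OF ev, symmetric])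
  also have "\<dots> \<longleftrightarrow> (U, V) \<in> {(u, w). u \<in> X \<and> w \<in> X \<and> ((\<lambda>h. N ((1 / h) *\<^sub>R (T h u - u) - w)) \<longlongrightarrow> 0) (at_right 0)}"
    using assms by simp
  also have "\<dots> \<longleftrightarrow> (U, V) \<in> {(u, A u) | u. u \<in> Dom}"
    by (simp only: gn[unfolded is_generator_def])
  finally show ?thesis by blast
qed

lemma A_X: "U \<in> Dom \<Longrightarrow> A U \<in> X"
  using gn unfolding is_generator_def by blast

lemma gen_cases:
  assumes "cs.gen h w"
  obtains U where "U \<in> Dom" "h = J U" "w = J (A U)"
proof -
  obtain U V where "U \<in> X" "h = J U" "V \<in> X" "w = J V" using cs.gen_in[OF assms] by blast
  then show ?thesis using that gen_J_iff assms by metis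
qed

text \<open>The abstract locale knows real scalars only. Complex linearity of the domain and of
  \<open>A\<close> is read off from that of the semigroup, with no recourse to the formulas for the
  operator.\<close>

lemma gen_scaleC:
  assumes "U \<in> Dom" shows "c *\<^sub>C U \<in> Dom" "A (c *\<^sub>C U) = c *\<^sub>C A U"
proof -
  have X: "U \<in> X" "A U \<in> X" using assms Dom_X A_X by auto
  have m: "c *\<^sub>C (p - q) = c *\<^sub>C p - c *\<^sub>C q" for p q :: state
    using scaleC_add_right[of c "p - q" q] by (simp add: algebra_simps)
  have r: "r *\<^sub>R c *\<^sub>C x = c *\<^sub>C r *\<^sub>R x" for r and x :: state
    by (simp add: scaleR_scaleC scaleC_scaleC mult.commute)
  have "cs.gen (J U) (J (A U))" using gen_J_iff[OF X] assms by simp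
  then have "((\<lambda>h. norm ((1 / h) *\<^sub>R (T_on_image h (J U) - J U) - J (A U))) \<longlongrightarrow> 0) (at_right 0)"
    unfolding cs.gen_def tendsto_norm_zero_iff LIM_zero_iff by simp
  then have "((\<lambda>h. cmod c * norm ((1 / h) *\<^sub>R (T_on_image h (J U) - J U) - J (A U))) \<longlongrightarrow> 0) (at_right 0)"
    by (rule tendsto_mult_right_zero)
  moreover have "\<forall>\<^sub>F h in at_right 0. cmod c * norm ((1 / h) *\<^sub>R (T_on_image h (J U) - J U) - J (A U))
      = norm ((1 / h) *\<^sub>R (T_on_image h (J (c *\<^sub>C U)) - J (c *\<^sub>C U)) - J (c *\<^sub>C A U))"
  proof -
    have "cmod c * norm ((1 / h) *\<^sub>R (T_on_image h (J U) - J U) - J (A U))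
        = norm ((1 / h) *\<^sub>R (T_on_image h (J (c *\<^sub>C U)) - J (c *\<^sub>C U)) - J (c *\<^sub>C A U))" if "h > 0" for h
      unfolding norm_scaleC_state[symmetric] m r[symmetric]
      using X that by (simp add: T_on_image_J X_scaleC T_scaleC J_scaleC[symmetric] T_X)
    then show ?thesis by (auto simp: eventually_at_right_field intro!: exI[of _ 1])
  qed
  ultimately have "((\<lambda>h. norm ((1 / h) *\<^sub>R (T_on_image h (J (c *\<^sub>C U)) - J (c *\<^sub>C U)) - J (c *\<^sub>C A U))) \<longlongrightarrow> 0) (at_right 0)"
    by (rule Lim_transform_eventually)
  then have "cs.gen (J (c *\<^sub>C U)) (J (c *\<^sub>C A U))"
    using X X_scaleC unfolding cs.gen_def tendsto_norm_zero_iff LIM_zero_iff by simp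
  then show "c *\<^sub>C U \<in> Dom" "A (c *\<^sub>C U) = c *\<^sub>C A U"
    using gen_J_iff[OF X_scaleC[OF X(1)] X_scaleC[OF X(2)], of c c] by auto
qed

lemma gen_add:
  assumes "U \<in> Dom" "V \<in> Dom" shows "U + V \<in> Dom" "A (U + V) = A U + A V"
proof -
  have X: "U \<in> X" "A U \<in> X" "V \<in> X" "A V \<in> X" using assms Dom_X A_X by auto
  have "cs.gen (J U + J V) (J (A U) + J (A V))"
    using cs.gen_add gen_J_iff[OF X(1,2)] gen_J_iff[OF X(3,4)] assms by blast
  then show "U + V \<in> Dom" "A (U + V) = A U + A V"
    using gen_J_iff[OF X_add[OF X(1,3)] X_add[OF X(2,4)]] by (simp_all add: J_add X)
qed

text \<open>From \<open>A\<^sup>2 U = - m\<^sup>2 U\<close> either \<open>A U + \<i> m U\<close> or \<open>U\<close> itself is an eigenvector on the imaginary axis.\<close>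

lemma no_square_eigenvector:
  assumes "cs.gen y p" "cs.gen p (- (m\<^sup>2) *\<^sub>R y)"
  shows "y = 0"
proof -
  obtain U where U: "U \<in> Dom" "y = J U" "p = J (A U)" using gen_cases[OF assms(1)] by metis
  have X: "U \<in> X" "A U \<in> X" using U Dom_X A_X by auto
  have e: "- (m\<^sup>2) *\<^sub>R y = J (- (m\<^sup>2) *\<^sub>R U)" unfolding U(2) by (rule J_scaleR[OF X(1), symmetric])
  have g: "cs.gen (J (A U)) (J (- (m\<^sup>2) *\<^sub>R U))" using assms(2) unfolding e U(3) .
  have AU: "A U \<in> Dom" "- (m\<^sup>2) *\<^sub>R U = A (A U)"
    using gen_J_iff[THEN iffD1, OF X(2) X_scaleR[OF X(1)] g] by blast+
  define c where "c = Complex 0 m"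
  have cc: "c *\<^sub>C c *\<^sub>C U = - (m\<^sup>2) *\<^sub>R U"
  proof -
    have "c * c = of_real (- (m\<^sup>2))" by (simp add: c_def complex_eq_iff power2_eq_square)
    then show ?thesis by (simp add: scaleC_scaleC scaleR_scaleC)
  qed
  \<comment> \<open>A^2 + m^2 factors as (A - c)(A + c) with c = i m, so (A + c) U is an eigenvector
    for \<open>c\<close> or 0. It must be 0, and then U itself has eigenvalue - c. The case m = 0 is
    included.\<close>
  define Z where "Z = A U + c *\<^sub>C U"
  have "Z \<in> Dom" "A Z = c *\<^sub>C Z"
    using gen_add[OF AU(1) gen_scaleC(1)[OF U(1), of c]] gen_scaleC(2)[OF U(1), of c] AU(2) cc
    by (simp_all add: Z_def scaleC_add_right add.commute)
  then have "Z = 0" unfolding c_def by (rule no_imaginary_eigenvector)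
  then have "A U = - (c *\<^sub>C U)" by (simp add: Z_def eq_neg_iff_add_eq_0)
  also have "\<dots> = Complex 0 (- m) *\<^sub>C U"
    unfolding c_def scaleC_Complex by simp
  finally have "U = 0" by (rule no_imaginary_eigenvector[OF U(1)])
  then show ?thesis using U(2) J_diff[OF X_zero X_zero] by simp
qed

lemma semigroup_strongly_stable:
  assumes U: "U \<in> X"
  shows "((\<lambda>t. N (T t U)) \<longlongrightarrow> 0) at_top"
proof -
  have "((\<lambda>t. T_on_image t (J U)) \<longlongrightarrow> 0) at_top"
  proof (rule cs.strongly_stable)
    show "\<exists>r w. strict_mono (r :: nat \<Rightarrow> nat) \<and> (H \<circ> r) \<longlonglongrightarrow> w"
      if g: "\<And>n. cs.gen (H n) (W n)" and b: "bounded (range H)" "bounded (range W)"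
        and lim: "(\<lambda>n. inner (W n) (H n)) \<longlonglongrightarrow> 0" for H W :: "nat \<Rightarrow> state"
    proof -
      have "\<exists>V. V \<in> Dom \<and> H n = J V \<and> W n = J (A V)" for n using gen_cases[OF g] by metis
      then obtain V where V: "\<And>n. V n \<in> Dom" "\<And>n. H n = J (V n)" "\<And>n. W n = J (A (V n))" by metis
      have HW: "H = (\<lambda>n. J (V n))" "W = (\<lambda>n. J (A (V n)))" using V by auto
      have "seq_precompact (\<lambda>n. J (V n))"
        by (rule compactness) (use V(1) b lim in \<open>simp_all only: HW\<close>)
      then obtain s w where "strict_mono (s :: nat \<Rightarrow> nat)" "(\<lambda>n. J (V (id (s n)))) \<longlonglongrightarrow> w"
        unfolding seq_precompact_def using strict_mono_id by blast
      then show ?thesis by (intro exI[of _ s] exI[of _ w]) (simp add: HW o_def)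
    qed
    show "y = 0" if "cs.gen y p" "cs.gen p (- (m\<^sup>2) *\<^sub>R y)" for y p m
      using no_square_eigenvector[OF that] .
    show "J U \<in> J ` X" using U by simp
  qed
  then have "((\<lambda>t. norm (T_on_image t (J U))) \<longlongrightarrow> 0) at_top" by (rule tendsto_norm_zero)
  moreover have "\<forall>\<^sub>F t in at_top. norm (T_on_image t (J U)) = N (T t U)"
    using U by (auto simp: eventually_at_top_linorder T_on_image_J norm_J T_X intro!: exI[of _ 0])
  ultimately show ?thesis by (rule Lim_transform_eventually)
qed

end

theorem theorem3p1:
  fixes \<rho>1 \<rho>2 k1 k2 k3 l L \<alpha> \<beta> d0 :: real
    and T :: "real \<Rightarrow> state \<Rightarrow> state"
  assumes "0 < \<rho>1" "0 < \<rho>2" "0 < k1" "0 < k2" "0 < k3" "0 < l" "0 < L"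
    and "0 < \<alpha>" "\<alpha> < \<beta>" "\<beta> < L" "0 < d0"
    and "C0_contraction_semigroup (bresse_space L) (bresse_norm \<rho>1 \<rho>2 k1 k2 k3 l L) T"
    and "is_generator (bresse_space L) (bresse_norm \<rho>1 \<rho>2 k1 k2 k3 l L) T
      (bresse_dom k3 l L (damping \<alpha> \<beta> d0))
      (bresse_op \<rho>1 \<rho>2 k1 k2 k3 l L (damping \<alpha> \<beta> d0))"
  shows "\<forall>U0 \<in> bresse_space L.
    ((\<lambda>t. bresse_norm \<rho>1 \<rho>2 k1 k2 k3 l L (T t U0)) \<longlongrightarrow> 0) at_top"
proof -
  interpret bresse_semigroup \<rho>1 \<rho>2 k1 k2 k3 l L \<alpha> \<beta> d0 T
    by unfold_locales (fact assms)+
  show ?thesis using semigroup_strongly_stable by blast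
qed

end
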